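(* Let $T$ be the $C_0$-semigroup on $L_2(0,\infty)$ generated by the Dirichlet Laplacian on $(0,\infty)$. Let $V\colon(0,\infty)\to\mathbb{R}$ be measurable and $T$-admissible, and assume that $V\leqslant0$. Let $\alpha\in(0,1)$. Further, assume that for every $t>0$ the operator $T_V(t)$ has an integral kernel $k_t^V\in L_\infty((0,\infty)\times(0,\infty))$ such that, for some $c>0$ independent of $t$, $$0\leqslant k_t^V(x,y)\leqslant c\left(1\wedge\left(\frac{xy}{t}\left(1+\frac{(x-y)^2}{4t}\right)^{3\alpha/4}\right)\right)t^{-1/2}e^{-(x-y)^2/4t}$$ for all $t>0$ and a.e. $x,y\in(0,\infty)$. Then $$\int_0^\infty x|V(x)|\,dx<\infty.$$
   Context: The scalar field is $\mathbb{K}\in\{\mathbb{R},\mathbb{C}\}$. $a\wedge b$, $a\vee b$ denote minimum and maximum (also pointwise for functions). Dirichlet Laplacian on $(0,\infty)$: $\operatorname{dom}(\Delta_{\mathrm D})=\{u\in H_0^1(0,\infty): \Delta u\in L_2(0,\infty)\}$, $\Delta_{\mathrm D}u=\Delta u$ (distributional; $\Delta u=u''$). The semigroup $T$ is positive, i.e. each $T(t)$ maps nonnegative functions to nonnegative functions. Admissibility. Let $T$ be a positive $C_0$-semigroup on $L_2(\mu)$ with generator $A$. For real-valued $V\in L_\infty(\mu)$, $T_V$ is the $C_0$-semigroup generated by $A-V$ ($V$ acting as multiplication operator). A measurable (finite-valued) $V\leqslant0$ is $T$-admissible if $T_V(t):=\operatorname{s-lim}_{n\to\infty}T_{V\vee(-n)}(t)$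 exists for all $t\geqslant0$ and $T_V$ thus defined is a $C_0$-semigroup. $k_t^V$ is an integral kernel of $T_V(t)$ if $T_V(t)f(x)=\int_0^\infty k_t^V(x,y)f(y)\,dy$ for all $f\in L_2(0,\infty)$ and a.e. $x\in(0,\infty)$. *)

theory Defs
  imports "HOL-Analysis.Analysis"
begin

section \<open>The space of square-integrable functions on the half-line\<close>

text \<open>
  Throughout, \<open>'k\<close> of sort \<open>{real_normed_field, euclidean_space}\<close> is the scalar field. Up to
  isometric isomorphism the only such types are \<open>real\<close> and \<open>complex\<close>.
\<close>

abbreviation halfline :: "real measure" where
  "halfline \<equiv> lebesgue_on {0<..}"

definition sq_integrable :: "(real \<Rightarrow> 'k::{real_normed_field, euclidean_space}) \<Rightarrow> bool" where
  "sq_integrable f \<longleftrightarrow>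
     f \<in> borel_measurable halfline \<and> integrable halfline (\<lambda>x. (norm (f x))\<^sup>2)"

lemma sq_integrable_zero: "sq_integrable (\<lambda>_. 0)"
  by (simp add: sq_integrable_def)

lemma sq_integrable_mult_norm:
  assumes "sq_integrable f" "sq_integrable g"
  shows "integrable halfline (\<lambda>x. norm (f x) * norm (g x))"
proof (rule Bochner_Integration.integrable_bound)
  show "integrable halfline (\<lambda>x. (norm (f x))\<^sup>2 + (norm (g x))\<^sup>2)"
    using assms by (auto simp: sq_integrable_def)
  show "(\<lambda>x. norm (f x) * norm (g x)) \<in> borel_measurable halfline"
    using assms by (auto simp: sq_integrable_def)
  have "norm (f x) * norm (g x) \<le> (norm (f x))\<^sup>2 + (norm (g x))\<^sup>2" for x
    using sum_squares_bound[of "norm (f x)" "norm (g x)"]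
      mult_nonneg_nonneg[OF norm_ge_zero[of "f x"] norm_ge_zero[of "g x"]] by linarith
  then show "AE x in halfline.
      norm (norm (f x) * norm (g x)) \<le> norm ((norm (f x))\<^sup>2 + (norm (g x))\<^sup>2)"
    by (auto simp: abs_mult)
qed

lemma sq_integrable_add:
  assumes "sq_integrable f" "sq_integrable g"
  shows "sq_integrable (\<lambda>x. f x + g x)"
  unfolding sq_integrable_def
proof
  show m: "(\<lambda>x. f x + g x) \<in> borel_measurable halfline"
    using assms by (auto simp: sq_integrable_def)
  show "integrable halfline (\<lambda>x. (norm (f x + g x))\<^sup>2)"
  proof (rule Bochner_Integration.integrable_bound)
    show "integrable halfline
        (\<lambda>x. (norm (f x))\<^sup>2 + (norm (g x))\<^sup>2 + 2 * (norm (f x) * norm (g x)))"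
      using assms sq_integrable_mult_norm[OF assms] by (auto simp: sq_integrable_def)
    show "(\<lambda>x. (norm (f x + g x))\<^sup>2) \<in> borel_measurable halfline"
      using m by measurable
    have "(norm (f x + g x))\<^sup>2 \<le> (norm (f x))\<^sup>2 + (norm (g x))\<^sup>2 + 2 * (norm (f x) * norm (g x))" for x
      using power_mono[OF norm_triangle_ineq[of "f x" "g x"], of 2]
      by (simp add: power2_sum mult.assoc)
    then show "AE x in halfline. norm ((norm (f x + g x))\<^sup>2) \<le>
        norm ((norm (f x))\<^sup>2 + (norm (g x))\<^sup>2 + 2 * (norm (f x) * norm (g x)))"
      by (auto intro: order_trans[OF _ abs_ge_self])
  qed
qed

lemma sq_integrable_mult:
  "sq_integrable f \<Longrightarrow> sq_integrable (\<lambda>x. c * f x)"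
  by (auto simp: sq_integrable_def norm_mult power_mult_distrib)

lemma sq_integrable_scaleR:
  "sq_integrable f \<Longrightarrow> sq_integrable (\<lambda>x. r *\<^sub>R f x)"
  by (auto simp: sq_integrable_def power_mult_distrib)

lemma sq_integrable_minus:
  "sq_integrable f \<Longrightarrow> sq_integrable (\<lambda>x. - f x)"
  by (auto simp: sq_integrable_def)

lemma sq_integrable_diff:
  "sq_integrable f \<Longrightarrow> sq_integrable g \<Longrightarrow> sq_integrable (\<lambda>x. f x - g x)"
  using sq_integrable_add[OF _ sq_integrable_minus] by fastforce

definition norm2 :: "(real \<Rightarrow> 'k::{real_normed_field, euclidean_space}) \<Rightarrow> real" where
  "norm2 f = sqrt (\<integral>x. (norm (f x))\<^sup>2 \<partial>halfline)"

lemma norm2_nonneg: "0 \<le> norm2 f"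
  by (simp add: norm2_def)

lemma norm2_sq: "(norm2 f)\<^sup>2 = (\<integral>x. (norm (f x))\<^sup>2 \<partial>halfline)"
  by (simp add: norm2_def)

lemma norm2_cong:
  assumes "sq_integrable f" "sq_integrable g" "AE x in halfline. f x = g x"
  shows "norm2 f = norm2 g"
proof -
  have "(\<integral>x. (norm (f x))\<^sup>2 \<partial>halfline) = (\<integral>x. (norm (g x))\<^sup>2 \<partial>halfline)"
    using assms by (intro integral_cong_AE) (auto simp: sq_integrable_def)
  then show ?thesis by (simp add: norm2_def)
qed

lemma norm2_eq_0_iff:
  assumes "sq_integrable f"
  shows "norm2 f = 0 \<longleftrightarrow> (AE x in halfline. f x = 0)"
proof -
  have "norm2 f = 0 \<longleftrightarrow> (\<integral>x. (norm (f x))\<^sup>2 \<partial>halfline) = 0"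
    by (simp add: norm2_def)
  also have "\<dots> \<longleftrightarrow> (AE x in halfline. (norm (f x))\<^sup>2 = 0)"
    using assms by (intro integral_nonneg_eq_0_iff_AE) (auto simp: sq_integrable_def)
  finally show ?thesis by simp
qed

lemma integral_norm_mult_le:
  assumes f: "sq_integrable f" and g: "sq_integrable g"
  shows "(\<integral>x. norm (f x) * norm (g x) \<partial>halfline) \<le> norm2 f * norm2 g"
proof (cases "norm2 f = 0 \<or> norm2 g = 0")
  case True
  then have "AE x in halfline. norm (f x) * norm (g x) = 0"
    using norm2_eq_0_iff[OF f] norm2_eq_0_iff[OF g] by auto
  then have "(\<integral>x. norm (f x) * norm (g x) \<partial>halfline) = 0"
    by (rule integral_eq_zero_AE)
  then show ?thesis by (simp add: norm2_nonneg)
next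
  case False
  then have A: "norm2 f > 0" and B: "norm2 g > 0"
    using norm2_nonneg[of f] norm2_nonneg[of g] by auto
  let ?A = "norm2 f" and ?B = "norm2 g"
  have pt: "norm (f x) * norm (g x) \<le>
      (?B / (2 * ?A)) * (norm (f x))\<^sup>2 + (?A / (2 * ?B)) * (norm (g x))\<^sup>2" for x
  proof -
    have "0 \<le> (?B * norm (f x) - ?A * norm (g x))\<^sup>2 / (2 * ?A * ?B)"
      using A B by simp
    then show ?thesis using A B
      by (simp add: power2_eq_square field_simps)
  qed
  have "(\<integral>x. norm (f x) * norm (g x) \<partial>halfline) \<le>
      (\<integral>x. (?B / (2 * ?A)) * (norm (f x))\<^sup>2 + (?A / (2 * ?B)) * (norm (g x))\<^sup>2 \<partial>halfline)"
    using f g pt sq_integrable_mult_norm[OF f g]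
    by (intro integral_mono) (auto simp: sq_integrable_def)
  also have "\<dots> = (?B / (2 * ?A)) * ?A\<^sup>2 + (?A / (2 * ?B)) * ?B\<^sup>2"
    using f g unfolding norm2_sq
    by (subst Bochner_Integration.integral_add) (auto simp: sq_integrable_def)
  also have "\<dots> = ?A * ?B"
    using A B by (simp add: power2_eq_square field_simps)
  finally show ?thesis .
qed

lemma norm2_triangle:
  assumes f: "sq_integrable f" and g: "sq_integrable g"
  shows "norm2 (\<lambda>x. f x + g x) \<le> norm2 f + norm2 g"
proof (rule power2_le_imp_le)
  have pt: "(norm (f x + g x))\<^sup>2 \<le>
      (norm (f x))\<^sup>2 + (norm (g x))\<^sup>2 + 2 * (norm (f x) * norm (g x))" for x
    using power_mono[OF norm_triangle_ineq[of "f x" "g x"], of 2]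
    by (simp add: power2_sum mult.assoc)
  have "(norm2 (\<lambda>x. f x + g x))\<^sup>2 \<le>
      (\<integral>x. (norm (f x))\<^sup>2 + (norm (g x))\<^sup>2 + 2 * (norm (f x) * norm (g x)) \<partial>halfline)"
    unfolding norm2_sq
    using f g pt sq_integrable_add[OF f g] sq_integrable_mult_norm[OF f g]
    by (intro integral_mono) (auto simp: sq_integrable_def)
  also have "\<dots> = (norm2 f)\<^sup>2 + (norm2 g)\<^sup>2
      + 2 * (\<integral>x. norm (f x) * norm (g x) \<partial>halfline)"
    using f g sq_integrable_mult_norm[OF f g] unfolding norm2_sq
    by (simp add: sq_integrable_def)
  also have "\<dots> \<le> (norm2 f + norm2 g)\<^sup>2"
    using integral_norm_mult_le[OF f g] by (simp add: power2_sum)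
  finally show "(norm2 (\<lambda>x. f x + g x))\<^sup>2 \<le> (norm2 f + norm2 g)\<^sup>2" .
qed (simp add: norm2_nonneg)

definition l2_rel ::
  "(real \<Rightarrow> 'k::{real_normed_field, euclidean_space}) \<Rightarrow> (real \<Rightarrow> 'k) \<Rightarrow> bool" where
  "l2_rel f g \<longleftrightarrow> sq_integrable f \<and> sq_integrable g \<and> (AE x in halfline. f x = g x)"

lemma part_equivp_l2_rel: "part_equivp l2_rel"
proof (rule part_equivpI)
  show "\<exists>f. l2_rel f f"
    using sq_integrable_zero by (auto simp: l2_rel_def)
  show "symp l2_rel"
    by (auto simp: symp_def l2_rel_def elim: eventually_mono)
  show "transp l2_rel"
    unfolding transp_def l2_rel_def by (auto elim: eventually_elim2)
qed

quotient_type (overloaded) 'k l2 =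
  "real \<Rightarrow> 'k::{real_normed_field, euclidean_space}" / partial: l2_rel
  by (rule part_equivp_l2_rel)

text \<open>\<open>fn_of u\<close> is some representative of the class \<open>u\<close>; it is determined up to null sets only.\<close>

definition fn_of :: "'k::{real_normed_field, euclidean_space} l2 \<Rightarrow> real \<Rightarrow> 'k" where
  "fn_of u = rep_l2 u"

lift_definition scale_l2 ::
  "'k::{real_normed_field, euclidean_space} \<Rightarrow> 'k l2 \<Rightarrow> 'k l2" is "\<lambda>c f x. c * f x"
  by (auto simp: l2_rel_def sq_integrable_mult elim: eventually_mono)

instantiation l2 :: ("{real_normed_field, euclidean_space}") real_normed_vector
begin

lift_definition zero_l2 :: "'a l2" is "\<lambda>_. 0"
  by (simp add: l2_rel_def sq_integrable_zero)

lift_definition plus_l2 :: "'a l2 \<Rightarrow> 'a l2 \<Rightarrow> 'a l2" is "\<lambda>f g x. f x + g x"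
  by (auto simp: l2_rel_def sq_integrable_add elim: eventually_elim2)

lift_definition uminus_l2 :: "'a l2 \<Rightarrow> 'a l2" is "\<lambda>f x. - f x"
  by (auto simp: l2_rel_def sq_integrable_minus elim: eventually_mono)

lift_definition minus_l2 :: "'a l2 \<Rightarrow> 'a l2 \<Rightarrow> 'a l2" is "\<lambda>f g x. f x - g x"
  by (auto simp: l2_rel_def sq_integrable_diff elim: eventually_elim2)

lift_definition scaleR_l2 :: "real \<Rightarrow> 'a l2 \<Rightarrow> 'a l2" is "\<lambda>r f x. r *\<^sub>R f x"
  by (auto simp: l2_rel_def sq_integrable_scaleR elim: eventually_mono)

lift_definition norm_l2 :: "'a l2 \<Rightarrow> real" is norm2
  by (auto simp: l2_rel_def intro: norm2_cong)

definition sgn_l2 :: "'a l2 \<Rightarrow> 'a l2" where "sgn_l2 u = inverse (norm u) *\<^sub>R u"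

definition dist_l2 :: "'a l2 \<Rightarrow> 'a l2 \<Rightarrow> real" where "dist_l2 u v = norm (u - v)"

definition uniformity_l2 :: "('a l2 \<times> 'a l2) filter" where
  "uniformity_l2 = (INF e\<in>{0<..}. principal {(u, v). dist u v < e})"

definition open_l2 :: "'a l2 set \<Rightarrow> bool" where
  "open_l2 U \<longleftrightarrow> (\<forall>u\<in>U. eventually (\<lambda>(u', v). u' = u \<longrightarrow> v \<in> U) uniformity)"

instance
proof
  fix u v w :: "'a l2" and r s :: real
  show "u + v + w = u + (v + w)"
    by transfer (auto simp: l2_rel_def add.assoc sq_integrable_add)
  show "u + v = v + u"
    by transfer (auto simp: l2_rel_def add.commute sq_integrable_add)
  show "0 + u = u"
    by transfer (auto simp: l2_rel_def)
  show "- u + u = 0"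
    by transfer (auto simp: l2_rel_def sq_integrable_zero)
  show "u - v = u + - v"
    by transfer (auto simp: l2_rel_def sq_integrable_diff)
  show "r *\<^sub>R (u + v) = r *\<^sub>R u + r *\<^sub>R v"
    by transfer (auto simp: l2_rel_def scaleR_add_right sq_integrable_scaleR sq_integrable_add)
  show "(r + s) *\<^sub>R u = r *\<^sub>R u + s *\<^sub>R u"
    by transfer (auto simp: l2_rel_def scaleR_add_left sq_integrable_scaleR sq_integrable_add)
  show "r *\<^sub>R s *\<^sub>R u = (r * s) *\<^sub>R u"
    by transfer (auto simp: l2_rel_def sq_integrable_scaleR)
  show "1 *\<^sub>R u = u"
    by transfer (auto simp: l2_rel_def)
  show "(norm u = 0) = (u = 0)"
    by transfer (auto simp: l2_rel_def norm2_eq_0_iff sq_integrable_zero)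
  show "norm (u + v) \<le> norm u + norm v"
    by transfer (auto simp: l2_rel_def norm2_triangle)
  show "norm (r *\<^sub>R u) = \<bar>r\<bar> * norm u"
    by transfer (auto simp: norm2_def power_mult_distrib real_sqrt_mult)
qed (auto simp: sgn_l2_def dist_l2_def uniformity_l2_def open_l2_def)

end

section \<open>\<open>C\<^sub>0\<close>-semigroups and their generators\<close>

text \<open>
  A semigroup is a function on \<open>real\<close> of which only the values at \<open>t \<ge> 0\<close> matter. Unbounded
  operators are represented by their graphs.
\<close>

definition bounded_operator ::
  "('k::{real_normed_field, euclidean_space} l2 \<Rightarrow> 'k l2) \<Rightarrow> bool" where
  "bounded_operator U \<longleftrightarrow>
     bounded_linear U \<and> (\<forall>c u. U (scale_l2 c u) = scale_l2 c (U u))"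

definition C0_semigroup ::
  "(real \<Rightarrow> 'k::{real_normed_field, euclidean_space} l2 \<Rightarrow> 'k l2) \<Rightarrow> bool" where
  "C0_semigroup T \<longleftrightarrow>
     (\<forall>t\<ge>0. bounded_operator (T t)) \<and>
     (\<forall>u. T 0 u = u) \<and>
     (\<forall>s\<ge>0. \<forall>t\<ge>0. \<forall>u. T (s + t) u = T s (T t u)) \<and>
     (\<forall>u. ((\<lambda>t. T t u) \<longlongrightarrow> u) (at_right 0))"

definition generator ::
  "(real \<Rightarrow> 'k::{real_normed_field, euclidean_space} l2 \<Rightarrow> 'k l2) \<Rightarrow> ('k l2 \<times> 'k l2) set" where
  "generator T = {(u, v). ((\<lambda>t. (T t u - u) /\<^sub>R t) \<longlongrightarrow> v) (at_right 0)}"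

section \<open>The Dirichlet Laplacian on the half-line\<close>

abbreviation vderiv :: "(real \<Rightarrow> 'k::real_normed_vector) \<Rightarrow> real \<Rightarrow> 'k" where
  "vderiv \<phi> \<equiv> \<lambda>x. vector_derivative \<phi> (at x)"

text \<open>Elements of \<open>C\<^sub>c\<^sup>\<infinity>(0,\<infinity>)\<close>, extended by zero to the whole real line.\<close>

definition test_function :: "(real \<Rightarrow> 'k::real_normed_vector) \<Rightarrow> bool" where
  "test_function \<phi> \<longleftrightarrow>
     (\<forall>n x. (vderiv ^^ n) \<phi> differentiable at x) \<and>
     (\<exists>a b. 0 < a \<and> (\<forall>x. x \<notin> {a..b} \<longrightarrow> \<phi> x = 0))"

definition weak_deriv ::
  "'k::{real_normed_field, euclidean_space} l2 \<Rightarrow> 'k l2 \<Rightarrow> bool" where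
  "weak_deriv u v \<longleftrightarrow>
     (\<forall>\<phi>. test_function \<phi> \<longrightarrow>
        (\<integral>x. fn_of u x * vderiv \<phi> x \<partial>halfline) = - (\<integral>x. fn_of v x * \<phi> x \<partial>halfline))"

definition distr_laplacian ::
  "'k::{real_normed_field, euclidean_space} l2 \<Rightarrow> 'k l2 \<Rightarrow> bool" where
  "distr_laplacian u v \<longleftrightarrow>
     (\<forall>\<phi>. test_function \<phi> \<longrightarrow>
        (\<integral>x. fn_of u x * vderiv (vderiv \<phi>) x \<partial>halfline) = (\<integral>x. fn_of v x * \<phi> x \<partial>halfline))"

text \<open>
  The map \<open>u \<mapsto> (u, u')\<close> is an isometry from \<open>H\<^sup>1(0,\<infinity>)\<close> into the product \<open>L\<^sub>2 \<times> L\<^sub>2\<close>, whose norm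
  is the Euclidean one. The closure below is therefore the closure of the test functions
  with respect to the \<open>H\<^sup>1\<close>-norm.
\<close>

definition H1_0 :: "'k::{real_normed_field, euclidean_space} l2 set" where
  "H1_0 = {u. \<exists>u'. weak_deriv u u' \<and>
     (u, u') \<in> closure {(v, v'). \<exists>\<phi>. test_function \<phi> \<and>
        (AE x in halfline. fn_of v x = \<phi> x) \<and> (AE x in halfline. fn_of v' x = vderiv \<phi> x)}}"

definition dirichlet_laplacian ::
  "('k::{real_normed_field, euclidean_space} l2 \<times> 'k l2) set" where
  "dirichlet_laplacian = {(u, v). u \<in> H1_0 \<and> distr_laplacian u v}"

section \<open>Perturbation by potentials\<close>

definition minus_potential ::
  "('k::{real_normed_field, euclidean_space} l2 \<times> 'k l2) set \<Rightarrow> (real \<Rightarrow> real)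
    \<Rightarrow> ('k l2 \<times> 'k l2) set" where
  "minus_potential A V =
     {(u, w). \<exists>v. (u, v) \<in> A \<and> (AE x in halfline. fn_of w x = fn_of v x - V x *\<^sub>R fn_of u x)}"

text \<open>
  \<open>bdd_perturbed_semigroup T V S\<close> says that \<open>S = T\<^sub>V\<close> for an essentially bounded \<open>V\<close>, and
  \<open>perturbed_semigroup T V S\<close> says that \<open>S = T\<^sub>V\<close> for a possibly unbounded \<open>V \<le> 0\<close>. Both
  determine \<open>S\<close> uniquely at all times \<open>t \<ge> 0\<close>, since a \<open>C\<^sub>0\<close>-semigroup is determined by its
  generator.
\<close>

definition bdd_perturbed_semigroup ::
  "(real \<Rightarrow> 'k::{real_normed_field, euclidean_space} l2 \<Rightarrow> 'k l2) \<Rightarrow> (real \<Rightarrow> real)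
    \<Rightarrow> (real \<Rightarrow> 'k l2 \<Rightarrow> 'k l2) \<Rightarrow> bool" where
  "bdd_perturbed_semigroup T V S \<longleftrightarrow>
     C0_semigroup S \<and> generator S = minus_potential (generator T) V"

definition perturbed_semigroup ::
  "(real \<Rightarrow> 'k::{real_normed_field, euclidean_space} l2 \<Rightarrow> 'k l2) \<Rightarrow> (real \<Rightarrow> real)
    \<Rightarrow> (real \<Rightarrow> 'k l2 \<Rightarrow> 'k l2) \<Rightarrow> bool" where
  "perturbed_semigroup T V S \<longleftrightarrow>
     C0_semigroup S \<and>
     (\<exists>R. (\<forall>n::nat. bdd_perturbed_semigroup T (\<lambda>x. max (V x) (- real n)) (R n)) \<and>
          (\<forall>t\<ge>0. \<forall>u. (\<lambda>n. R n t u) \<longlonglongrightarrow> S t u))"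

definition admissible ::
  "(real \<Rightarrow> 'k::{real_normed_field, euclidean_space} l2 \<Rightarrow> 'k l2) \<Rightarrow> (real \<Rightarrow> real) \<Rightarrow> bool" where
  "admissible T V \<longleftrightarrow> (\<exists>S. perturbed_semigroup T V S)"

definition integral_kernel ::
  "(real \<Rightarrow> real \<Rightarrow> real) \<Rightarrow> ('k::{real_normed_field, euclidean_space} l2 \<Rightarrow> 'k l2) \<Rightarrow> bool" where
  "integral_kernel k U \<longleftrightarrow>
     (\<forall>u. AE x in halfline.
        integrable halfline (\<lambda>y. k x y *\<^sub>R fn_of u y) \<and>
        fn_of (U u) x = (\<integral>y. k x y *\<^sub>R fn_of u y \<partial>halfline))"

abbreviation quadrant :: "(real \<times> real) measure" where
  "quadrant \<equiv> lebesgue_on ({0<..} \<times> {0<..})"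

definition L_infinity_quadrant :: "(real \<Rightarrow> real \<Rightarrow> real) \<Rightarrow> bool" where
  "L_infinity_quadrant k \<longleftrightarrow>
     (\<lambda>(x, y). k x y) \<in> borel_measurable quadrant \<and> (\<exists>C. AE (x, y) in quadrant. \<bar>k x y\<bar> \<le> C)"

end

theory Submission
  imports Defs "HOL-Probability.Probability" "HOL-Real_Asymp.Real_Asymp"
begin

text \<open>
  Write \<open>W\<^sub>n = (-V) \<and> n\<close>. Since the heat semigroup \<open>T\<close> is positive, iterating Duhamel's formula
  gives \<open>T\<^sub>V(t) \<ge> \<integral>\<^sub>0\<^sup>t T(t - s) W\<^sub>n T(s) ds\<close> for all \<open>n\<close>. Both sides are tested with the heat kernel
  \<open>h(x) = p\<^sub>\<sigma>(a, x)\<close> of the half-line, where \<open>\<sigma> = a\<^sup>2\<close>, for which \<open>T(s) h = p\<^sub>\<sigma>\<^sub>+\<^sub>s(a, \<cdot>)\<close> is explicit.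

  The assumed kernel bound implies \<open>k\<^sub>t(x, y) \<le> c x y t\<^sup>-\<^sup>3\<^sup>/\<^sup>2\<close>, because \<open>(1 + r)\<^sup>\<beta> e\<^sup>-\<^sup>r \<le> 1\<close> for \<open>\<beta> \<le> 1\<close>; as
  \<open>\<integral> x h(x) dx = a\<close>, the left-hand side is at most \<open>c a\<^sup>2 t\<^sup>-\<^sup>3\<^sup>/\<^sup>2\<close>. On the right-hand side, for
  \<open>a \<le> x \<le> \<surd>t / 2\<close> already the times \<open>x\<^sup>2 \<le> s \<le> 2 x\<^sup>2\<close> contribute at least \<open>K a\<^sup>2 t\<^sup>-\<^sup>3\<^sup>/\<^sup>2 x W\<^sub>n(x)\<close>. Hence
  \<open>\<integral> x W\<^sub>n(x) dx \<le> c / K\<close> over \<open>[a, \<surd>t / 2]\<close>, uniformly in \<open>a\<close>, \<open>t\<close> and \<open>n\<close>.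

  Positivity of \<open>T\<close> is read off from \<open>(T(t) f, p\<^sub>s(a, \<cdot>)) = (f, p\<^sub>s\<^sub>+\<^sub>t(a, \<cdot>))\<close> by letting \<open>s \<rightarrow> 0\<close>.
\<close>

section \<open>The Hilbert space of square-integrable functions\<close>

lemma sq_integrable_fn_of [simp]: "sq_integrable (fn_of u)"
  using Quotient3_rep_reflp[OF Quotient3_l2, of u] by (simp add: l2_rel_def fn_of_def)

lemma borel_measurable_fn_of [measurable]: "fn_of u \<in> borel_measurable halfline"
  using sq_integrable_fn_of[of u] by (simp add: sq_integrable_def)

lemma fn_of_abs_l2:
  assumes "sq_integrable f"
  shows "AE x in halfline. fn_of (abs_l2 f) x = f x"
proof -
  have "l2_rel f f" using assms by (simp add: l2_rel_def)
  then have "l2_rel (rep_l2 (abs_l2 f)) f"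
    by (rule rep_abs_rsp_left[OF Quotient3_l2])
  then show ?thesis by (simp add: l2_rel_def fn_of_def)
qed

lemma l2_eq_iff: "u = v \<longleftrightarrow> (AE x in halfline. fn_of u x = fn_of v x)"
  using Quotient3_rel_rep[OF Quotient3_l2, of u v] sq_integrable_fn_of[of u] sq_integrable_fn_of[of v]
  by (simp add: l2_rel_def fn_of_def)

lemma fn_of_add: "AE x in halfline. fn_of (u + v) x = fn_of u x + fn_of v x"
  using fn_of_abs_l2[OF sq_integrable_add[of "fn_of u" "fn_of v"]]
  by (simp add: plus_l2_def fn_of_def[symmetric])

lemma fn_of_diff: "AE x in halfline. fn_of (u - v) x = fn_of u x - fn_of v x"
  using fn_of_abs_l2[OF sq_integrable_diff[of "fn_of u" "fn_of v"]]
  by (simp add: minus_l2_def fn_of_def[symmetric])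

lemma fn_of_scaleR: "AE x in halfline. fn_of (r *\<^sub>R u) x = r *\<^sub>R fn_of u x"
  using fn_of_abs_l2[OF sq_integrable_scaleR[of "fn_of u" r]]
  by (simp add: scaleR_l2_def fn_of_def[symmetric])

lemma fn_of_scale_l2: "AE x in halfline. fn_of (scale_l2 c u) x = c * fn_of u x"
  using fn_of_abs_l2[OF sq_integrable_mult[of "fn_of u" c]]
  by (simp add: scale_l2_def fn_of_def[symmetric])

lemma norm_l2_fn_of: "norm u = norm2 (fn_of u)"
  by (simp add: norm_l2_def fn_of_def)

lemma integrable_norm_sq_fn_of [simp]: "integrable halfline (\<lambda>x. (norm (fn_of u x))\<^sup>2)"
  using sq_integrable_fn_of[of u] by (simp add: sq_integrable_def)

lemma norm_l2_sq: "(norm u)\<^sup>2 = (\<integral>x. (norm (fn_of u x))\<^sup>2 \<partial>halfline)"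
  by (simp add: norm_l2_fn_of norm2_sq)

lemma sq_integrable_inner:
  assumes "sq_integrable f" "sq_integrable g"
  shows "integrable halfline (\<lambda>x. f x \<bullet> g x)"
proof (rule Bochner_Integration.integrable_bound[OF sq_integrable_mult_norm[OF assms]])
  show "(\<lambda>x. f x \<bullet> g x) \<in> borel_measurable halfline"
    using assms by (auto simp: sq_integrable_def)
  show "AE x in halfline. norm (f x \<bullet> g x) \<le> norm (norm (f x) * norm (g x))"
    using Cauchy_Schwarz_ineq2 by auto
qed

lemma integrable_inner_fn_of [simp]: "integrable halfline (\<lambda>x. fn_of u x \<bullet> fn_of v x)"
  by (simp add: sq_integrable_inner)

instantiation l2 :: ("{real_normed_field, euclidean_space}") real_inner
begin

definition inner_l2 :: "'a l2 \<Rightarrow> 'a l2 \<Rightarrow> real" where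
  "inner_l2 u v = (\<integral>x. fn_of u x \<bullet> fn_of v x \<partial>halfline)"

instance
proof
  fix u v w :: "'a l2" and r :: real
  show "inner u v = inner v u"
    by (simp add: inner_l2_def inner_commute)
  have "inner (u + v) w = (\<integral>x. fn_of u x \<bullet> fn_of w x + fn_of v x \<bullet> fn_of w x \<partial>halfline)"
    unfolding inner_l2_def
    using fn_of_add[of u v] by (intro integral_cong_AE) (auto simp: inner_add_left elim!: eventually_mono)
  then show "inner (u + v) w = inner u w + inner v w"
    by (simp add: inner_l2_def)
  have "inner (r *\<^sub>R u) w = (\<integral>x. r * (fn_of u x \<bullet> fn_of w x) \<partial>halfline)"
    unfolding inner_l2_def
    using fn_of_scaleR[of r u] by (intro integral_cong_AE) (auto elim!: eventually_mono)
  then show "inner (r *\<^sub>R u) w = r * inner u w"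
    by (simp add: inner_l2_def)
  have *: "inner u u = (norm u)\<^sup>2"
    by (simp add: inner_l2_def norm_l2_sq power2_norm_eq_inner)
  show "0 \<le> inner u u" "inner u u = 0 \<longleftrightarrow> u = 0" "norm u = sqrt (inner u u)"
    unfolding * by auto
qed

end

lemma norm_abs_l2: "sq_integrable f \<Longrightarrow> norm (abs_l2 f) = norm2 f"
  unfolding norm_l2_fn_of by (intro norm2_cong fn_of_abs_l2) auto

lemma inner_abs_l2_right:
  assumes "sq_integrable f"
  shows "u \<bullet> abs_l2 f = (\<integral>x. fn_of u x \<bullet> f x \<partial>halfline)"
  unfolding inner_l2_def using assms fn_of_abs_l2[OF assms]
  by (intro integral_cong_AE) (auto simp: sq_integrable_def elim!: eventually_mono)

lemma abs_l2_eqI: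
  assumes "sq_integrable f" "AE x in halfline. fn_of u x = f x"
  shows "abs_l2 f = u"
  unfolding l2_eq_iff using fn_of_abs_l2[OF assms(1)] assms(2) by eventually_elim simp

lemma abs_l2_diff:
  assumes "sq_integrable f" "sq_integrable g"
  shows "abs_l2 (\<lambda>x. f x - g x) = abs_l2 f - abs_l2 g"
proof (rule abs_l2_eqI[OF sq_integrable_diff[OF assms]])
  show "AE x in halfline. fn_of (abs_l2 f - abs_l2 g) x = f x - g x"
    using fn_of_diff[of "abs_l2 f" "abs_l2 g"] fn_of_abs_l2[OF assms(1)] fn_of_abs_l2[OF assms(2)]
    by eventually_elim simp
qed

lemma abs_l2_scaleR:
  assumes "sq_integrable f"
  shows "abs_l2 (\<lambda>x. r *\<^sub>R f x) = r *\<^sub>R abs_l2 f"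
proof (rule abs_l2_eqI[OF sq_integrable_scaleR[OF assms]])
  show "AE x in halfline. fn_of (r *\<^sub>R abs_l2 f) x = r *\<^sub>R f x"
    using fn_of_scaleR[of r "abs_l2 f"] fn_of_abs_l2[OF assms] by eventually_elim simp
qed

lemma sq_integrable_bound:
  assumes "sq_integrable g" "f \<in> borel_measurable halfline"
    "AE x in halfline. norm (f x) \<le> norm (g x)"
  shows "sq_integrable f"
  unfolding sq_integrable_def
proof
  show "integrable halfline (\<lambda>x. (norm (f x))\<^sup>2)"
  proof (rule Bochner_Integration.integrable_bound)
    show "integrable halfline (\<lambda>x. (norm (g x))\<^sup>2)" using assms(1) by (simp add: sq_integrable_def)
    show "(\<lambda>x. (norm (f x))\<^sup>2) \<in> borel_measurable halfline" using assms(2) by measurable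
    show "AE x in halfline. norm ((norm (f x))\<^sup>2) \<le> norm ((norm (g x))\<^sup>2)"
      using assms(3) by eventually_elim (simp add: power_mono)
  qed
qed (rule assms)

lemma integrable_halfline:
  fixes f :: "real \<Rightarrow> 'b::{banach, second_countable_topology}"
  assumes "integrable lborel f"
  shows "integrable halfline f"
proof -
  have "integrable lebesgue f"
    using assms by (subst integrable_completion) auto
  then have "integrable lebesgue (\<lambda>x. indicator {0<..} x *\<^sub>R f x)"
    by (rule integrable_mult_indicator[rotated]) auto
  then show ?thesis
    by (subst integrable_restrict_space) auto
qed

lemma borel_measurable_halfline [measurable (raw)]:
  "f \<in> borel_measurable borel \<Longrightarrow> f \<in> borel_measurable halfline"
  by (intro measurable_restrict_space1 measurable_completion) simp

lemma sq_integrable_exp_square: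
  assumes "0 < b"
  shows "sq_integrable (\<lambda>x::real. exp (- (b * (x - a)\<^sup>2)))"
proof -
  define \<sigma> where "\<sigma> = sqrt (1 / (4 * b))"
  have \<sigma>: "0 < \<sigma>" "\<sigma>\<^sup>2 = 1 / (4 * b)" using assms by (auto simp: \<sigma>_def)
  have "(norm (exp (- (b * (x - a)\<^sup>2))))\<^sup>2 = sqrt (2 * pi * \<sigma>\<^sup>2) * normal_density a \<sigma> x" for x
    using \<sigma> assms by (simp add: normal_density_def mult_ac flip: exp_double)
  then have "integrable lborel (\<lambda>x. (norm (exp (- (b * (x - a)\<^sup>2))))\<^sup>2)"
    using integrable_normal_density[OF \<sigma>(1), of a] by simp
  then show ?thesis unfolding sq_integrable_def
    by (intro conjI integrable_halfline borel_measurable_halfline) auto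
qed

instance l2 :: ("{real_normed_field, euclidean_space}") banach
proof
  fix X :: "nat \<Rightarrow> 'a l2"
  assume X: "Cauchy X"
  obtain r :: "nat \<Rightarrow> nat" where r: "strict_mono r"
    "\<And>n. norm (X (r (Suc n)) - X (r n)) < (1/2) ^ n"
  proof -
    have "\<exists>M. \<forall>m\<ge>M. \<forall>n\<ge>M. norm (X m - X n) < (1/2) ^ k" for k
      using X by (auto simp: Cauchy_iff)
    then obtain M where M: "\<And>k m n. m \<ge> M k \<Longrightarrow> n \<ge> M k \<Longrightarrow> norm (X m - X n) < (1/2) ^ k"
      by metis
    define r where "r = rec_nat (M 0) (\<lambda>k j. max (Suc j) (M (Suc k)))"
    have r: "r 0 = M 0" "\<And>k. r (Suc k) = max (Suc (r k)) (M (Suc k))"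
      by (simp_all add: r_def)
    have "strict_mono r" by (rule strict_monoI_Suc) (simp add: r)
    moreover have "r k \<ge> M k" for k by (cases k) (auto simp: r)
    ultimately show thesis
      by (intro that[of r] M) (auto intro: order_trans[OF _ less_imp_le] simp: strict_mono_Suc_iff)
  qed
  define d where "d n x = norm (fn_of (X (r (Suc n)) - X (r n)) x)" for n x
  \<comment> \<open>The weight makes the telescoping series integrable, so pointwise convergence needs no
    estimate of its square.\<close>
  define e where "e x = exp (- (1 * (x - 0)\<^sup>2))" for x :: real
  have [measurable]: "d n \<in> borel_measurable halfline" "e \<in> borel_measurable halfline" for n
    unfolding d_def e_def using sq_integrable_exp_square[of 1 0] by (auto simp: sq_integrable_def)
  have d_int: "(\<integral>\<^sup>+ x. ennreal (d n x * e x) \<partial>halfline) \<le> ennreal ((1/2) ^ n * norm2 e)" for n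
  proof -
    have e: "sq_integrable e" unfolding e_def by (rule sq_integrable_exp_square) simp
    have d: "sq_integrable (fn_of (X (r (Suc n)) - X (r n)))" by simp
    have eq: "d n x * e x = norm (fn_of (X (r (Suc n)) - X (r n)) x) * norm (e x)" for x
      by (simp add: d_def e_def)
    have "(\<integral>\<^sup>+ x. ennreal (d n x * e x) \<partial>halfline) = ennreal (\<integral>x. d n x * e x \<partial>halfline)"
      unfolding eq using sq_integrable_mult_norm[OF d e] by (intro nn_integral_eq_integral) auto
    also have "(\<integral>x. d n x * e x \<partial>halfline) \<le> norm (X (r (Suc n)) - X (r n)) * norm2 e"
      unfolding eq using integral_norm_mult_le[OF d e] by (simp add: norm_l2_fn_of)
    also have "\<dots> \<le> (1/2) ^ n * norm2 e"
      using r(2)[of n] by (intro mult_right_mono) (auto simp: norm2_nonneg)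
    finally show ?thesis by (simp add: ennreal_leI)
  qed
  have "(\<integral>\<^sup>+ x. (\<Sum>n. ennreal (d n x * e x)) \<partial>halfline) =
      (\<Sum>n. \<integral>\<^sup>+ x. ennreal (d n x * e x) \<partial>halfline)"
    by (intro nn_integral_suminf) auto
  also have "\<dots> \<le> (\<Sum>n. ennreal ((1/2) ^ n * norm2 e))"
    by (intro suminf_le d_int) auto
  also have "\<dots> < \<infinity>"
    using norm2_nonneg[of e]
    by (simp add: suminf_ennreal_eq[OF _ sums_mult2[OF geometric_sums[of "1/2"]]])
  finally have "AE x in halfline. (\<Sum>n. ennreal (d n x * e x)) \<noteq> \<infinity>"
    by (intro nn_integral_PInf_AE) auto
  then have "AE x in halfline. summable (\<lambda>n. d n x)"
  proof eventually_elim
    case (elim x)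
    then have "summable (\<lambda>n. d n x * e x)"
      by (intro summable_suminf_not_top) (auto simp: d_def e_def)
    then have "summable (\<lambda>n. d n x * e x * (1 / e x))" by (rule summable_mult2)
    then show ?case by (simp add: e_def)
  qed
  moreover have "AE x in halfline. \<forall>n. fn_of (X (r (Suc n)) - X (r n)) x =
      fn_of (X (r (Suc n))) x - fn_of (X (r n)) x"
    unfolding AE_all_countable by (auto intro: fn_of_diff)
  ultimately have conv: "AE x in halfline. convergent (\<lambda>n. fn_of (X (r n)) x)"
  proof eventually_elim
    case (elim x)
    then have "summable (\<lambda>n. fn_of (X (r (Suc n))) x - fn_of (X (r n)) x)"
      by (intro summable_norm_cancel[of "\<lambda>n. fn_of (X (r (Suc n))) x - fn_of (X (r n)) x"])
        (simp add: d_def)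
    then have "convergent (\<lambda>n. \<Sum>i<n. fn_of (X (r (Suc i))) x - fn_of (X (r i)) x)"
      by (simp add: summable_iff_convergent)
    then have "convergent (\<lambda>n. fn_of (X (r n)) x - fn_of (X (r 0)) x)"
      by (simp add: sum_lessThan_telescope[of "\<lambda>n. fn_of (X (r n)) x"])
    from convergent_add[OF this convergent_const[of "fn_of (X (r 0)) x"]] show ?case by simp
  qed
  define g where "g x = lim (\<lambda>n. fn_of (X (r n)) x)" for x
  have [measurable]: "g \<in> borel_measurable halfline"
    unfolding g_def by measurable
  have lim: "AE x in halfline. (\<lambda>n. fn_of (X (r n)) x) \<longlonglongrightarrow> g x"
    using conv by eventually_elim (simp add: g_def convergent_LIMSEQ_iff)
  have fatou: "(\<integral>\<^sup>+ x. ennreal ((norm (g x - fn_of (X m) x))\<^sup>2) \<partial>halfline) \<le> ennreal (\<epsilon>\<^sup>2)"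
    if "\<epsilon> > 0" "\<And>n. n \<ge> N \<Longrightarrow> norm (X n - X m) \<le> \<epsilon>" for m N \<epsilon>
  proof -
    let ?f = "\<lambda>n x. ennreal ((norm (fn_of (X (r n)) x - fn_of (X m) x))\<^sup>2)"
    have le: "(\<integral>\<^sup>+ x. ?f n x \<partial>halfline) \<le> ennreal (\<epsilon>\<^sup>2)"
      if n: "n \<ge> N" for n
    proof -
      have "(\<integral>\<^sup>+ x. ?f n x \<partial>halfline)
          = (\<integral>\<^sup>+ x. ennreal ((norm (fn_of (X (r n) - X m) x))\<^sup>2) \<partial>halfline)"
        using fn_of_diff[of "X (r n)" "X m"]
        by (intro nn_integral_cong_AE) (auto elim!: eventually_mono)
      also have "\<dots> = ennreal ((norm (X (r n) - X m))\<^sup>2)"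
        unfolding norm_l2_sq by (intro nn_integral_eq_integral) auto
      also have "\<dots> \<le> ennreal (\<epsilon>\<^sup>2)"
        using n r(1)[THEN strict_mono_imp_increasing, of n] \<open>\<epsilon> > 0\<close>
        by (intro ennreal_leI power_mono \<open>\<And>n. n \<ge> N \<Longrightarrow> norm (X n - X m) \<le> \<epsilon>\<close>) auto
      finally show ?thesis .
    qed
    have "(\<integral>\<^sup>+ x. ennreal ((norm (g x - fn_of (X m) x))\<^sup>2) \<partial>halfline) =
        (\<integral>\<^sup>+ x. liminf (\<lambda>n. ?f n x) \<partial>halfline)"
    proof (intro nn_integral_cong_AE, use lim in eventually_elim)
      case (elim x)
      then have "(\<lambda>n. ?f n x)
          \<longlonglongrightarrow> ennreal ((norm (g x - fn_of (X m) x))\<^sup>2)"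
        by (intro tendsto_intros)
      then show ?case by (intro lim_imp_Liminf[symmetric]) auto
    qed
    also have "\<dots> \<le> liminf (\<lambda>n. \<integral>\<^sup>+ x. ?f n x \<partial>halfline)"
      by (intro nn_integral_liminf) auto
    also have "\<dots> \<le> limsup (\<lambda>n. \<integral>\<^sup>+ x. ?f n x \<partial>halfline)"
      by (intro Liminf_le_Limsup) auto
    also have "\<dots> \<le> ennreal (\<epsilon>\<^sup>2)"
      using le by (intro Limsup_bounded) (auto simp: eventually_sequentially)
    finally show ?thesis .
  qed
  have sq: "sq_integrable (\<lambda>x. g x - fn_of (X m) x)"
    if "\<epsilon> > 0" "\<And>n. n \<ge> N \<Longrightarrow> norm (X n - X m) \<le> \<epsilon>" for m N \<epsilon>
    using fatou[OF that] unfolding sq_integrable_def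
    by (auto intro!: integrableI_nn_integral_finite simp: integrable_iff_bounded less_top[symmetric] top_unique
        elim: order_le_less_trans)
  obtain N where N: "\<And>m n. m \<ge> N \<Longrightarrow> n \<ge> N \<Longrightarrow> norm (X n - X m) < 1"
    using X unfolding Cauchy_iff by (metis zero_less_one)
  have "sq_integrable (\<lambda>x. (g x - fn_of (X N) x) + fn_of (X N) x)"
    using N[of N] by (intro sq_integrable_add sq[of 1 N] ) (auto intro: less_imp_le)
  then have g: "sq_integrable g" by simp
  have "X \<longlonglongrightarrow> abs_l2 g"
  proof (rule LIMSEQ_I)
    fix \<epsilon> :: real assume "\<epsilon> > 0"
    then obtain N where N: "\<And>m n. m \<ge> N \<Longrightarrow> n \<ge> N \<Longrightarrow> norm (X n - X m) < \<epsilon> / 2"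
      using X unfolding Cauchy_iff by (metis half_gt_zero)
    show "\<exists>N. \<forall>n\<ge>N. norm (X n - abs_l2 g) < \<epsilon>"
    proof (intro exI allI impI)
      fix m assume m: "m \<ge> N"
      have 1: "\<epsilon> / 2 > 0" "\<And>n. n \<ge> N \<Longrightarrow> norm (X n - X m) \<le> \<epsilon> / 2"
        using N[OF m] \<open>\<epsilon> > 0\<close> by (auto intro: less_imp_le)
      have "(norm (abs_l2 g - X m))\<^sup>2 = (\<integral>x. (norm (fn_of (abs_l2 g - X m) x))\<^sup>2 \<partial>halfline)"
        by (rule norm_l2_sq)
      also have "ennreal \<dots> = (\<integral>\<^sup>+ x. ennreal ((norm (fn_of (abs_l2 g - X m) x))\<^sup>2) \<partial>halfline)"
        by (intro nn_integral_eq_integral[symmetric]) auto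
      also have "\<dots> = (\<integral>\<^sup>+ x. ennreal ((norm (g x - fn_of (X m) x))\<^sup>2) \<partial>halfline)"
        using fn_of_diff[of "abs_l2 g" "X m"] fn_of_abs_l2[OF g]
        by (intro nn_integral_cong_AE, eventually_elim) simp
      also have "\<dots> \<le> ennreal ((\<epsilon> / 2)\<^sup>2)" by (rule fatou[OF 1])
      finally have "(norm (abs_l2 g - X m))\<^sup>2 \<le> (\<epsilon> / 2)\<^sup>2" by simp
      then have "norm (abs_l2 g - X m) \<le> \<epsilon> / 2"
        using \<open>\<epsilon> > 0\<close> by (auto intro: power2_le_imp_le)
      then show "norm (X m - abs_l2 g) < \<epsilon>" using \<open>\<epsilon> > 0\<close> by (simp add: norm_minus_commute)
    qed
  qed
  then show "convergent X" by (auto simp: convergent_def)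
qed

section \<open>Strongly continuous semigroups\<close>

lemma uniform_boundedness:
  fixes F :: "nat \<Rightarrow> 'a::banach \<Rightarrow> 'b::real_normed_vector"
  assumes F: "\<And>n. bounded_linear (F n)" and bdd: "\<And>x. \<exists>K. \<forall>n. norm (F n x) \<le> K"
  shows "\<exists>M. \<forall>n x. norm (F n x) \<le> M * norm x"
proof -
  define C where "C m = {x. \<forall>n. norm (F n x) \<le> real m}" for m
  have closed: "closed (C m)" for m
  proof -
    have "closed {x. norm (F n x) \<le> real m}" for n
      by (intro closed_Collect_le continuous_intros linear_continuous_on[OF F])
    moreover have "C m = (\<Inter>n. {x. norm (F n x) \<le> real m})"
      by (auto simp: C_def)
    ultimately show ?thesis by auto
  qed
  have "\<exists>m. interior (C m) \<noteq> {}"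
  proof (rule ccontr)
    assume "\<not> ?thesis"
    then have "euclidean interior_of (\<Union>(range C)) = {}"
      using closed by (intro Baire_category_alt)
        (auto simp: completely_metrizable_space_euclidean)
    moreover have "(\<Union>(range C)) = UNIV"
    proof -
      have "\<exists>m. x \<in> C m" for x
      proof -
        obtain K where "\<forall>n. norm (F n x) \<le> K" using bdd by blast
        moreover obtain m :: nat where "K \<le> real m" using real_arch_simple by blast
        ultimately show ?thesis by (auto simp: C_def intro: order_trans)
      qed
      then show ?thesis by blast
    qed
    ultimately show False by simp
  qed
  then obtain m x0 where "x0 \<in> interior (C m)" by blast
  then obtain r where r: "r > 0" "ball x0 r \<subseteq> C m"
    by (meson mem_interior)
  have small: "norm (F n y) \<le> 2 * real m" if "norm y < r" for n y
  proof -
    have "x0 + y \<in> C m" "x0 \<in> C m" using r that by (auto simp: dist_norm intro!: subsetD[OF r(2)])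
    then have "norm (F n (x0 + y)) + norm (F n x0) \<le> 2 * real m" by (auto simp: C_def intro: add_mono[THEN order_trans])
    moreover have "F n y = F n (x0 + y) - F n x0"
      by (simp add: linear_add[OF bounded_linear.linear[OF F]])
    ultimately show ?thesis by (metis norm_triangle_ineq4 order_trans)
  qed
  have "norm (F n x) \<le> 4 * real m / r * norm x" for n x
  proof (cases "x = 0")
    case True
    then show ?thesis using linear_0[OF bounded_linear.linear[OF F]] by simp
  next
    case False
    define s where "s = r / (2 * norm x)"
    have s: "s > 0" using False r by (simp add: s_def)
    have "norm (F n (s *\<^sub>R x)) \<le> 2 * real m"
      using False r by (intro small) (simp add: s_def)
    then have "s * norm (F n x) \<le> 2 * real m"
      using s by (simp add: linear_scale[OF bounded_linear.linear[OF F]])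
    then have "norm (F n x) \<le> 2 * real m / s" using s by (simp add: field_simps)
    then show ?thesis using False r by (simp add: s_def field_simps)
  qed
  then show ?thesis by blast
qed

lemma has_vector_derivative_within_quotient:
  "(f has_vector_derivative D) (at x within S) \<longleftrightarrow>
    ((\<lambda>y. (f y - f x) /\<^sub>R (y - x)) \<longlongrightarrow> D) (at x within S)"
proof -
  have "norm (f y - f x - (y - x) *\<^sub>R D) / norm (y - x) = norm ((f y - f x) /\<^sub>R (y - x) - D)"
    if "y \<noteq> x" for y
  proof -
    have "(f y - f x) /\<^sub>R (y - x) - D = (f y - f x - (y - x) *\<^sub>R D) /\<^sub>R (y - x)"
      using that by (simp add: scaleR_diff_right)
    then show ?thesis using that by (simp add: divide_inverse mult.commute)
  qed
  then have "((\<lambda>y. norm (f y - f x - (y - x) *\<^sub>R D) / norm (y - x)) \<longlongrightarrow> 0) (at x within S) \<longleftrightarrow>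
      ((\<lambda>y. norm ((f y - f x) /\<^sub>R (y - x) - D)) \<longlongrightarrow> 0) (at x within S)"
    by (intro filterlim_cong) (auto simp: eventually_at_filter)
  then show ?thesis
    by (simp add: has_vector_derivative_def has_derivative_iff_norm bounded_linear_scaleR_left
        tendsto_norm_zero_iff LIM_zero_iff)
qed

lemma has_vector_derivative_reflect:
  assumes "(f has_vector_derivative D) (at (t - s) within (\<lambda>y. t - y) ` S)"
  shows "((\<lambda>y. f (t - y)) has_vector_derivative - D) (at s within S)"
proof -
  have "((\<lambda>y. t - y) has_vector_derivative - 1) (at s within S)"
    unfolding has_vector_derivative_def by (auto intro!: derivative_eq_intros)
  from vector_diff_chain_within[OF this assms] show ?thesis by (simp add: o_def)
qed

text \<open>\<open>gen T u v\<close> says that \<open>u\<close> is in the domain of the generator of \<open>T\<close>, which maps it to \<open>v\<close>.\<close>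

definition gen :: "(real \<Rightarrow> 'a::real_normed_vector \<Rightarrow> 'a) \<Rightarrow> 'a \<Rightarrow> 'a \<Rightarrow> bool" where
  "gen T u v \<longleftrightarrow> ((\<lambda>t. (T t u - u) /\<^sub>R t) \<longlongrightarrow> v) (at_right 0)"

locale strongly_continuous_semigroup =
  fixes T :: "real \<Rightarrow> 'a::banach \<Rightarrow> 'a"
  assumes bounded_linear: "0 \<le> t \<Longrightarrow> bounded_linear (T t)"
    and zero: "T 0 u = u"
    and add: "0 \<le> s \<Longrightarrow> 0 \<le> t \<Longrightarrow> T (s + t) u = T s (T t u)"
    and tendsto_0: "((\<lambda>t. T t u) \<longlongrightarrow> u) (at_right 0)"
begin

lemma linear: "0 \<le> t \<Longrightarrow> linear (T t)"
  by (intro bounded_linear.linear bounded_linear)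

lemma tendsto_0_within: "((\<lambda>t. T t u) \<longlongrightarrow> u) (at 0 within {0..})"
  using tendsto_0 by (simp add: at_within_Ici_at_right)

lemma locally_bounded:
  obtains M where "M \<ge> 1" "\<And>t u. 0 \<le> t \<Longrightarrow> t \<le> \<tau> \<Longrightarrow> norm (T t u) \<le> M * norm u"
proof -
  have "\<exists>\<delta>>0. \<exists>M. \<forall>t u. 0 \<le> t \<and> t \<le> \<delta> \<longrightarrow> norm (T t u) \<le> M * norm u"
  proof (rule ccontr)
    assume neg: "\<not> ?thesis"
    have "\<exists>t u. 0 \<le> t \<and> t \<le> inverse (real (Suc n)) \<and> norm (T t u) > real n * norm u" for n
      using neg by (force simp: not_le dest: spec[of _ "inverse (real (Suc n))"])
    then obtain t u where t: "\<And>n. 0 \<le> t n" "\<And>n. t n \<le> inverse (real (Suc n))"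
      and u: "\<And>n. norm (T (t n) (u n)) > real n * norm (u n)"
      by metis
    have t0: "t \<longlonglongrightarrow> 0"
      by (rule tendsto_sandwich[OF _ _ tendsto_const LIMSEQ_inverse_real_of_nat]) (use t in auto)
    have "\<exists>K. \<forall>n. norm (T (t n) x) \<le> K" for x
    proof -
      have "continuous (at 0 within {0..}) (\<lambda>t. T t x)"
        using tendsto_0_within[of x] by (simp add: continuous_within zero)
      then have "(\<lambda>n. T (t n) x) \<longlonglongrightarrow> T 0 x"
        by (rule continuous_within_tendsto_compose[OF _ _ t0]) (use t in auto)
      then have "Bseq (\<lambda>n. T (t n) x)" by (intro convergent_imp_Bseq) (auto simp: convergent_def)
      then show ?thesis by (auto simp: Bseq_def)
    qed
    then obtain M where M: "\<And>n x. norm (T (t n) x) \<le> M * norm x"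
      using uniform_boundedness[of "\<lambda>n. T (t n)"] bounded_linear t by blast
    obtain n :: nat where "M \<le> real n" using real_arch_simple by blast
    then have "norm (T (t n) (u n)) \<le> real n * norm (u n)"
      using M[of n "u n"] by (meson mult_right_mono norm_ge_zero order_trans)
    with u[of n] show False by simp
  qed
  then obtain \<delta> M0 where \<delta>: "\<delta> > 0"
    and M0: "\<And>t u. 0 \<le> t \<Longrightarrow> t \<le> \<delta> \<Longrightarrow> norm (T t u) \<le> M0 * norm u"
    by blast
  define M where "M = max 1 M0"
  have M: "norm (T t u) \<le> M * norm u" if "0 \<le> t" "t \<le> \<delta>" for t u
    using M0[OF that, of u] mult_right_mono[of M0 M "norm u"] by (simp add: M_def)
  have M1: "M \<ge> 1" by (simp add: M_def)
  have pow: "norm (T t u) \<le> M ^ n * norm u" if "0 \<le> t" "t \<le> real n * \<delta>" for n t u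
    using that
  proof (induction n arbitrary: t)
    case 0
    then show ?case by (simp add: zero)
  next
    case (Suc n)
    define s where "s = min t \<delta>"
    have s: "0 \<le> s" "s \<le> \<delta>" "0 \<le> t - s" using Suc.prems \<delta> by (auto simp: s_def)
    have ts: "t - s \<le> real n * \<delta>" using Suc.prems \<delta> by (auto simp: s_def min_def algebra_simps)
    have "norm (T t u) = norm (T s (T (t - s) u))"
      using add[of s "t - s" u] s by simp
    also have "\<dots> \<le> M * norm (T (t - s) u)" by (rule M[OF s(1,2)])
    also have "\<dots> \<le> M * (M ^ n * norm u)"
      using Suc.IH[OF s(3) ts] M1 by (intro mult_left_mono) auto
    finally show ?case by simp
  qed
  obtain n :: nat where n: "\<tau> / \<delta> \<le> real n" using real_arch_simple by blast
  show thesis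
  proof (rule that[of "M ^ n"])
    show "M ^ n \<ge> 1" using M1 by (rule one_le_power)
    show "norm (T t u) \<le> M ^ n * norm u" if "0 \<le> t" "t \<le> \<tau>" for t u
      using that n \<delta> by (intro pow) (auto simp: field_simps)
  qed
qed

lemma continuous_on_orbit: "continuous_on {0..} (\<lambda>t. T t u)"
  unfolding continuous_on_iff
proof (intro ballI allI impI)
  fix t e :: real assume t: "t \<in> {0..}" and e: "0 < e"
  obtain M where M: "M \<ge> 1" "\<And>s u. 0 \<le> s \<Longrightarrow> s \<le> t + 1 \<Longrightarrow> norm (T s u) \<le> M * norm u"
    using locally_bounded[of "t + 1"] by blast
  have "eventually (\<lambda>h. dist (T h u) u < e / M) (at_right 0)"
    using tendsto_0[of u] M e by (auto simp: tendsto_iff)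
  then obtain d where d: "d > 0" "\<And>h. 0 < h \<Longrightarrow> h < d \<Longrightarrow> norm (T h u - u) < e / M"
    unfolding eventually_at_right_field dist_norm by auto
  have main: "norm (T b u - T a u) < e" if "0 \<le> a" "a \<le> b" "b - a < d" "a \<le> t + 1" for a b
  proof (cases "a = b")
    case True
    then show ?thesis using e by simp
  next
    case False
    have "T b u - T a u = T a (T (b - a) u - u)"
      using that add[of a "b - a" u] by (simp add: linear_diff[OF linear])
    then have "norm (T b u - T a u) \<le> M * norm (T (b - a) u - u)"
      using M(2)[of a] that by simp
    also have "\<dots> < M * (e / M)"
      using d(2)[of "b - a"] that False M(1) by (intro mult_strict_left_mono) auto
    finally show ?thesis using M(1) by simp
  qed
  show "\<exists>d>0. \<forall>x'\<in>{0..}. dist x' t < d \<longrightarrow> dist (T x' u) (T t u) < e"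
  proof (intro exI conjI ballI impI)
    show "min d 1 > 0" using d by simp
    fix s assume s: "s \<in> {0..}" "dist s t < min d 1"
    show "dist (T s u) (T t u) < e"
    proof (cases "s \<le> t")
      case True
      then show ?thesis using main[of s t] s t by (auto simp: dist_norm norm_minus_commute)
    next
      case False
      then show ?thesis using main[of t s] s t by (auto simp: dist_norm)
    qed
  qed
qed

lemma tendsto_apply:
  assumes r: "(r \<longlongrightarrow> t) F" "eventually (\<lambda>x. 0 \<le> r x) F" and t: "0 \<le> t" and v: "(v \<longlongrightarrow> w) F"
  shows "((\<lambda>x. T (r x) (v x)) \<longlongrightarrow> T t w) F"
proof -
  obtain M where M: "M \<ge> 1" "\<And>s u. 0 \<le> s \<Longrightarrow> s \<le> t + 1 \<Longrightarrow> norm (T s u) \<le> M * norm u"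
    using locally_bounded[of "t + 1"] by blast
  have "continuous (at t within {0..}) (\<lambda>t. T t w)"
    using continuous_on_orbit[of w] t by (simp add: continuous_on_eq_continuous_within)
  then have 1: "((\<lambda>x. T (r x) w) \<longlongrightarrow> T t w) F"
    by (rule continuous_within_tendsto_compose[OF _ _ r(1)]) (use r in auto)
  have "((\<lambda>x. T (r x) (v x) - T (r x) w) \<longlongrightarrow> 0) F"
  proof (rule Lim_null_comparison)
    have "((\<lambda>x. v x - w) \<longlongrightarrow> 0) F" using v by (simp add: LIM_zero_iff)
    then show "((\<lambda>x. M * norm (v x - w)) \<longlongrightarrow> 0) F"
      using tendsto_mult_right_zero tendsto_norm_zero by blast
    have "eventually (\<lambda>x. r x < t + 1) F" using r(1) by (rule order_tendstoD) simp
    then show "eventually (\<lambda>x. norm (T (r x) (v x) - T (r x) w) \<le> M * norm (v x - w)) F"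
      using r(2) by eventually_elim (simp add: M linear_diff[OF linear, symmetric])
  qed
  from tendsto_add[OF this 1] show ?thesis by simp
qed

lemma continuous_on_apply:
  assumes "continuous_on S r" "\<And>x. x \<in> S \<Longrightarrow> 0 \<le> r x" "continuous_on S v"
  shows "continuous_on S (\<lambda>x. T (r x) (v x))"
  using assms unfolding continuous_on_def
  by (auto intro!: tendsto_apply simp: eventually_at_filter)

lemma has_vector_derivative_orbit:
  assumes u: "gen T u v" and s: "0 \<le> s"
  shows "((\<lambda>s. T s u) has_vector_derivative T s v) (at s within {0..})"
  unfolding has_vector_derivative_within_quotient
proof -
  let ?q = "\<lambda>h. (T h u - u) /\<^sub>R h"
  have abs: "filterlim (\<lambda>y. \<bar>y - s\<bar>) (at_right 0) (at s within {0..})"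
    unfolding filterlim_at by (auto intro!: tendsto_eq_intros simp: eventually_at_filter)
  have "((\<lambda>y. T (min s y) (?q \<bar>y - s\<bar>)) \<longlongrightarrow> T s v) (at s within {0..})"
  proof (rule tendsto_apply)
    show "((\<lambda>y. min s y) \<longlongrightarrow> s) (at s within {0..})"
      by (auto intro!: tendsto_eq_intros)
    show "((\<lambda>y. ?q \<bar>y - s\<bar>) \<longlongrightarrow> v) (at s within {0..})"
      using u unfolding gen_def by (rule filterlim_compose[OF _ abs])
  qed (use s in \<open>auto simp: eventually_at_filter\<close>)
  then show "((\<lambda>y. (T y u - T s u) /\<^sub>R (y - s)) \<longlongrightarrow> T s v) (at s within {0..})"
  proof (rule Lim_transform_eventually)
    have "T (min s y) (?q \<bar>y - s\<bar>) = (T y u - T s u) /\<^sub>R (y - s)" if "y \<noteq> s" "0 \<le> y" for y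
    proof (cases "s \<le> y")
      case True
      then show ?thesis using s that add[of s "y - s" u]
        by (simp add: linear_diff[OF linear] linear_scale[OF linear])
    next
      case False
      then have "T (min s y) (?q \<bar>y - s\<bar>) = (T s u - T y u) /\<^sub>R (s - y)"
        using s that add[of y "s - y" u]
        by (simp add: linear_diff[OF linear] linear_scale[OF linear])
      also have "\<dots> = (T y u - T s u) /\<^sub>R (y - s)"
        using inverse_minus_eq[of "y - s"] by (simp add: scaleR_diff_right)
      finally show ?thesis .
    qed
    then show "\<forall>\<^sub>F y in at s within {0..}. T (min s y) (?q \<bar>y - s\<bar>) = (T y u - T s u) /\<^sub>R (y - s)"
      by (auto simp: eventually_at_filter)
  qed
qed

lemma gen_orbit:
  assumes "gen T u v" "0 \<le> s"
  shows "gen T (T s u) (T s v)"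
proof -
  have "((\<lambda>h. T s ((T h u - u) /\<^sub>R h)) \<longlongrightarrow> T s v) (at_right 0)"
    using assms by (intro tendsto_apply) (auto simp: gen_def)
  then show ?thesis unfolding gen_def
  proof (rule Lim_transform_eventually)
    have "T s ((T h u - u) /\<^sub>R h) = (T h (T s u) - T s u) /\<^sub>R h" if "h > 0" for h
      using that assms(2) add[of s h u] add[of h s u]
      by (simp add: linear_diff[OF linear] linear_scale[OF linear] add.commute)
    then show "\<forall>\<^sub>F h in at_right 0. T s ((T h u - u) /\<^sub>R h) = (T h (T s u) - T s u) /\<^sub>R h"
      by (auto simp: eventually_at_filter)
  qed
qed

lemma orbit_eqI:
  assumes t: "0 \<le> t"
    and deriv: "\<And>s. 0 \<le> s \<Longrightarrow> s \<le> t \<Longrightarrow> (v has_vector_derivative w s) (at s within {0..t})"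
    and gen: "\<And>s. 0 \<le> s \<Longrightarrow> s \<le> t \<Longrightarrow> gen T (v s) (w s)"
  shows "T t (v 0) = v t"
proof -
  have "((\<lambda>s. T (t - s) (v s)) has_derivative (\<lambda>h. 0)) (at s within {0..t})" if s: "s \<in> {0..t}" for s
  proof -
    have 1: "((\<lambda>y. T (t - y) ((v y - v s) /\<^sub>R (y - s))) \<longlongrightarrow> T (t - s) (w s)) (at s within {0..t})"
      using s deriv[of s] unfolding has_vector_derivative_within_quotient
      by (intro tendsto_apply) (auto intro!: tendsto_intros simp: eventually_at_filter)
    have "((\<lambda>y. T y (v s)) has_vector_derivative T (t - s) (w s)) (at (t - s) within {0..})"
      using s gen by (intro has_vector_derivative_orbit) auto
    then have "((\<lambda>y. T (t - y) (v s)) has_vector_derivative - T (t - s) (w s)) (at s within {0..t})"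
      by (intro has_vector_derivative_reflect, rule has_vector_derivative_within_subset) auto
    then have 2: "((\<lambda>y. (T (t - y) (v s) - T (t - s) (v s)) /\<^sub>R (y - s)) \<longlongrightarrow> - T (t - s) (w s))
        (at s within {0..t})"
      unfolding has_vector_derivative_within_quotient by simp
    have "((\<lambda>y. (T (t - y) (v y) - T (t - s) (v s)) /\<^sub>R (y - s)) \<longlongrightarrow> 0) (at s within {0..t})"
    proof (rule Lim_transform_eventually)
      show "((\<lambda>y. T (t - y) ((v y - v s) /\<^sub>R (y - s)) + (T (t - y) (v s) - T (t - s) (v s)) /\<^sub>R (y - s))
          \<longlongrightarrow> 0) (at s within {0..t})"
        using tendsto_add[OF 1 2] by simp
      have "T (t - y) ((v y - v s) /\<^sub>R (y - s)) + (T (t - y) (v s) - T (t - s) (v s)) /\<^sub>R (y - s)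
          = (T (t - y) (v y) - T (t - s) (v s)) /\<^sub>R (y - s)" if "y \<le> t" for y
        using that by (simp add: linear_diff[OF linear] linear_scale[OF linear] flip: scaleR_add_right)
      then show "\<forall>\<^sub>F y in at s within {0..t}. T (t - y) ((v y - v s) /\<^sub>R (y - s)) +
          (T (t - y) (v s) - T (t - s) (v s)) /\<^sub>R (y - s)
          = (T (t - y) (v y) - T (t - s) (v s)) /\<^sub>R (y - s)"
        by (auto simp: eventually_at_filter)
    qed
    then have "((\<lambda>s. T (t - s) (v s)) has_vector_derivative 0) (at s within {0..t})"
      by (rule iffD2[OF has_vector_derivative_within_quotient])
    then show ?thesis
      by (simp add: has_vector_derivative_def)
  qed
  then obtain c where "\<And>s. s \<in> {0..t} \<Longrightarrow> T (t - s) (v s) = c"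
    using has_derivative_zero_constant[of "{0..t}" "\<lambda>s. T (t - s) (v s)"] by auto
  from this[of 0] this[of t] t show ?thesis by (simp add: zero)
qed

lemma dense_domain:
  obtains w w' where "\<And>n::nat. gen T (w n) (w' n)" "w \<longlonglongrightarrow> u"
proof -
  define I where "I a = integral {0..a} (\<lambda>s. T s u)" for a
  have cont: "continuous_on {a..b} (\<lambda>s. T s u)" if "0 \<le> a" for a b
    using that by (intro continuous_on_subset[OF continuous_on_orbit]) auto
  have int: "(\<lambda>s. T s u) integrable_on {a..b}" if "0 \<le> a" for a b
    using cont[OF that] by (rule integrable_continuous_real)
  have I: "((\<lambda>h. (I (a + h) - I a) /\<^sub>R h) \<longlongrightarrow> T a u) (at_right 0)" if "0 \<le> a" for a
  proof -
    have "(I has_vector_derivative T a u) (at a within {0..a+1})"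
      unfolding I_def using that by (intro integral_has_vector_derivative cont) auto
    then have "((\<lambda>y. (I y - I a) /\<^sub>R (y - a)) \<longlongrightarrow> T a u) (at a within {0..a+1})"
      by (simp add: has_vector_derivative_within_quotient)
    moreover have "filterlim (\<lambda>h. a + h) (at a within {0..a+1}) (at_right 0)"
      unfolding filterlim_at
      using eventually_at_right_less[of "0::real"] that
      by (auto intro!: tendsto_eq_intros eventually_at_rightI[of 0 1])
    ultimately show ?thesis
      using filterlim_compose[of "\<lambda>y. (I y - I a) /\<^sub>R (y - a)" "nhds (T a u)"
          "at a within {0..a+1}" "\<lambda>h. a + h"] by simp
  qed
  have gen: "gen T (I a) (T a u - u)" if "0 \<le> a" for a
    unfolding gen_def
  proof (rule Lim_transform_eventually)
    show "((\<lambda>h. (I (a + h) - I a) /\<^sub>R h - (I (0 + h) - I 0) /\<^sub>R h) \<longlongrightarrow> T a u - u) (at_right 0)"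
      using tendsto_diff[OF I[OF that] I[of 0]] by (simp add: zero)
    have "(I (a + h) - I a) /\<^sub>R h - (I (0 + h) - I 0) /\<^sub>R h = (T h (I a) - I a) /\<^sub>R h" if h: "h > 0" for h
    proof -
      have "T h (I a) = integral {0..a} (T h \<circ> (\<lambda>s. T s u))"
        unfolding I_def using h by (intro integral_linear[symmetric] int bounded_linear) auto
      also have "\<dots> = integral {0..a} (\<lambda>s. T (s + h) u)"
        using h by (intro Henstock_Kurzweil_Integration.integral_cong) (simp add: add[symmetric] add.commute)
      also have "\<dots> = integral {h..a + h} (\<lambda>s. T s u)"
        using integral_shift_Icc_real[of 0 a "\<lambda>s. T s u" h] by (simp add: o_def add.commute)
      finally have "T h (I a) = integral {h..a + h} (\<lambda>s. T s u)" .
      moreover have "I h + integral {h..a + h} (\<lambda>s. T s u) = I (a + h)"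
        unfolding I_def using h \<open>0 \<le> a\<close> by (intro Henstock_Kurzweil_Integration.integral_combine int) auto
      moreover have "I 0 = 0" by (simp add: I_def)
      ultimately show ?thesis by (simp add: algebra_simps flip: scaleR_diff_right)
    qed
    then show "\<forall>\<^sub>F h in at_right 0. (I (a + h) - I a) /\<^sub>R h - (I (0 + h) - I 0) /\<^sub>R h
        = (T h (I a) - I a) /\<^sub>R h"
      by (auto simp: eventually_at_filter)
  qed
  define h where "h n = inverse (real (Suc n))" for n
  have lin: "gen T (c *\<^sub>R x) (c *\<^sub>R y)" if "gen T x y" for c x y
  proof -
    have "((\<lambda>t. c *\<^sub>R ((T t x - x) /\<^sub>R t)) \<longlongrightarrow> c *\<^sub>R y) (at_right 0)"
      using that unfolding gen_def by (intro tendsto_intros)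
    then show ?thesis unfolding gen_def
      by (rule Lim_transform_eventually)
        (auto simp: eventually_at_filter linear_scale[OF linear] scaleR_diff_right mult.commute)
  qed
  show thesis
  proof (rule that[of "\<lambda>n. I (h n) /\<^sub>R h n"])
    show "gen T (I (h n) /\<^sub>R h n) ((T (h n) u - u) /\<^sub>R h n)" for n
      by (intro lin gen) (simp add: h_def)
    have "filterlim h (at_right 0) sequentially"
      unfolding filterlim_at h_def using LIMSEQ_inverse_real_of_nat by auto
    from filterlim_compose[OF I[of 0] this] show "(\<lambda>n. I (h n) /\<^sub>R h n) \<longlonglongrightarrow> u"
      by (simp add: zero I_def)
  qed
qed

end

text \<open>The assumption \<open>perturb\<close> says that the generator of \<open>R\<close> is, weakly, the adjoint of the
  generator of \<open>T\<close> plus \<open>W\<close>.\<close>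

lemma duhamel:
  fixes R T :: "real \<Rightarrow> 'a::{real_inner, banach} \<Rightarrow> 'a"
  assumes "strongly_continuous_semigroup R" "strongly_continuous_semigroup T"
    and W: "bounded_linear W"
    and perturb: "\<And>u u' v v'. gen R u u' \<Longrightarrow> gen T v v' \<Longrightarrow> u' \<bullet> v - u \<bullet> v' = W u \<bullet> v"
    and t: "0 \<le> t"
  shows "((\<lambda>s. W (R s f) \<bullet> T (t - s) g) has_integral (R t f \<bullet> g - f \<bullet> T t g)) {0..t}"
proof -
  interpret R: strongly_continuous_semigroup R by fact
  interpret T: strongly_continuous_semigroup T by fact
  have contR: "continuous_on {0..t} (\<lambda>s. R s u)" for u
    by (rule continuous_on_subset[OF R.continuous_on_orbit]) auto
  have contT: "continuous_on {0..t} (\<lambda>s. T (t - s) u)" for u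
    by (intro T.continuous_on_apply continuous_intros) auto
  have domain: "((\<lambda>s. W (R s f) \<bullet> T (t - s) g) has_integral (R t f \<bullet> g - f \<bullet> T t g)) {0..t}"
    if f: "gen R f f'" and g: "gen T g g'" for f f' g g'
  proof -
    have deriv: "((\<lambda>s. R s f \<bullet> T (t - s) g) has_vector_derivative W (R s f) \<bullet> T (t - s) g) (at s within {0..t})"
      if s: "s \<in> {0..t}" for s
    proof -
      have 1: "((\<lambda>s. R s f) has_vector_derivative R s f') (at s within {0..t})"
        using s by (intro has_vector_derivative_within_subset[OF R.has_vector_derivative_orbit[OF f]]) auto
      have 2: "((\<lambda>y. T (t - y) g) has_vector_derivative - T (t - s) g') (at s within {0..t})"
        using s by (intro has_vector_derivative_reflect
            has_vector_derivative_within_subset[OF T.has_vector_derivative_orbit[OF g]]) auto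
      have "((\<lambda>s. R s f \<bullet> T (t - s) g) has_vector_derivative
          R s f \<bullet> (- T (t - s) g') + R s f' \<bullet> T (t - s) g) (at s within {0..t})"
        by (rule bounded_bilinear.has_vector_derivative[OF bounded_bilinear_inner 1 2])
      moreover have "R s f \<bullet> (- T (t - s) g') + R s f' \<bullet> T (t - s) g = W (R s f) \<bullet> T (t - s) g"
        using perturb[OF R.gen_orbit[OF f] T.gen_orbit[OF g], of s "t - s"] s by simp
      ultimately show ?thesis by simp
    qed
    from fundamental_theorem_of_calculus[OF t deriv] show ?thesis
      by (simp add: R.zero T.zero)
  qed
  obtain f1 f1' where f1: "\<And>n. gen R (f1 n) (f1' n)" "f1 \<longlonglongrightarrow> f"
    using R.dense_domain by blast
  obtain g1 g1' where g1: "\<And>n. gen T (g1 n) (g1' n)" "g1 \<longlonglongrightarrow> g"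
    using T.dense_domain by blast
  obtain MR where MR: "MR \<ge> 1" "\<And>s u. 0 \<le> s \<Longrightarrow> s \<le> t \<Longrightarrow> norm (R s u) \<le> MR * norm u"
    using R.locally_bounded[of t] by blast
  obtain MT where MT: "MT \<ge> 1" "\<And>s u. 0 \<le> s \<Longrightarrow> s \<le> t \<Longrightarrow> norm (T s u) \<le> MT * norm u"
    using T.locally_bounded[of t] by blast
  obtain MW where MW: "MW > 0" "\<And>u. norm (W u) \<le> norm u * MW"
    using bounded_linear.pos_bounded[OF W] by blast
  obtain Kf where Kf: "\<And>n. norm (f1 n) \<le> Kf"
    using convergent_imp_Bseq[of f1] f1(2) by (auto simp: convergent_def Bseq_def)
  obtain Kg where Kg: "\<And>n. norm (g1 n) \<le> Kg"
    using convergent_imp_Bseq[of g1] g1(2) by (auto simp: convergent_def Bseq_def)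
  have nonneg: "0 \<le> Kf" "0 \<le> Kg" using Kf[of 0] Kg[of 0] by (meson norm_ge_zero order_trans)+
  let ?F = "\<lambda>n s. W (R s (f1 n)) \<bullet> T (t - s) (g1 n)"
  have int: "(?F n has_integral (R t (f1 n) \<bullet> g1 n - f1 n \<bullet> T t (g1 n))) {0..t}" for n
    by (rule domain[OF f1(1) g1(1)])
  have bound: "norm (?F n s) \<le> MR * Kf * MW * (MT * Kg)" if "s \<in> {0..t}" for n s
  proof -
    have "norm (W (R s (f1 n))) \<le> norm (R s (f1 n)) * MW" by (rule MW)
    also have "\<dots> \<le> MR * Kf * MW"
      using order_trans[OF MR(2)[of s "f1 n"] mult_left_mono[OF Kf[of n], of MR]] MR(1) MW(1) that
      by (intro mult_right_mono) auto
    finally have 1: "norm (W (R s (f1 n))) \<le> MR * Kf * MW" .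
    have 2: "norm (T (t - s) (g1 n)) \<le> MT * Kg"
      using order_trans[OF MT(2)[of "t - s" "g1 n"] mult_left_mono[OF Kg[of n], of MT]] MT(1) that by auto
    have "norm (?F n s) \<le> norm (W (R s (f1 n))) * norm (T (t - s) (g1 n))"
      using Cauchy_Schwarz_ineq2 by simp
    also have "\<dots> \<le> MR * Kf * MW * (MT * Kg)"
      using 1 2 by (intro mult_mono) (auto intro: order_trans[OF norm_ge_zero])
    finally show ?thesis .
  qed
  have limR: "(\<lambda>n. R s (f1 n)) \<longlonglongrightarrow> R s f" if "0 \<le> s" for s
    using that f1(2) by (intro R.tendsto_apply) auto
  have limT: "(\<lambda>n. T s (g1 n)) \<longlonglongrightarrow> T s g" if "0 \<le> s" for s
    using that g1(2) by (intro T.tendsto_apply) auto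
  have lim: "(\<lambda>n. ?F n s) \<longlonglongrightarrow> W (R s f) \<bullet> T (t - s) g" if "s \<in> {0..t}" for s
    using that by (intro tendsto_inner bounded_linear.tendsto[OF W] limR limT) auto
  have 1: "(\<lambda>s. W (R s f) \<bullet> T (t - s) g) integrable_on {0..t}"
    and 2: "(\<lambda>n. integral {0..t} (?F n)) \<longlonglongrightarrow> integral {0..t} (\<lambda>s. W (R s f) \<bullet> T (t - s) g)"
    using dominated_convergence[of ?F "{0..t}" "\<lambda>_. MR * Kf * MW * (MT * Kg)", OF _ _ bound lim] int
    by (auto simp: has_integral_iff)
  have "(\<lambda>n. integral {0..t} (?F n)) = (\<lambda>n. R t (f1 n) \<bullet> g1 n - f1 n \<bullet> T t (g1 n))"
    using int by (auto simp: has_integral_iff)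
  moreover have "(\<lambda>n. R t (f1 n) \<bullet> g1 n - f1 n \<bullet> T t (g1 n)) \<longlonglongrightarrow> R t f \<bullet> g - f \<bullet> T t g"
    using t by (intro tendsto_intros limR limT f1 g1) auto
  ultimately have "integral {0..t} (\<lambda>s. W (R s f) \<bullet> T (t - s) g) = R t f \<bullet> g - f \<bullet> T t g"
    using 2 LIMSEQ_unique by fastforce
  with 1 show ?thesis by (simp add: has_integral_iff)
qed

lemma semigroup_symmetric:
  fixes T :: "real \<Rightarrow> 'a::{real_inner, banach} \<Rightarrow> 'a"
  assumes "strongly_continuous_semigroup T" "0 \<le> t"
    and "\<And>u u' v v'. gen T u u' \<Longrightarrow> gen T v v' \<Longrightarrow> u' \<bullet> v = u \<bullet> v'"
  shows "T t f \<bullet> g = f \<bullet> T t g"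
proof -
  have "((\<lambda>s. 0 \<bullet> T (t - s) g) has_integral (T t f \<bullet> g - f \<bullet> T t g)) {0..t}"
    by (rule duhamel[OF assms(1,1) bounded_linear_zero _ assms(2)]) (simp add: assms(3))
  then show ?thesis by simp
qed

text \<open>Iterating Duhamel's formula shows that the negative part of \<open>R t f \<bullet> g\<close> is at most the
  \<open>n\<close>-th Taylor remainder of an exponential, for every \<open>n\<close>.\<close>

lemma perturbed_nonneg:
  fixes R T :: "real \<Rightarrow> 'a::{real_inner, banach} \<Rightarrow> 'a"
  assumes R: "strongly_continuous_semigroup R" and T: "strongly_continuous_semigroup T"
    and W: "bounded_linear W" "\<And>u v. W u \<bullet> v = u \<bullet> W v"
    and perturb: "\<And>u u' v v'. gen R u u' \<Longrightarrow> gen T v v' \<Longrightarrow> u' \<bullet> v - u \<bullet> v' = W u \<bullet> v"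
    and P: "\<And>u v. u \<in> P \<Longrightarrow> v \<in> P \<Longrightarrow> 0 \<le> u \<bullet> v" "\<And>u. u \<in> P \<Longrightarrow> W u \<in> P"
      "\<And>t u. 0 \<le> t \<Longrightarrow> u \<in> P \<Longrightarrow> T t u \<in> P"
    and t: "0 \<le> t" and f: "f \<in> P" and g: "g \<in> P"
  shows "0 \<le> R t f \<bullet> g"
proof -
  interpret R: strongly_continuous_semigroup R by fact
  interpret T: strongly_continuous_semigroup T by fact
  obtain MR where MR: "MR \<ge> 1" "\<And>s u. 0 \<le> s \<Longrightarrow> s \<le> t \<Longrightarrow> norm (R s u) \<le> MR * norm u"
    using R.locally_bounded[of t] by blast
  obtain MT where MT: "MT \<ge> 1" "\<And>s u. 0 \<le> s \<Longrightarrow> s \<le> t \<Longrightarrow> norm (T s u) \<le> MT * norm u"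
    using T.locally_bounded[of t] by blast
  obtain MW where MW: "MW > 0" "\<And>u. norm (W u) \<le> norm u * MW"
    using bounded_linear.pos_bounded[OF W(1)] by blast
  define c where "c = MW * MT"
  define K where "K = MR * norm f"
  have c: "0 \<le> c" "0 \<le> K" using MW MT MR by (auto simp: c_def K_def)
  have key: "- (R s f \<bullet> g) \<le> K * norm g * ((c * s) ^ n / fact n)"
    if "0 \<le> s" "s \<le> t" "g \<in> P" for n s g
    using that
  proof (induction n arbitrary: s g)
    case 0
    have "- (R s f \<bullet> g) \<le> norm (R s f) * norm g"
      using Cauchy_Schwarz_ineq2[of "R s f" g] by linarith
    also have "\<dots> \<le> K * norm g"
      using MR(2)[OF 0(1,2), of f] by (intro mult_right_mono) (auto simp: K_def)
    finally show ?case by simp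
  next
    case (Suc n)
    let ?b = "\<lambda>r. K * norm g * (c ^ Suc n * (r ^ n / fact n))"
    have lower: "- ?b r \<le> W (R r f) \<bullet> T (s - r) g" if r: "r \<in> {0..s}" for r
    proof -
      have "- (W (R r f) \<bullet> T (s - r) g) = - (R r f \<bullet> W (T (s - r) g))" by (simp add: W)
      also have "\<dots> \<le> K * norm (W (T (s - r) g)) * ((c * r) ^ n / fact n)"
        using r Suc.prems by (intro Suc.IH P) auto
      also have "\<dots> \<le> K * (c * norm g) * ((c * r) ^ n / fact n)"
      proof (intro mult_right_mono mult_left_mono)
        have "norm (W (T (s - r) g)) \<le> norm (T (s - r) g) * MW" by (rule MW)
        also have "\<dots> \<le> (MT * norm g) * MW"
          using r Suc.prems MW(1) by (intro mult_right_mono MT) auto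
        finally show "norm (W (T (s - r) g)) \<le> c * norm g" by (simp add: c_def mult_ac)
      qed (use c r in auto)
      finally show ?thesis by (simp add: power_mult_distrib mult_ac)
    qed
    have "((\<lambda>r. r ^ n / fact n) has_integral (s ^ Suc n / fact (Suc n) - 0 ^ Suc n / fact (Suc n))) {0..s}"
    proof (rule fundamental_theorem_of_calculus[OF Suc.prems(1)])
      fix r assume "r \<in> {0..s}"
      have "((\<lambda>r. r ^ Suc n / fact (Suc n)) has_real_derivative (real (Suc n) * r ^ n / fact (Suc n))) (at r within {0..s})"
        using DERIV_cdivide[OF has_field_derivative_at_within[OF DERIV_pow[of "Suc n" r]], where c = "fact (Suc n)"]
        by (simp del: fact_Suc of_nat_Suc power_Suc)
      moreover have "real (Suc n) * r ^ n / fact (Suc n) = r ^ n / fact n"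
        by (simp del: of_nat_Suc)
      ultimately show "((\<lambda>r. r ^ Suc n / fact (Suc n)) has_vector_derivative r ^ n / fact n) (at r within {0..s})"
        by (simp add: has_real_derivative_iff_has_vector_derivative del: fact_Suc)
    qed
    then have "((\<lambda>r. - ?b r) has_integral (- (K * norm g * (c ^ Suc n * (s ^ Suc n / fact (Suc n)))))) {0..s}"
      by (intro has_integral_neg has_integral_mult_right) simp
    from has_integral_le[OF this duhamel[OF R T W(1) perturb Suc.prems(1), of f g] lower]
    have "- (K * norm g * (c ^ Suc n * (s ^ Suc n / fact (Suc n)))) \<le> R s f \<bullet> g - f \<bullet> T s g"
      by simp
    moreover have "0 \<le> f \<bullet> T s g"
      using f Suc.prems by (intro P) auto
    ultimately show ?case by (simp add: power_mult_distrib mult_ac)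
  qed
  have "(\<lambda>n. K * norm g * ((c * t) ^ n / fact n)) \<longlonglongrightarrow> K * norm g * 0"
    using summable_LIMSEQ_zero[OF summable_exp[of "c * t"]]
    by (intro tendsto_intros) (simp add: divide_inverse mult.commute)
  then have "- (R t f \<bullet> g) \<le> K * norm g * 0"
    by (rule LIMSEQ_le_const) (use key[OF t order.refl g] in auto)
  then show ?thesis by simp
qed

lemma perturbed_ge:
  fixes R T :: "real \<Rightarrow> 'a::{real_inner, banach} \<Rightarrow> 'a"
  assumes R: "strongly_continuous_semigroup R" and T: "strongly_continuous_semigroup T"
    and W: "bounded_linear W" "\<And>u v. W u \<bullet> v = u \<bullet> W v"
    and perturb: "\<And>u u' v v'. gen R u u' \<Longrightarrow> gen T v v' \<Longrightarrow> u' \<bullet> v - u \<bullet> v' = W u \<bullet> v"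
    and P: "\<And>u v. u \<in> P \<Longrightarrow> v \<in> P \<Longrightarrow> 0 \<le> u \<bullet> v" "\<And>u. u \<in> P \<Longrightarrow> W u \<in> P"
      "\<And>t u. 0 \<le> t \<Longrightarrow> u \<in> P \<Longrightarrow> T t u \<in> P"
    and t: "0 \<le> t" and f: "f \<in> P" and g: "g \<in> P"
  shows "f \<bullet> T t g \<le> R t f \<bullet> g"
proof -
  have "0 \<le> W (R s f) \<bullet> T (t - s) g" if "s \<in> {0..t}" for s
    unfolding W(2) using that f g
    by (intro perturbed_nonneg[OF R T W perturb P(1,2,3)] P) auto
  from has_integral_nonneg[OF duhamel[OF R T W(1) perturb t] this] show ?thesis by simp
qed

section \<open>Test functions\<close>

definition bump :: "nat \<Rightarrow> real \<Rightarrow> real" where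
  "bump k x = (if 0 < x then (1 / x) ^ k * exp (- (1 / x)) else 0)"

lemma bump_nonneg: "0 \<le> bump k x"
  by (simp add: bump_def)

lemma bump_le_fact: "bump k x \<le> fact k"
proof (cases "0 < x")
  case True
  have "(1 / x) ^ k / fact k \<le> exp (1 / x)"
  proof -
    have "(\<Sum>n\<in>{k}. (1 / x) ^ n /\<^sub>R fact n) \<le> (\<Sum>n. (1 / x) ^ n /\<^sub>R fact n)"
      using True by (intro sum_le_suminf summable_exp_generic) auto
    then show ?thesis by (simp add: exp_def divide_inverse mult.commute)
  qed
  then show ?thesis using True by (simp add: bump_def exp_minus field_simps)
qed (simp add: bump_def)

lemma bump_tendsto_0: "(bump k \<longlongrightarrow> 0) (at 0)"
proof -
  have "((\<lambda>x. (1 / x) ^ k / exp (1 / x)) \<longlongrightarrow> (0::real)) (at_right 0)"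
    by (rule filterlim_compose[OF tendsto_power_div_exp_0])
      (simp add: divide_inverse filterlim_inverse_at_top_right)
  then have "(bump k \<longlongrightarrow> 0) (at_right 0)"
    by (rule Lim_transform_eventually)
      (auto simp: bump_def eventually_at_filter exp_minus divide_inverse)
  moreover have "(bump k \<longlongrightarrow> 0) (at_left 0)"
    by (rule Lim_transform_eventually[OF tendsto_const]) (auto simp: bump_def eventually_at_filter)
  ultimately show ?thesis by (simp add: filterlim_split_at)
qed

lemma bump_deriv:
  "(bump k has_real_derivative bump (k + 2) x - real k * bump (k + 1) x) (at x)"
proof -
  consider "x > 0" | "x < 0" | "x = 0" by linarith
  then show ?thesis
  proof cases
    case 1
    have "((\<lambda>x. (1 / x) ^ k * exp (- (1 / x))) has_real_derivative
        bump (k + 2) x - real k * bump (k + 1) x) (at x)"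
    proof -
      have "(1 / x) ^ k * (exp (- (1 / x)) * (1 / x ^ 2)) + real k * (1 / x) ^ (k - 1) * (- (1 / x ^ 2)) * exp (- (1 / x))
          = bump (k + 2) x - real k * bump (k + 1) x"
        using 1 by (cases k) (simp_all add: bump_def power2_eq_square algebra_simps add_divide_distrib)
      then show ?thesis using 1
        by (auto intro!: derivative_eq_intros simp: power2_eq_square mult.commute)
    qed
    then show ?thesis
      by (rule DERIV_cong_ev[THEN iffD1, rotated -1, OF _ refl])
        (use 1 in \<open>auto simp: bump_def eventually_nhds intro!: exI[of _ "{0<..}"]\<close>)
  next
    case 2
    have "((\<lambda>x. 0) has_real_derivative bump (k + 2) x - real k * bump (k + 1) x) (at x)"
      using 2 by (simp add: bump_def)
    then show ?thesis
      by (rule DERIV_cong_ev[THEN iffD1, rotated -1, OF _ refl])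
        (use 2 in \<open>auto simp: bump_def eventually_nhds intro!: exI[of _ "{..<0}"]\<close>)
  next
    case 3
    have eq: "(\<lambda>h. (bump k (0 + h) - bump k 0) / h) = bump (Suc k)"
      by (auto simp: bump_def fun_eq_iff)
    have "bump (k + 2) 0 - real k * bump (k + 1) 0 = 0"
      by (simp add: bump_def)
    then show ?thesis using bump_tendsto_0[of "Suc k"]
      unfolding 3 DERIV_def eq by simp
  qed
qed

text \<open>A class of functions that is closed under differentiation, rich enough to contain Gaussians
  and cutoffs.\<close>

inductive_set smooth_funs :: "(real \<Rightarrow> real) set" where
  smooth_const: "(\<lambda>x. c) \<in> smooth_funs"
| smooth_ident: "(\<lambda>x. x) \<in> smooth_funs"
| smooth_gauss: "(\<lambda>x. exp (- (b * (x - a)\<^sup>2))) \<in> smooth_funs"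
| smooth_bump: "(\<lambda>x. bump k (c * x + d)) \<in> smooth_funs"
| smooth_add: "f \<in> smooth_funs \<Longrightarrow> g \<in> smooth_funs \<Longrightarrow> (\<lambda>x. f x + g x) \<in> smooth_funs"
| smooth_mult: "f \<in> smooth_funs \<Longrightarrow> g \<in> smooth_funs \<Longrightarrow> (\<lambda>x. f x * g x) \<in> smooth_funs"

lemma smooth_diff:
  assumes "f \<in> smooth_funs" "g \<in> smooth_funs"
  shows "(\<lambda>x. f x - g x) \<in> smooth_funs"
  using smooth_add[OF assms(1) smooth_mult[OF smooth_const[of "- 1"] assms(2)]] by simp

lemma smooth_funs_deriv:
  assumes "f \<in> smooth_funs"
  shows "\<exists>f'\<in>smooth_funs. \<forall>x. (f has_real_derivative f' x) (at x)"
  using assms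
proof induction
  case (smooth_const c)
  show ?case by (intro bexI[of _ "\<lambda>x. 0"] smooth_funs.intros) auto
next
  case smooth_ident
  show ?case by (intro bexI[of _ "\<lambda>x. 1"] smooth_funs.intros) (auto intro!: derivative_eq_intros)
next
  case (smooth_gauss b a)
  show ?case
    by (intro bexI[of _ "\<lambda>x. ((- 2 * b) * (x - a)) * exp (- (b * (x - a)\<^sup>2))"]
        smooth_funs.intros smooth_diff) (auto intro!: derivative_eq_intros)
next
  case (smooth_bump k c d)
  have "((\<lambda>x. bump k (c * x + d)) has_real_derivative
      c * (bump (k + 2) (c * x + d) - real k * bump (k + 1) (c * x + d))) (at x)" for x
    by (rule DERIV_chain2[OF bump_deriv, THEN DERIV_cong]) (auto intro!: derivative_eq_intros)
  then show ?case
    by (intro bexI[of _ "\<lambda>x. c * (bump (k + 2) (c * x + d) - real k * bump (k + 1) (c * x + d))"]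
        smooth_funs.intros smooth_diff) auto
next
  case (smooth_add f g)
  then obtain f' g' where "f' \<in> smooth_funs" "g' \<in> smooth_funs"
    "\<And>x. (f has_real_derivative f' x) (at x)" "\<And>x. (g has_real_derivative g' x) (at x)" by blast
  then show ?case
    by (intro bexI[of _ "\<lambda>x. f' x + g' x"] smooth_funs.intros) (auto intro!: derivative_eq_intros)
next
  case (smooth_mult f g)
  then obtain f' g' where "f' \<in> smooth_funs" "g' \<in> smooth_funs"
    "\<And>x. (f has_real_derivative f' x) (at x)" "\<And>x. (g has_real_derivative g' x) (at x)" by blast
  then show ?case using smooth_mult.hyps
    by (intro bexI[of _ "\<lambda>x. f x * g' x + f' x * g x"] smooth_funs.intros)
      (auto intro!: derivative_eq_intros)
qed

lemma smooth_funs_deriv_eq: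
  assumes "f \<in> smooth_funs" "\<And>x. (f has_real_derivative f' x) (at x)"
  shows "f' \<in> smooth_funs"
proof -
  obtain g where g: "g \<in> smooth_funs" "\<And>x. (f has_real_derivative g x) (at x)"
    using smooth_funs_deriv[OF assms(1)] by blast
  have "f' = g" using assms(2) g(2) DERIV_unique by blast
  with g(1) show ?thesis by simp
qed

lemma smooth_funs_continuous: "f \<in> smooth_funs \<Longrightarrow> continuous_on S f"
  using smooth_funs_deriv[of f] by (meson DERIV_continuous continuous_at_imp_continuous_on)

lemma vderiv_eqI: "(\<And>x. (f has_vector_derivative f' x) (at x)) \<Longrightarrow> vderiv f = f'"
  by (auto simp: fun_eq_iff vector_derivative_at)

lemma of_real_has_vector_derivative:
  assumes "(f has_real_derivative f') (at x)"
  shows "((\<lambda>x. of_real (f x) :: 'k::real_normed_field) has_vector_derivative of_real f') (at x)"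
  using assms by (intro bounded_linear.has_vector_derivative[OF bounded_linear_of_real])
    (simp add: has_real_derivative_iff_has_vector_derivative)

lemma vderiv_iter_of_real:
  assumes "f \<in> smooth_funs"
  shows "\<exists>g\<in>smooth_funs. (vderiv ^^ n) (\<lambda>x. of_real (f x) :: 'k::real_normed_field) = (\<lambda>x. of_real (g x))"
proof (induction n)
  case 0
  then show ?case using assms by auto
next
  case (Suc n)
  then obtain g where g: "g \<in> smooth_funs"
    "(vderiv ^^ n) (\<lambda>x. of_real (f x) :: 'k) = (\<lambda>x. of_real (g x))" by blast
  obtain g' where g': "g' \<in> smooth_funs" "\<And>x. (g has_real_derivative g' x) (at x)"
    using smooth_funs_deriv[OF g(1)] by blast
  have "(vderiv ^^ Suc n) (\<lambda>x. of_real (f x) :: 'k) = (\<lambda>x. of_real (g' x))"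
    using vderiv_eqI[OF of_real_has_vector_derivative[OF g'(2)]] by (simp add: g(2))
  then show ?case using g'(1) by blast
qed

lemma test_function_of_real:
  assumes "f \<in> smooth_funs" "0 < a" "\<And>x. x \<notin> {a..b} \<Longrightarrow> f x = 0"
  shows "test_function (\<lambda>x. of_real (f x) :: 'k::real_normed_field)"
  unfolding test_function_def
proof (intro conjI allI)
  fix n x
  obtain g where g: "g \<in> smooth_funs"
    "(vderiv ^^ n) (\<lambda>x. of_real (f x) :: 'k) = (\<lambda>x. of_real (g x))"
    using vderiv_iter_of_real[OF assms(1)] by blast
  obtain g' where "\<And>x. (g has_real_derivative g' x) (at x)"
    using smooth_funs_deriv[OF g(1)] by blast
  then show "(vderiv ^^ n) (\<lambda>x. of_real (f x) :: 'k) differentiable at x"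
    unfolding g(2) using of_real_has_vector_derivative by (metis differentiableI_vector)
qed (use assms(2,3) in auto)

lemma test_function_vderiv: "test_function \<phi> \<Longrightarrow> (\<phi> has_vector_derivative vderiv \<phi> x) (at x)"
  unfolding test_function_def using vector_derivative_works by (metis funpow_0)

lemma vderiv_eq_0_outside:
  assumes "\<And>x. x \<notin> {a..b} \<Longrightarrow> \<phi> x = 0" "x \<notin> {a..b}"
  shows "vderiv \<phi> x = 0"
proof -
  have "((\<lambda>x. 0) has_vector_derivative 0) (at x)" by simp
  then have "(\<phi> has_vector_derivative 0) (at x)"
    by (rule has_vector_derivative_transform_within_open[of _ _ _ "- {a..b}"]) (use assms in auto)
  then show ?thesis by (rule vector_derivative_at)
qed

lemma test_function_vderiv_test_function:
  assumes "test_function \<phi>"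
  shows "test_function (vderiv \<phi>)"
  unfolding test_function_def
proof (intro conjI allI)
  show "(vderiv ^^ n) (vderiv \<phi>) differentiable at x" for n x
    using assms unfolding test_function_def by (metis funpow_Suc_right comp_apply)
  obtain a b where ab: "0 < a" "\<And>x. x \<notin> {a..b} \<Longrightarrow> \<phi> x = 0"
    using assms unfolding test_function_def by blast
  show "\<exists>a b. 0 < a \<and> (\<forall>x. x \<notin> {a..b} \<longrightarrow> vderiv \<phi> x = 0)"
    using ab(1) vderiv_eq_0_outside[of a b \<phi>, OF ab(2)] by blast
qed

lemma test_function_continuous: "test_function \<phi> \<Longrightarrow> continuous_on S \<phi>"
  using test_function_vderiv
  by (metis has_vector_derivative_continuous continuous_at_imp_continuous_on)

lemma test_function_inner:
  fixes \<phi> :: "real \<Rightarrow> 'k::{real_normed_field, euclidean_space}"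
  assumes "test_function \<phi>"
  shows "test_function (\<lambda>x. of_real (\<phi> x \<bullet> b) :: 'k)"
    and "vderiv (\<lambda>x. of_real (\<phi> x \<bullet> b) :: 'k) = (\<lambda>x. of_real (vderiv \<phi> x \<bullet> b))"
proof -
  have d: "((\<lambda>x. of_real (\<psi> x \<bullet> b) :: 'k) has_vector_derivative of_real (vderiv \<psi> x \<bullet> b)) (at x)"
    if "\<psi> differentiable at x" for x and \<psi> :: "real \<Rightarrow> 'k"
  proof -
    have "(\<psi> has_vector_derivative vderiv \<psi> x) (at x)"
      using that vector_derivative_works by blast
    then show ?thesis
      by (intro bounded_linear.has_vector_derivative[OF bounded_linear_of_real]
          bounded_linear.has_vector_derivative[OF bounded_linear_inner_left])
  qed
  have diff: "(vderiv ^^ n) \<phi> differentiable at x" for n x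
    using assms by (simp add: test_function_def)
  have iter: "(vderiv ^^ n) (\<lambda>x. of_real (\<phi> x \<bullet> b) :: 'k) = (\<lambda>x. of_real ((vderiv ^^ n) \<phi> x \<bullet> b))" for n
  proof (induction n)
    case (Suc n)
    show ?case using vderiv_eqI[OF d[OF diff[of n]]] by (simp add: Suc)
  qed simp
  show "test_function (\<lambda>x. of_real (\<phi> x \<bullet> b) :: 'k)"
    unfolding test_function_def
  proof (intro conjI allI)
    show "(vderiv ^^ n) (\<lambda>x. of_real (\<phi> x \<bullet> b) :: 'k) differentiable at x" for n x
      unfolding iter using d[OF diff] by (metis differentiableI_vector)
    show "\<exists>a ba. 0 < a \<and> (\<forall>x. x \<notin> {a..ba} \<longrightarrow> of_real (\<phi> x \<bullet> b) = (0::'k))"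
      using assms unfolding test_function_def by (metis inner_zero_left of_real_0)
  qed
  show "vderiv (\<lambda>x. of_real (\<phi> x \<bullet> b) :: 'k) = (\<lambda>x. of_real (vderiv \<phi> x \<bullet> b))"
    using iter[of 1] by simp
qed

lemma compactly_supported_integrable:
  fixes \<psi> :: "real \<Rightarrow> 'k::euclidean_space"
  assumes "continuous_on UNIV \<psi>" "\<And>x. x \<notin> {a..b} \<Longrightarrow> \<psi> x = 0"
  shows "integrable lborel \<psi>"
proof -
  have "set_integrable lborel {a..b} \<psi>"
    by (intro borel_integrable_atLeastAtMost' continuous_on_subset[OF assms(1)]) simp
  moreover have "(\<lambda>x. indicator {a..b} x *\<^sub>R \<psi> x) = \<psi>"
    using assms(2) by (auto simp: indicator_def fun_eq_iff)
  ultimately show ?thesis by (simp add: set_integrable_def)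
qed

lemma sq_integrable_test_function:
  fixes \<phi> :: "real \<Rightarrow> 'k::{real_normed_field, euclidean_space}"
  assumes "test_function \<phi>"
  shows "sq_integrable \<phi>"
proof -
  obtain a b where ab: "0 < a" "\<And>x. x \<notin> {a..b} \<Longrightarrow> \<phi> x = 0"
    using assms unfolding test_function_def by blast
  have "integrable lborel (\<lambda>x. (norm (\<phi> x))\<^sup>2)"
    using ab test_function_continuous[OF assms]
    by (intro compactly_supported_integrable[of _ a b] continuous_intros) auto
  moreover have "\<phi> \<in> borel_measurable borel"
    by (intro borel_measurable_continuous_onI test_function_continuous assms)
  ultimately show ?thesis
    by (simp add: sq_integrable_def integrable_halfline borel_measurable_halfline)
qed

lemma integral_halfline_deriv_eq_0:
  fixes \<psi> :: "real \<Rightarrow> 'k::euclidean_space"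
  assumes ab: "0 < a" "\<And>x. x \<notin> {a..b} \<Longrightarrow> \<psi> x = 0"
    and deriv: "\<And>x. (\<psi> has_vector_derivative \<psi>' x) (at x)" and cont: "continuous_on UNIV \<psi>'"
  shows "(\<integral>x. \<psi>' x \<partial>halfline) = 0"
proof -
  define c where "c = max (a + 1) (b + 1)"
  have out: "\<psi>' x = 0" if "x \<notin> {a..b}" for x
    using vderiv_eq_0_outside[of a b \<psi>, OF ab(2) that] vector_derivative_at[OF deriv[of x]] by simp
  have [measurable]: "\<psi>' \<in> borel_measurable borel"
    by (intro borel_measurable_continuous_onI cont)
  have "(\<integral>x. \<psi>' x \<partial>halfline) = (\<integral>x. indicator {0<..} x *\<^sub>R \<psi>' x \<partial>lebesgue)"
    by (subst integral_restrict_space) auto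
  also have "\<dots> = (\<integral>x. indicator {0<..} x *\<^sub>R \<psi>' x \<partial>lborel)"
    by (intro integral_completion) auto
  also have "\<dots> = (\<integral>x. indicator {a / 2..c} x *\<^sub>R \<psi>' x \<partial>lborel)"
    using ab(1) out by (intro Bochner_Integration.integral_cong) (auto simp: indicator_def c_def not_le)
  also have "\<dots> = \<psi> c - \<psi> (a / 2)"
    using ab(1) deriv cont
    by (intro integral_FTC_atLeastAtMost)
      (auto simp: c_def max_def intro: has_vector_derivative_at_within continuous_on_subset)
  also have "\<dots> = 0" using ab by (simp add: c_def)
  finally show ?thesis .
qed

lemma integration_by_parts_test_function:
  fixes \<phi> :: "real \<Rightarrow> 'k::{real_normed_field, euclidean_space}"
  assumes u: "\<And>x. (u has_real_derivative u' x) (at x)" "continuous_on UNIV u'" and \<phi>: "test_function \<phi>"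
  shows "(\<integral>x. of_real (u x) * vderiv \<phi> x \<partial>halfline) = - (\<integral>x. of_real (u' x) * \<phi> x \<partial>halfline)"
proof -
  obtain a b where ab: "0 < a" "\<And>x. x \<notin> {a..b} \<Longrightarrow> \<phi> x = 0"
    using \<phi> unfolding test_function_def by blast
  have cu: "continuous_on UNIV u"
    using u(1) by (meson DERIV_continuous continuous_at_imp_continuous_on)
  have c1: "continuous_on UNIV (\<lambda>x. of_real (u x) * vderiv \<phi> x)"
    "continuous_on UNIV (\<lambda>x. of_real (u' x) * \<phi> x)"
    by (intro continuous_intros cu u(2) test_function_continuous test_function_vderiv_test_function \<phi>)+
  have i: "integrable halfline (\<lambda>x. of_real (u x) * vderiv \<phi> x)"
    "integrable halfline (\<lambda>x. of_real (u' x) * \<phi> x)"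
    using ab vderiv_eq_0_outside[of a b \<phi>, OF ab(2)]
    by (auto intro!: integrable_halfline compactly_supported_integrable[of _ a b] c1)
  have "(\<integral>x. of_real (u x) * vderiv \<phi> x + of_real (u' x) * \<phi> x \<partial>halfline) = 0"
    using ab(1)
  proof (rule integral_halfline_deriv_eq_0)
    show "((\<lambda>x. of_real (u x) * \<phi> x) has_vector_derivative
        of_real (u x) * vderiv \<phi> x + of_real (u' x) * \<phi> x) (at x)" for x
      by (intro has_vector_derivative_mult of_real_has_vector_derivative u test_function_vderiv \<phi>)
  qed (use ab c1 in \<open>auto intro!: continuous_intros\<close>)
  then have "(\<integral>x. of_real (u x) * vderiv \<phi> x \<partial>halfline) + (\<integral>x. of_real (u' x) * \<phi> x \<partial>halfline) = 0"
    using i by simp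
  then show ?thesis by (simp add: eq_neg_iff_add_eq_0)
qed

section \<open>The domain of the Dirichlet Laplacian\<close>

abbreviation test_graph :: "('k::{real_normed_field, euclidean_space} l2 \<times> 'k l2) set" where
  "test_graph \<equiv> {(v, v'). \<exists>\<phi>. test_function \<phi> \<and>
    (AE x in halfline. fn_of v x = \<phi> x) \<and> (AE x in halfline. fn_of v' x = vderiv \<phi> x)}"

lemma abs_l2_tendsto_dominated:
  fixes f :: "nat \<Rightarrow> real \<Rightarrow> 'k::{real_normed_field, euclidean_space}" and w :: "real \<Rightarrow> real"
  assumes f: "\<And>n. f n \<in> borel_measurable halfline" and g: "g \<in> borel_measurable halfline"
    and w: "sq_integrable w" and bound: "\<And>n x. 0 < x \<Longrightarrow> norm (f n x) \<le> w x"
    and lim: "\<And>x. 0 < x \<Longrightarrow> (\<lambda>n. f n x) \<longlonglongrightarrow> g x"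
  shows "(\<lambda>n. abs_l2 (f n)) \<longlonglongrightarrow> abs_l2 g"
proof -
  have w0: "0 \<le> w x" if "0 < x" for x
    using bound[OF that, of 0] norm_ge_zero order_trans by blast
  have g_bound: "norm (g x) \<le> w x" if "0 < x" for x
    using bound[OF that] by (intro LIMSEQ_le_const2[OF tendsto_norm[OF lim[OF that]]]) auto
  have AE: "AE x in halfline. P x" if "\<And>x. 0 < x \<Longrightarrow> P x" for P
    using that by (intro AE_I2) simp
  have sf: "sq_integrable (f n)" for n
    by (rule sq_integrable_bound[OF w f AE]) (use order_trans[OF bound abs_ge_self] in auto)
  have sg: "sq_integrable g"
    by (rule sq_integrable_bound[OF w g AE]) (use order_trans[OF g_bound abs_ge_self] in auto)
  have "(\<lambda>n. \<integral>x. (norm (f n x - g x))\<^sup>2 \<partial>halfline) \<longlonglongrightarrow> (\<integral>x. 0 \<partial>halfline)"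
  proof (rule integral_dominated_convergence)
    show "integrable halfline (\<lambda>x. (2 * w x)\<^sup>2)"
      using sq_integrable_mult[OF w, of 2] by (simp add: sq_integrable_def)
    show "AE x in halfline. (\<lambda>n. (norm (f n x - g x))\<^sup>2) \<longlonglongrightarrow> 0"
      using lim by (intro AE) (auto intro!: tendsto_eq_intros)
    show "AE x in halfline. norm ((norm (f n x - g x))\<^sup>2) \<le> (2 * w x)\<^sup>2" for n
    proof (rule AE)
      fix x :: real assume x: "0 < x"
      have "norm (f n x - g x) \<le> 2 * w x"
        using norm_triangle_ineq4[of "f n x" "g x"] bound[OF x, of n] g_bound[OF x] by linarith
      then show "norm ((norm (f n x - g x))\<^sup>2) \<le> (2 * w x)\<^sup>2"
        using power_mono[of "norm (f n x - g x)" "2 * w x" 2] by simp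
    qed
  qed (use f g in auto)
  then have "(\<lambda>n. (norm (abs_l2 (f n) - abs_l2 g))\<^sup>2) \<longlonglongrightarrow> 0"
    using sf sg by (simp add: abs_l2_diff[symmetric] norm_abs_l2 sq_integrable_diff norm2_sq)
  then have "(\<lambda>n. norm (abs_l2 (f n) - abs_l2 g)) \<longlonglongrightarrow> 0"
    using tendsto_real_sqrt by fastforce
  then show ?thesis
    by (simp add: LIM_zero_iff tendsto_norm_zero_iff)
qed

definition emb :: "(real \<Rightarrow> real) \<Rightarrow> 'k::{real_normed_field, euclidean_space} l2" where
  "emb f = abs_l2 (\<lambda>x. of_real (f x))"

lemma sq_integrable_of_real:
  "sq_integrable f \<Longrightarrow> sq_integrable (\<lambda>x. of_real (f x) :: 'k::{real_normed_field, euclidean_space})"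
  by (auto simp: sq_integrable_def)

lemma fn_of_emb:
  "sq_integrable f \<Longrightarrow> AE x in halfline. fn_of (emb f :: 'k::{real_normed_field, euclidean_space} l2) x = of_real (f x)"
  unfolding emb_def by (intro fn_of_abs_l2 sq_integrable_of_real)

lemma fn_of_integral_cong:
  fixes u :: "'k::{real_normed_field, euclidean_space} l2"
  assumes "AE x in halfline. fn_of u x = f x" "f \<in> borel_measurable halfline" "\<phi> \<in> borel_measurable halfline"
  shows "(\<integral>x. fn_of u x * \<phi> x \<partial>halfline) = (\<integral>x. f x * \<phi> x \<partial>halfline)"
  using assms by (intro integral_cong_AE) (auto elim!: eventually_mono)

lemma test_function_measurable [measurable]:
  fixes \<phi> :: "real \<Rightarrow> 'k::{real_normed_field, euclidean_space}"
  shows "test_function \<phi> \<Longrightarrow> \<phi> \<in> borel_measurable halfline"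
  using sq_integrable_test_function[of \<phi>] by (simp add: sq_integrable_def)

lemma smooth_funs_measurable: "f \<in> smooth_funs \<Longrightarrow> f \<in> borel_measurable borel"
  by (intro borel_measurable_continuous_onI smooth_funs_continuous)

text \<open>The smooth cutoffs \<open>bump 0 (n x - 1) * bump 0 (n - x)\<close> tend to 1 pointwise, and their derivatives
  times \<open>u\<close> are dominated by \<open>3 \<bar>u x / x\<bar> + 2 \<bar>u x\<bar>\<close>.\<close>

lemma emb_in_H1_0:
  fixes u u' :: "real \<Rightarrow> real"
  assumes u: "u \<in> smooth_funs" "\<And>x. (u has_real_derivative u' x) (at x)"
    and sq: "sq_integrable u" "sq_integrable u'" "sq_integrable (\<lambda>x. u x / x)"
  shows "(emb u :: 'k::{real_normed_field, euclidean_space} l2) \<in> H1_0"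
proof -
  have u': "u' \<in> smooth_funs" using smooth_funs_deriv_eq[OF u] .
  note meas [measurable] = smooth_funs_measurable[OF u(1)] smooth_funs_measurable[OF u']
  have weak: "weak_deriv (emb u :: 'k l2) (emb u')"
    unfolding weak_deriv_def
  proof (intro allI impI)
    fix \<phi> :: "real \<Rightarrow> 'k" assume \<phi>: "test_function \<phi>"
    have [measurable]: "\<phi> \<in> borel_measurable halfline" "vderiv \<phi> \<in> borel_measurable halfline"
      using \<phi> test_function_vderiv_test_function[OF \<phi>] by measurable
    show "(\<integral>x. fn_of (emb u) x * vderiv \<phi> x \<partial>halfline) = - (\<integral>x. fn_of (emb u') x * \<phi> x \<partial>halfline)"
      using integration_by_parts_test_function[OF u(2) smooth_funs_continuous[OF u'] \<phi>]
      by (simp add: fn_of_integral_cong[OF fn_of_emb] sq)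
  qed
  define \<eta> where "\<eta> n x = bump 0 (real n * x - 1) * bump 0 (real n - x)" for n x
  define \<eta>' where "\<eta>' n x = real n * bump 2 (real n * x - 1) * bump 0 (real n - x)
      - bump 0 (real n * x - 1) * bump 2 (real n - x)" for n x
  have \<eta>_smooth: "\<eta> n \<in> smooth_funs" for n
    unfolding \<eta>_def using smooth_mult[OF smooth_bump[of 0 "real n" "- 1"] smooth_bump[of 0 "- 1" "real n"]] by simp
  have \<eta>_deriv: "(\<eta> n has_real_derivative \<eta>' n x) (at x)" for n x
    unfolding \<eta>_def \<eta>'_def
    by (rule derivative_eq_intros DERIV_chain2[OF bump_deriv] refl)+ (simp add: numeral_2_eq_2 algebra_simps)
  have \<eta>'_smooth: "\<eta>' n \<in> smooth_funs" for n
    using smooth_funs_deriv_eq[OF \<eta>_smooth \<eta>_deriv] .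
  note [measurable] = smooth_funs_measurable[OF \<eta>_smooth] smooth_funs_measurable[OF \<eta>'_smooth]
  define f where "f n x = \<eta> n x * u x" for n x
  define f' where "f' n x = \<eta> n x * u' x + \<eta>' n x * u x" for n x
  have [measurable]: "f n \<in> borel_measurable borel" "f' n \<in> borel_measurable borel" for n
    unfolding f_def f'_def by measurable
  have f_deriv: "(f n has_real_derivative f' n x) (at x)" for n x
    unfolding f_def f'_def by (rule derivative_eq_intros \<eta>_deriv u(2) refl)+ simp
  have f_smooth: "f n \<in> smooth_funs" for n
    unfolding f_def by (intro smooth_mult \<eta>_smooth u)
  have f_zero: "f n x = 0" if "x \<notin> {1 / (real n + 1)..real n}" for n x
  proof -
    have "real n * x \<le> 1" if "x < 1 / (real n + 1)"
    proof -
      have "(real n + 1) * x < 1" using that by (simp add: field_simps)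
      then show ?thesis using mult_nonneg_nonneg[of "real n" "- x"] by (cases "0 \<le> x") (auto simp: algebra_simps)
    qed
    then have "real n * x \<le> 1 \<or> real n \<le> x"
      using that by auto
    then show ?thesis by (auto simp: f_def \<eta>_def bump_def)
  qed
  have f_test: "test_function (\<lambda>x. of_real (f n x) :: 'k)" for n
    by (rule test_function_of_real[OF f_smooth _ f_zero]) auto
  have f_vderiv: "vderiv (\<lambda>x. of_real (f n x) :: 'k) = (\<lambda>x. of_real (f' n x))" for n
    by (intro vderiv_eqI of_real_has_vector_derivative f_deriv)
  have \<eta>_bound: "0 \<le> \<eta> n x" "\<eta> n x \<le> 1" for n x
    using mult_mono[OF bump_le_fact[of 0 "real n * x - 1"] bump_le_fact[of 0 "real n - x"]]
    by (auto simp: \<eta>_def bump_nonneg)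
  have \<eta>'_bound: "\<bar>\<eta>' n x\<bar> \<le> 3 / x + 2" if "0 < x" for n x
  proof -
    have *: "real n * bump 2 (real n * x - 1) \<le> 3 / x"
    proof -
      have "(y + 1) * bump 2 y \<le> 3" for y
      proof -
        have "(y + 1) * bump 2 y = bump 1 y + bump 2 y"
          by (auto simp: bump_def power2_eq_square field_simps)
        then show ?thesis using bump_le_fact[of 1 y] bump_le_fact[of 2 y] by (simp add: numeral_2_eq_2)
      qed
      from this[of "real n * x - 1"] show ?thesis using that by (simp add: field_simps)
    qed
    have "real n * bump 2 (real n * x - 1) * bump 0 (real n - x) \<le> 3 / x * 1"
      using * bump_le_fact[of 0] that by (intro mult_mono) (auto simp: bump_nonneg)
    moreover have "bump 0 (real n * x - 1) * bump 2 (real n - x) \<le> 1 * 2"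
      using bump_le_fact[of 0] bump_le_fact[of 2] by (intro mult_mono) (auto simp: bump_nonneg numeral_2_eq_2)
    moreover have "0 \<le> real n * bump 2 (real n * x - 1) * bump 0 (real n - x)"
      "0 \<le> bump 0 (real n * x - 1) * bump 2 (real n - x)" by (auto simp: bump_nonneg)
    ultimately show ?thesis unfolding \<eta>'_def by linarith
  qed
  have top: "filterlim (\<lambda>n. real n * x - 1) at_top sequentially" "filterlim (\<lambda>n. real n - x) at_top sequentially"
    if "0 < x" for x using that by real_asymp+
  have bump_top: "(bump 0 \<longlongrightarrow> 1) at_top" "((\<lambda>x. x * bump 2 x) \<longlongrightarrow> 0) at_top"
    "(bump 2 \<longlongrightarrow> 0) at_top"
  proof -
    have ev: "\<forall>\<^sub>F x in at_top. (1 / x) ^ k * exp (- (1 / x)) = bump k x" for k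
      using eventually_gt_at_top[of 0] by eventually_elim (simp add: bump_def)
    have 1: "((\<lambda>x::real. (1 / x) ^ 0 * exp (- (1 / x))) \<longlongrightarrow> 1) at_top"
      and 2: "((\<lambda>x::real. (1 / x)\<^sup>2 * exp (- (1 / x))) \<longlongrightarrow> 0) at_top" by real_asymp+
    show "(bump 0 \<longlongrightarrow> 1) at_top" by (rule Lim_transform_eventually[OF 1 ev])
    show "(bump 2 \<longlongrightarrow> 0) at_top" by (rule Lim_transform_eventually[OF 2 ev])
    have "((\<lambda>x::real. x * ((1 / x)\<^sup>2 * exp (- (1 / x)))) \<longlongrightarrow> 0) at_top" by real_asymp
    then show "((\<lambda>x. x * bump 2 x) \<longlongrightarrow> 0) at_top"
      by (rule Lim_transform_eventually) (use ev[of 2] in eventually_elim, simp)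
  qed
  have \<eta>_lim: "(\<lambda>n. \<eta> n x) \<longlonglongrightarrow> 1" if "0 < x" for x
    unfolding \<eta>_def
    using tendsto_mult[OF filterlim_compose[OF bump_top(1) top(1)[OF that]] filterlim_compose[OF bump_top(1) top(2)[OF that]]]
    by simp
  have \<eta>'_lim: "(\<lambda>n. \<eta>' n x) \<longlonglongrightarrow> 0" if "0 < x" for x
  proof -
    let ?y = "\<lambda>n. real n * x - 1"
    have "(\<lambda>n. (?y n * bump 2 (?y n) + bump 2 (?y n)) / x) \<longlonglongrightarrow> (0 + 0) / x"
      using that by (intro tendsto_intros filterlim_compose[OF bump_top(2) top(1)] filterlim_compose[OF bump_top(3) top(1)]) auto
    moreover have "(?y n * bump 2 (?y n) + bump 2 (?y n)) / x = real n * bump 2 (?y n)" for n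
      using that by (simp add: field_simps)
    ultimately have 1: "(\<lambda>n. real n * bump 2 (?y n)) \<longlonglongrightarrow> 0" by simp
    have "(\<lambda>n. real n * bump 2 (?y n) * bump 0 (real n - x) - bump 0 (?y n) * bump 2 (real n - x)) \<longlonglongrightarrow> 0 * 1 - 1 * 0"
      using that by (intro tendsto_intros 1 filterlim_compose[OF bump_top(1) top(1)]
        filterlim_compose[OF bump_top(1) top(2)] filterlim_compose[OF bump_top(3) top(2)])
    then show ?thesis by (simp add: \<eta>'_def)
  qed
  have "(\<lambda>n. emb (f n) :: 'k l2) \<longlonglongrightarrow> emb u"
    unfolding emb_def
  proof (rule abs_l2_tendsto_dominated)
    show "sq_integrable (\<lambda>x. \<bar>u x\<bar>)" using sq(1) by (auto simp: sq_integrable_def)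
    show "norm (of_real (f n x) :: 'k) \<le> \<bar>u x\<bar>" for n x
      using mult_right_mono[OF \<eta>_bound(2)[of n x] abs_ge_zero[of "u x"]] \<eta>_bound(1)[of n x] by (simp add: f_def abs_mult norm_mult)
    show "(\<lambda>n. of_real (f n x)) \<longlonglongrightarrow> (of_real (u x) :: 'k)" if "0 < x" for x
      unfolding f_def using tendsto_mult[OF \<eta>_lim[OF that] tendsto_const[of "u x"]] by (intro tendsto_intros) simp
  qed measurable
  moreover have "(\<lambda>n. emb (f' n) :: 'k l2) \<longlonglongrightarrow> emb u'"
    unfolding emb_def
  proof (rule abs_l2_tendsto_dominated)
    have "sq_integrable (\<lambda>x. \<bar>u' x\<bar> + (3 * \<bar>u x / x\<bar> + 2 * \<bar>u x\<bar>))"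
      using sq by (intro sq_integrable_add sq_integrable_mult) (auto simp: sq_integrable_def)
    then show "sq_integrable (\<lambda>x. \<bar>u' x\<bar> + (3 * \<bar>u x / x\<bar> + 2 * \<bar>u x\<bar>))" .
    show "norm (of_real (f' n x) :: 'k) \<le> \<bar>u' x\<bar> + (3 * \<bar>u x / x\<bar> + 2 * \<bar>u x\<bar>)" if "0 < x" for n x
    proof -
      have "\<bar>f' n x\<bar> \<le> \<eta> n x * \<bar>u' x\<bar> + \<bar>\<eta>' n x\<bar> * \<bar>u x\<bar>"
        unfolding f'_def using abs_triangle_ineq[of "\<eta> n x * u' x" "\<eta>' n x * u x"] \<eta>_bound(1)[of n x]
        by (simp add: abs_mult)
      also have "\<dots> \<le> 1 * \<bar>u' x\<bar> + (3 / x + 2) * \<bar>u x\<bar>"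
        using \<eta>_bound[of n x] \<eta>'_bound[OF that, of n] by (intro add_mono mult_right_mono) auto
      finally show ?thesis using that by (simp add: algebra_simps)
    qed
    show "(\<lambda>n. of_real (f' n x)) \<longlonglongrightarrow> (of_real (u' x) :: 'k)" if "0 < x" for x
      unfolding f'_def
      using tendsto_add[OF tendsto_mult[OF \<eta>_lim[OF that] tendsto_const[of "u' x"]] tendsto_mult[OF \<eta>'_lim[OF that] tendsto_const[of "u x"]]]
      by (intro tendsto_intros) simp
  qed measurable
  ultimately have lim: "(\<lambda>n. (emb (f n) :: 'k l2, emb (f' n) :: 'k l2)) \<longlonglongrightarrow> (emb u, emb u')"
    by (rule tendsto_Pair)
  have sf: "sq_integrable (\<lambda>x. of_real (f n x) :: 'k)" "sq_integrable (\<lambda>x. of_real (f' n x) :: 'k)" for n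
    using sq_integrable_test_function[OF f_test] sq_integrable_test_function[OF test_function_vderiv_test_function[OF f_test]]
    by (simp_all add: f_vderiv)
  show ?thesis
    unfolding H1_0_def
  proof (intro CollectI exI conjI)
    show "weak_deriv (emb u :: 'k l2) (emb u')" by (rule weak)
    show "(emb u :: 'k l2, emb u') \<in> closure test_graph"
      unfolding closure_sequential
    proof (intro exI[of _ "\<lambda>n. (emb (f n), emb (f' n))"] conjI allI)
      show "(\<lambda>n. (emb (f n) :: 'k l2, emb (f' n) :: 'k l2)) \<longlonglongrightarrow> (emb u, emb u')" by (rule lim)
      fix n
      have "AE x in halfline. fn_of (emb (f n) :: 'k l2) x = of_real (f n x)"
        "AE x in halfline. fn_of (emb (f' n) :: 'k l2) x = of_real (f' n x)"
        unfolding emb_def by (intro fn_of_abs_l2 sf)+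
      then show "(emb (f n) :: 'k l2, emb (f' n)) \<in> test_graph"
        unfolding mem_Collect_eq case_prod_conv
        by (intro exI[of _ "\<lambda>x. of_real (f n x)"] conjI f_test) (simp_all add: fun_cong[OF f_vderiv])
    qed
  qed
qed

lemma emb_in_dirichlet_laplacian:
  fixes u u' u'' :: "real \<Rightarrow> real"
  assumes u: "u \<in> smooth_funs" "\<And>x. (u has_real_derivative u' x) (at x)" "\<And>x. (u' has_real_derivative u'' x) (at x)"
    and sq: "sq_integrable u" "sq_integrable u'" "sq_integrable u''" "sq_integrable (\<lambda>x. u x / x)"
  shows "(emb u :: 'k::{real_normed_field, euclidean_space} l2, emb u'') \<in> dirichlet_laplacian"
proof -
  have u': "u' \<in> smooth_funs" using smooth_funs_deriv_eq[OF u(1,2)] .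
  have u'': "u'' \<in> smooth_funs" using smooth_funs_deriv_eq[OF u' u(3)] .
  note [measurable] = smooth_funs_measurable[OF u(1)] smooth_funs_measurable[OF u']  smooth_funs_measurable[OF u'']
  have "distr_laplacian (emb u :: 'k l2) (emb u'')"
    unfolding distr_laplacian_def
  proof (intro allI impI)
    fix \<phi> :: "real \<Rightarrow> 'k" assume \<phi>: "test_function \<phi>"
    note \<phi>' = test_function_vderiv_test_function[OF \<phi>]
    have [measurable]: "\<phi> \<in> borel_measurable halfline" "vderiv \<phi> \<in> borel_measurable halfline"
        "vderiv (vderiv \<phi>) \<in> borel_measurable halfline"
      using \<phi> \<phi>' test_function_vderiv_test_function[OF \<phi>'] by measurable
    show "(\<integral>x. fn_of (emb u) x * vderiv (vderiv \<phi>) x \<partial>halfline) = (\<integral>x. fn_of (emb u'') x * \<phi> x \<partial>halfline)"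
      using integration_by_parts_test_function[OF u(2) smooth_funs_continuous[OF u'] \<phi>']
        integration_by_parts_test_function[OF u(3) smooth_funs_continuous[OF u''] \<phi>]
      by (simp add: fn_of_integral_cong[OF fn_of_emb] sq)
  qed
  then show ?thesis
    using emb_in_H1_0[OF u(1,2) sq(1,2,4)] by (simp add: dirichlet_laplacian_def)
qed

lemma sq_integrable_imp_integrable_mult:
  fixes f g :: "real \<Rightarrow> 'k::{real_normed_field, euclidean_space}"
  assumes "sq_integrable f" "sq_integrable g"
  shows "integrable halfline (\<lambda>x. f x * g x)"
  by (rule Bochner_Integration.integrable_bound[OF sq_integrable_mult_norm[OF assms]])
    (use assms in \<open>auto simp: sq_integrable_def norm_mult\<close>)

lemma dirichlet_laplacian_inner_test_function:
  fixes u w u' :: "'k::{real_normed_field, euclidean_space} l2"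
  assumes "distr_laplacian u w" "weak_deriv u u'" and \<phi>: "test_function \<phi>"
  shows "(\<integral>x. fn_of w x \<bullet> \<phi> x \<partial>halfline) = - (\<integral>x. fn_of u' x \<bullet> vderiv \<phi> x \<partial>halfline)"
proof -
  let ?\<psi> = "\<lambda>b x. of_real (\<phi> x \<bullet> b) :: 'k" and ?\<psi>' = "\<lambda>b x. of_real (vderiv \<phi> x \<bullet> b) :: 'k"
  have \<psi>: "test_function (?\<psi> b)" "vderiv (?\<psi> b) = ?\<psi>' b" for b
    using test_function_inner[OF \<phi>] by auto
  have \<psi>': "test_function (?\<psi>' b)" for b
    using test_function_vderiv_test_function[OF \<psi>(1)] by (simp add: \<psi>(2))
  have expand: "(\<integral>x. fn_of v x \<bullet> g x \<partial>halfline) =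
      (\<Sum>b\<in>Basis. (\<integral>x. fn_of v x * of_real (g x \<bullet> b) \<partial>halfline) \<bullet> b)"
    if "\<And>b. sq_integrable (\<lambda>x. of_real (g x \<bullet> b) :: 'k)" for v :: "'k l2" and g
  proof -
    have int: "integrable halfline (\<lambda>x. fn_of v x * of_real (g x \<bullet> b))" for b
      using that by (intro sq_integrable_imp_integrable_mult) auto
    have "fn_of v x \<bullet> g x = (\<Sum>b\<in>Basis. (fn_of v x * of_real (g x \<bullet> b)) \<bullet> b)" for x
      by (subst euclidean_inner) (simp add: of_real_def mult.commute)
    then have "(\<integral>x. fn_of v x \<bullet> g x \<partial>halfline) =
        (\<Sum>b\<in>Basis. \<integral>x. (fn_of v x * of_real (g x \<bullet> b)) \<bullet> b \<partial>halfline)"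
      using int by (simp add: Bochner_Integration.integral_sum)
    also have "\<dots> = (\<Sum>b\<in>Basis. (\<integral>x. fn_of v x * of_real (g x \<bullet> b) \<partial>halfline) \<bullet> b)"
      using int by (intro sum.cong refl integral_inner_left) auto
    finally show ?thesis .
  qed
  have "(\<integral>x. fn_of w x * ?\<psi> b x \<partial>halfline) = - (\<integral>x. fn_of u' x * ?\<psi>' b x \<partial>halfline)" for b
    using assms(1)[unfolded distr_laplacian_def, rule_format, OF \<psi>(1)[of b]]
      assms(2)[unfolded weak_deriv_def, rule_format, OF \<psi>'[of b]]
    by (simp add: \<psi>(2))
  then show ?thesis
    using expand[of \<phi> w, OF sq_integrable_test_function[OF \<psi>(1)]]
      expand[of "vderiv \<phi>" u', OF sq_integrable_test_function[OF \<psi>']]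
    by (simp add: sum_negf)
qed

lemma dirichlet_laplacian_inner:
  fixes u w :: "'k::{real_normed_field, euclidean_space} l2"
  assumes "distr_laplacian u w" "weak_deriv u u'"
    and v: "(v, v') \<in> closure test_graph"
  shows "w \<bullet> v = - (u' \<bullet> v')"
proof -
  let ?S = "{p. w \<bullet> fst p + u' \<bullet> snd p = 0}"
  have "closed ?S"
    by (intro closed_Collect_eq continuous_intros)
  moreover have "test_graph \<subseteq> ?S"
  proof clarsimp
    fix v v' :: "'k l2" and \<phi> :: "real \<Rightarrow> 'k"
    assume \<phi>: "test_function \<phi>" "AE x in halfline. fn_of v x = \<phi> x" "AE x in halfline. fn_of v' x = vderiv \<phi> x"
    note sq = sq_integrable_test_function[OF \<phi>(1)]
      sq_integrable_test_function[OF test_function_vderiv_test_function[OF \<phi>(1)]]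
    have "v = abs_l2 \<phi>" "v' = abs_l2 (vderiv \<phi>)"
      using abs_l2_eqI[OF sq(1) \<phi>(2)] abs_l2_eqI[OF sq(2) \<phi>(3)] by auto
    then show "w \<bullet> v + u' \<bullet> v' = 0"
      using dirichlet_laplacian_inner_test_function[OF assms(1,2) \<phi>(1)]
      by (simp add: inner_abs_l2_right sq)
  qed
  ultimately have "(v, v') \<in> ?S"
    using closure_minimal v by blast
  then show ?thesis by simp
qed

lemma dirichlet_laplacian_symmetric:
  fixes u w :: "'k::{real_normed_field, euclidean_space} l2"
  assumes "(u, u2) \<in> dirichlet_laplacian" "(v, v2) \<in> dirichlet_laplacian"
  shows "u2 \<bullet> v = u \<bullet> v2"
proof -
  from assms obtain u1 v1 where *: "distr_laplacian u u2" "distr_laplacian v v2" "weak_deriv u u1" "weak_deriv v v1"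
    "(u, u1) \<in> closure test_graph"
    "(v, v1) \<in> closure test_graph"
    unfolding dirichlet_laplacian_def H1_0_def by blast
  show ?thesis
    using dirichlet_laplacian_inner[OF *(1,3,6)] dirichlet_laplacian_inner[OF *(2,4,5)]
    by (simp add: inner_commute)
qed

section \<open>The heat kernel\<close>

definition gauss :: "real \<Rightarrow> real \<Rightarrow> real \<Rightarrow> real" where
  "gauss s a x = exp (- ((x - a)\<^sup>2 / (4 * s))) / sqrt (4 * pi * s)"

lemma gauss_pos: "0 < s \<Longrightarrow> 0 < gauss s a x"
  by (simp add: gauss_def)

lemma gauss_eq_normal_density: "0 < s \<Longrightarrow> gauss s a x = normal_density a (sqrt (2 * s)) x"
  by (simp add: gauss_def normal_density_def)

definition gauss_t :: "real \<Rightarrow> real \<Rightarrow> real \<Rightarrow> real" where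
  "gauss_t s a x = ((x - a)\<^sup>2 / (4 * s\<^sup>2) - 1 / (2 * s)) * gauss s a x"

lemma gauss_smooth: "gauss s a \<in> smooth_funs"
proof -
  have "gauss s a = (\<lambda>x. exp (- (1 / (4 * s) * (x - a)\<^sup>2)) * (1 / sqrt (4 * pi * s)))"
    by (auto simp: gauss_def fun_eq_iff)
  then show ?thesis by (simp only:) (intro smooth_funs.intros)
qed

lemma gauss_deriv_x:
  assumes "0 < s"
  shows "(gauss s a has_real_derivative - (x - a) / (2 * s) * gauss s a x) (at x)"
proof -
  have 1: "((\<lambda>x. exp (- ((x - a)\<^sup>2 / (4 * s)))) has_real_derivative
      exp (- ((x - a)\<^sup>2 / (4 * s))) * (- (2 * (x - a) / (4 * s)))) (at x)"
    using assms by (auto intro!: derivative_eq_intros simp: field_simps)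
  have 2: "E * (- (2 * (x - a) / (4 * s))) / r = - (x - a) / (2 * s) * (E / r)" for E r :: real
  proof -
    have "- (2 * (x - a) / (4 * s)) = - (x - a) / (2 * s)" using assms by (simp add: field_simps)
    then show ?thesis by simp
  qed
  have "(gauss s a has_real_derivative
      exp (- ((x - a)\<^sup>2 / (4 * s))) * (- (2 * (x - a) / (4 * s))) / sqrt (4 * pi * s)) (at x)"
    unfolding gauss_def[abs_def] by (rule DERIV_cdivide[OF 1])
  then show ?thesis unfolding 2 gauss_def .
qed

lemma gauss_deriv_xx:
  assumes "0 < s"
  shows "((\<lambda>x. - (x - a) / (2 * s) * gauss s a x) has_real_derivative gauss_t s a x) (at x)"
  using assms
  by (auto intro!: derivative_eq_intros gauss_deriv_x simp: gauss_t_def field_simps power2_eq_square)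

lemma gauss_deriv_t:
  assumes s: "0 < s"
  shows "((\<lambda>s. gauss s a x) has_real_derivative gauss_t s a x) (at s within S)"
proof -
  let ?r = "sqrt (4 * pi * s)"
  have "4 * pi * s > 0" using s by simp
  then have r: "?r > 0" "?r * ?r = 4 * pi * s"
    by (simp, metis abs_of_pos real_sqrt_mult_self)
  have 1: "((\<lambda>s. exp (- ((x - a)\<^sup>2 / (4 * s)))) has_real_derivative
      exp (- ((x - a)\<^sup>2 / (4 * s))) * ((x - a)\<^sup>2 / (4 * s\<^sup>2))) (at s within S)"
    using s by (auto intro!: derivative_eq_intros simp: field_simps power2_eq_square)
  have 2: "((\<lambda>s. sqrt (4 * pi * s)) has_real_derivative (4 * pi) / (2 * ?r)) (at s within S)"
  proof -
    have lin: "((\<lambda>s. 4 * pi * s) has_real_derivative 4 * pi) (at s within S)"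
      by (rule DERIV_cmult_Id)
    have eq: "inverse r / 2 * (4 * pi) = (4 * pi) / (2 * r)" for r :: real
      by (cases "r = 0") (simp_all add: field_simps)
    show ?thesis
      unfolding eq[symmetric] by (rule DERIV_chain2[OF DERIV_real_sqrt[OF \<open>4 * pi * s > 0\<close>] lin])
  qed
  have e: "(4 * pi) / (2 * ?r) = ?r / (2 * s)"
  proof (rule frac_eq_eq[THEN iffD2])
    show "4 * pi * (2 * s) = ?r * (2 * ?r)" using r(2) by linarith
  qed (use r(1) s in auto)
  have alg: "(E * A * r - E * (r / (2 * s))) / (r * r) = (A - 1 / (2 * s)) * (E / r)"
    if "r > 0" for E A r :: real
    using that s by (simp add: field_simps)
  show ?thesis
    unfolding gauss_def[abs_def] gauss_t_def
    by (rule DERIV_cong[OF DERIV_divide[OF 1 2[unfolded e]] alg[OF r(1)]]) (use r(1) s in simp)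
qed

text \<open>Half of the Gaussian exponent is given up to absorb polynomial factors.\<close>

lemma poly_gauss_bound:
  assumes "0 \<le> A" "0 \<le> B" "0 < \<sigma>" "\<sigma> \<le> s" "s \<le> \<tau>"
  shows "(A + B * (x - a)\<^sup>2) * gauss s a x
    \<le> (A + B * (8 * \<tau>)) / sqrt (4 * pi * \<sigma>) * exp (- (1 / (8 * \<tau>) * (x - a)\<^sup>2))"
proof -
  define z where "z = (x - a)\<^sup>2 / (8 * \<tau>)"
  have \<tau>: "0 < \<tau>" "0 < s" using assms by auto
  have z: "0 \<le> z" "(x - a)\<^sup>2 = 8 * \<tau> * z" using \<tau> by (auto simp: z_def)
  have "(x - a)\<^sup>2 / (4 * \<tau>) \<le> (x - a)\<^sup>2 / (4 * s)"
    using assms \<tau> by (intro divide_left_mono) auto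
  moreover have "(x - a)\<^sup>2 / (4 * \<tau>) = 2 * z" by (simp add: z_def)
  ultimately have "exp (- ((x - a)\<^sup>2 / (4 * s))) \<le> exp (- (2 * z))" by simp
  then have 1: "gauss s a x \<le> exp (- (2 * z)) / sqrt (4 * pi * \<sigma>)"
    unfolding gauss_def using assms by (intro frac_le) auto
  have "A + B * (x - a)\<^sup>2 \<le> (A + B * (8 * \<tau>)) * exp z"
  proof -
    have "A * 1 \<le> A * exp z" using assms z by (intro mult_left_mono) auto
    moreover have "z \<le> exp z" using exp_ge_add_one_self[of z] by linarith
    then have "B * (8 * \<tau>) * z \<le> B * (8 * \<tau>) * exp z"
      using assms \<tau> by (intro mult_left_mono) auto
    ultimately show ?thesis by (simp add: z(2) algebra_simps)
  qed
  then have "(A + B * (x - a)\<^sup>2) * gauss s a x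
      \<le> ((A + B * (8 * \<tau>)) * exp z) * (exp (- (2 * z)) / sqrt (4 * pi * \<sigma>))"
    using 1 assms gauss_pos[of s] \<tau> by (intro mult_mono) (auto intro: less_imp_le)
  also have "exp z * exp (- (2 * z)) = exp (- z)" by (simp flip: exp_add)
  then have "((A + B * (8 * \<tau>)) * exp z) * (exp (- (2 * z)) / sqrt (4 * pi * \<sigma>)) =
      (A + B * (8 * \<tau>)) / sqrt (4 * pi * \<sigma>) * exp (- z)"
    by (metis (no_types, opaque_lifting) mult.assoc times_divide_eq_left times_divide_eq_right)
  finally show ?thesis by (simp add: z_def)
qed

text \<open>The kernel of the semigroup of the Dirichlet Laplacian, obtained by reflection.\<close>

definition heat :: "real \<Rightarrow> real \<Rightarrow> real \<Rightarrow> real" where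
  "heat s a x = gauss s a x - gauss s (- a) x"

definition heat_t :: "real \<Rightarrow> real \<Rightarrow> real \<Rightarrow> real" where
  "heat_t s a x = gauss_t s a x - gauss_t s (- a) x"

lemma heat_deriv_t: "0 < s \<Longrightarrow> ((\<lambda>s. heat s a x) has_real_derivative heat_t s a x) (at s within S)"
  unfolding heat_def[abs_def] heat_t_def by (intro DERIV_diff gauss_deriv_t)

lemma abs_gauss_t_le:
  assumes "0 < \<sigma>" "\<sigma> \<le> s" "s \<le> \<tau>"
  shows "\<bar>gauss_t s a x\<bar> \<le> (1 / (2 * \<sigma>) + 1 / (4 * \<sigma>\<^sup>2) * (8 * \<tau>)) / sqrt (4 * pi * \<sigma>) * exp (- (1 / (8 * \<tau>) * (x - a)\<^sup>2))"
proof -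
  have "\<bar>(x - a)\<^sup>2 / (4 * s\<^sup>2) - 1 / (2 * s)\<bar> \<le> 1 / (2 * s) + (x - a)\<^sup>2 / (4 * s\<^sup>2)"
    using assms by (auto simp: abs_le_iff)
  also have "\<dots> \<le> 1 / (2 * \<sigma>) + (x - a)\<^sup>2 / (4 * \<sigma>\<^sup>2)"
    using assms by (intro add_mono divide_left_mono mult_left_mono power_mono) auto
  finally have "\<bar>gauss_t s a x\<bar> \<le> (1 / (2 * \<sigma>) + 1 / (4 * \<sigma>\<^sup>2) * (x - a)\<^sup>2) * gauss s a x"
    unfolding gauss_t_def abs_mult using gauss_pos[of s a x] assms by (auto intro!: mult_right_mono)
  also have "\<dots> \<le> (1 / (2 * \<sigma>) + 1 / (4 * \<sigma>\<^sup>2) * (8 * \<tau>)) / sqrt (4 * pi * \<sigma>) * exp (- (1 / (8 * \<tau>) * (x - a)\<^sup>2))"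
    using assms by (intro poly_gauss_bound) auto
  finally show ?thesis .
qed

lemma heat_t_dominated:
  assumes "0 < \<sigma>" "\<sigma> \<le> \<tau>"
  obtains w where "sq_integrable w" "\<And>s x. \<sigma> \<le> s \<Longrightarrow> s \<le> \<tau> \<Longrightarrow> \<bar>heat_t s a x\<bar> \<le> w x"
proof (rule that)
  let ?C = "(1 / (2 * \<sigma>) + 1 / (4 * \<sigma>\<^sup>2) * (8 * \<tau>)) / sqrt (4 * pi * \<sigma>)"
  let ?w = "\<lambda>x. ?C * exp (- (1 / (8 * \<tau>) * (x - a)\<^sup>2)) + ?C * exp (- (1 / (8 * \<tau>) * (x - - a)\<^sup>2))"
  show "sq_integrable ?w"
    using assms by (intro sq_integrable_add sq_integrable_mult sq_integrable_exp_square) auto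
  show "\<bar>heat_t s a x\<bar> \<le> ?w x" if "\<sigma> \<le> s" "s \<le> \<tau>" for s x
    unfolding heat_t_def
    by (rule order_trans[OF abs_triangle_ineq4 add_mono[OF abs_gauss_t_le abs_gauss_t_le]]) (use assms that in auto)
qed

lemma sq_integrable_gauss_poly:
  assumes "0 < s" "f \<in> borel_measurable borel" "0 \<le> A" "0 \<le> B"
    "\<And>x. \<bar>f x\<bar> \<le> (A + B * (x - a)\<^sup>2) * gauss s a x"
  shows "sq_integrable f"
proof (rule sq_integrable_bound)
  let ?w = "\<lambda>x. (A + B * (8 * s)) / sqrt (4 * pi * s) * exp (- (1 / (8 * s) * (x - a)\<^sup>2))"
  show "sq_integrable ?w"
    using assms by (intro sq_integrable_mult sq_integrable_exp_square) auto
  have "\<bar>f x\<bar> \<le> ?w x" for x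
    by (rule order_trans[OF assms(5) poly_gauss_bound]) (use assms in auto)
  then show "AE x in halfline. norm (f x) \<le> norm (?w x)"
    by (intro AE_I2) (metis abs_ge_self order_trans real_norm_def)
qed (use assms in \<open>simp add: borel_measurable_halfline\<close>)

lemma gauss_measurable [measurable]: "gauss s a \<in> borel_measurable borel"
  by (rule smooth_funs_measurable[OF gauss_smooth])

lemma sq_integrable_gauss_kernel: "0 < s \<Longrightarrow> sq_integrable (gauss s a)"
  by (rule sq_integrable_gauss_poly[of s _ 1 0 a]) (auto intro: less_imp_le[OF gauss_pos] abs_of_pos[OF gauss_pos, THEN eq_refl])

lemma sq_integrable_heat: "0 < s \<Longrightarrow> sq_integrable (heat s a)"
  unfolding heat_def[abs_def] by (intro sq_integrable_diff sq_integrable_gauss_kernel)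

lemma emb_heat_in_dirichlet_laplacian:
  assumes s: "0 < s"
  shows "(emb (heat s a) :: 'k::{real_normed_field, euclidean_space} l2, emb (heat_t s a)) \<in> dirichlet_laplacian"
proof (rule emb_in_dirichlet_laplacian)
  let ?g' = "\<lambda>a x. - (x - a) / (2 * s) * gauss s a x"
  let ?h' = "\<lambda>x. ?g' a x - ?g' (- a) x"
  show "heat s a \<in> smooth_funs"
    unfolding heat_def[abs_def] by (intro smooth_diff gauss_smooth)
  show deriv: "(heat s a has_real_derivative ?h' x) (at x)" for x
    unfolding heat_def[abs_def] by (intro DERIV_diff gauss_deriv_x s)
  show "(?h' has_real_derivative heat_t s a x) (at x)" for x
    unfolding heat_t_def by (intro DERIV_diff gauss_deriv_xx s)
  show sq: "sq_integrable (heat s a)" by (rule sq_integrable_heat[OF s])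
  have g': "\<bar>?g' a x\<bar> \<le> (1 / (2 * s) + 1 / (2 * s) * (x - a)\<^sup>2) * gauss s a x" for a x
  proof -
    have "\<bar>x - a\<bar> \<le> 1 + (x - a)\<^sup>2"
    proof -
      have "y \<le> 1 + y\<^sup>2" for y :: real
        using zero_le_power2[of "y - 1 / 2"] by (simp add: power2_diff power_divide)
      from this[of "\<bar>x - a\<bar>"] show ?thesis by simp
    qed
    then have "\<bar>- (x - a) / (2 * s)\<bar> \<le> 1 / (2 * s) + 1 / (2 * s) * (x - a)\<^sup>2"
      using s by (simp add: field_simps)
    from mult_right_mono[OF this less_imp_le[OF gauss_pos[OF s]]] show ?thesis
      by (subst abs_mult) (simp only: abs_of_pos[OF gauss_pos[OF s]])
  qed
  show "sq_integrable ?h'"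
    using s by (intro sq_integrable_diff sq_integrable_gauss_poly[OF s _ _ _ g']) auto
  show "sq_integrable (heat_t s a)"
  proof -
    have "sq_integrable (gauss_t s a)" for a
    proof (rule sq_integrable_gauss_poly[OF s, of _ "1 / (2 * s)" "1 / (4 * s\<^sup>2)" a])
      show "gauss_t s a \<in> borel_measurable borel" unfolding gauss_t_def[abs_def] by measurable
      have "\<bar>(x - a)\<^sup>2 / (4 * s\<^sup>2) - 1 / (2 * s)\<bar> \<le> 1 / (2 * s) + 1 / (4 * s\<^sup>2) * (x - a)\<^sup>2" for x
        using s by (auto simp: abs_le_iff)
      then show "\<bar>gauss_t s a x\<bar> \<le> (1 / (2 * s) + 1 / (4 * s\<^sup>2) * (x - a)\<^sup>2) * gauss s a x" for x
        unfolding gauss_t_def using gauss_pos[OF s, of a x] by (simp only: abs_mult abs_of_pos) (auto intro: mult_right_mono)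
    qed (use s in auto)
    then show ?thesis unfolding heat_t_def[abs_def] by (intro sq_integrable_diff)
  qed
  show "sq_integrable (\<lambda>x. heat s a x / x)"
  proof -
    define C where "C = (1 / (2 * s) + 1 / (2 * s) * (8 * s)) / sqrt (4 * pi * s)"
    have C: "0 \<le> C" using s by (simp add: C_def)
    have g'_C: "\<bar>?g' a x\<bar> \<le> C" for a x
    proof -
      have "\<bar>?g' a x\<bar> \<le> C * exp (- (1 / (8 * s) * (x - a)\<^sup>2))"
        unfolding C_def by (rule order_trans[OF g' poly_gauss_bound]) (use s in auto)
      also have "\<dots> \<le> C * 1" using C s by (intro mult_left_mono) auto
      finally show ?thesis by simp
    qed
    have "\<bar>?h' x\<bar> \<le> 2 * C" for x
      using g'_C[of x a] g'_C[of x "- a"] by linarith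
    then have "\<bar>heat s a x - heat s a 0\<bar> \<le> 2 * C * \<bar>x - 0\<bar>" for x
      using field_differentiable_bound[of UNIV "heat s a" ?h' "2 * C" x 0] deriv by auto
    then have lip: "\<bar>heat s a x\<bar> \<le> 2 * C * \<bar>x\<bar>" for x
      by (simp add: heat_def gauss_def)
    let ?w = "\<lambda>x. (2 * C * exp 1) * exp (- (1 * (x - 0)\<^sup>2)) + \<bar>heat s a x\<bar>"
    show ?thesis
    proof (rule sq_integrable_bound)
      have "sq_integrable (\<lambda>x. \<bar>heat s a x\<bar>)" using sq by (auto simp: sq_integrable_def)
      then show "sq_integrable ?w"
        by (intro sq_integrable_add sq_integrable_mult sq_integrable_exp_square) auto
      show "(\<lambda>x. heat s a x / x) \<in> borel_measurable halfline"
        by (rule borel_measurable_halfline) (simp add: heat_def)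
      have "\<bar>heat s a x / x\<bar> \<le> ?w x" if x: "0 < x" for x
      proof (cases "x \<le> 1")
        case True
        have "\<bar>heat s a x / x\<bar> \<le> 2 * C" using lip[of x] x by (simp add: field_simps)
        also have "\<dots> = (2 * C * exp 1) * exp (- 1)" by (simp flip: exp_add)
        also have "\<dots> \<le> (2 * C * exp 1) * exp (- (1 * (x - 0)\<^sup>2))"
          using True x C by (intro mult_left_mono) (auto simp: power_le_one)
        finally show ?thesis by linarith
      next
        case False
        then have "\<bar>heat s a x / x\<bar> \<le> \<bar>heat s a x\<bar> / 1"
          unfolding abs_divide by (intro frac_le) auto
        moreover have "0 \<le> (2 * C * exp 1) * exp (- (1 * (x - 0)\<^sup>2))" using C by simp
        ultimately show ?thesis by linarith
      qed
      then show "AE x in halfline. norm (heat s a x / x) \<le> norm (?w x)"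
        by (intro AE_I2) (auto intro: order_trans[OF _ abs_ge_self])
    qed
  qed
qed

lemma emb_diff:
  assumes "sq_integrable f" "sq_integrable g"
  shows "(emb (\<lambda>x. f x - g x) :: 'k::{real_normed_field, euclidean_space} l2) = emb f - emb g"
  unfolding emb_def using abs_l2_diff[OF sq_integrable_of_real[OF assms(1)] sq_integrable_of_real[OF assms(2)]]
  by simp

lemma emb_scaleR:
  assumes "sq_integrable f"
  shows "(emb (\<lambda>x. r * f x) :: 'k::{real_normed_field, euclidean_space} l2) = r *\<^sub>R emb f"
  unfolding emb_def using abs_l2_scaleR[OF sq_integrable_of_real[OF assms], of r]
  by (simp add: scaleR_conv_of_real)

lemma emb_heat_deriv:
  assumes \<sigma>: "0 < \<sigma>" and s: "s \<in> {0..t}"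
  shows "((\<lambda>s. emb (heat (\<sigma> + s) a) :: 'k::{real_normed_field, euclidean_space} l2)
    has_vector_derivative emb (heat_t (\<sigma> + s) a)) (at s within {0..t})"
  unfolding has_vector_derivative_within_quotient tendsto_at_iff_sequentially
proof (intro allI impI)
  fix X assume X: "\<forall>i. X i \<in> {0..t} - {s}" "X \<longlonglongrightarrow> s"
  obtain w where w: "sq_integrable w" "\<And>r x. \<sigma> \<le> r \<Longrightarrow> r \<le> \<sigma> + t \<Longrightarrow> \<bar>heat_t r a x\<bar> \<le> w x"
    using heat_t_dominated[OF \<sigma>, of "\<sigma> + t" a] s by auto
  let ?f = "\<lambda>i x. inverse (X i - s) * (heat (\<sigma> + X i) a x - heat (\<sigma> + s) a x)"
  have sq: "sq_integrable (heat (\<sigma> + r) a)" if "r \<in> {0..t}" for r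
    using that \<sigma> by (intro sq_integrable_heat) auto
  have "emb (?f i) = ((emb (heat (\<sigma> + X i) a) - emb (heat (\<sigma> + s) a)) /\<^sub>R (X i - s) :: 'k l2)" for i
  proof -
    have X_i: "X i \<in> {0..t}" using X(1) by auto
    show ?thesis
      by (subst emb_scaleR[OF sq_integrable_diff[OF sq[OF X_i] sq[OF s]]],
          subst emb_diff[OF sq[OF X_i] sq[OF s]]) simp
  qed
  moreover have "(\<lambda>i. emb (?f i) :: 'k l2) \<longlonglongrightarrow> emb (heat_t (\<sigma> + s) a)"
    unfolding emb_def
  proof (rule abs_l2_tendsto_dominated[OF _ _ w(1)])
    have [measurable]: "heat r a \<in> borel_measurable borel" "heat_t r a \<in> borel_measurable borel" for r
      unfolding heat_def[abs_def] heat_t_def[abs_def] gauss_t_def[abs_def] by measurable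
    show "(\<lambda>x. of_real (?f i x) :: 'k) \<in> borel_measurable halfline" for i
      by (rule borel_measurable_halfline) measurable
    show "(\<lambda>x. of_real (heat_t (\<sigma> + s) a x) :: 'k) \<in> borel_measurable halfline"
      by (rule borel_measurable_halfline) measurable
    fix x :: real assume "0 < x"
    have deriv: "((\<lambda>s. heat (\<sigma> + s) a x) has_real_derivative heat_t (\<sigma> + r) a x) (at r within {0..t})"
      if "r \<in> {0..t}" for r
    proof -
      have "((\<lambda>s. heat s a x) has_real_derivative heat_t (\<sigma> + r) a x) (at (\<sigma> + r))"
        using that \<sigma> by (intro heat_deriv_t) auto
      moreover have "((\<lambda>s. \<sigma> + s) has_real_derivative 1) (at r within {0..t})"
        by (auto intro!: derivative_eq_intros)
      ultimately show ?thesis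
        using DERIV_chain2[of "\<lambda>s. heat s a x" "heat_t (\<sigma> + r) a x" "\<lambda>s. \<sigma> + s" r 1 "{0..t}"] by simp
    qed
    show "norm (of_real (?f i x) :: 'k) \<le> w x" for i
    proof -
      have "norm (heat (\<sigma> + X i) a x - heat (\<sigma> + s) a x) \<le> w x * norm (X i - s)"
        using deriv w(2) X(1) s
        by (intro field_differentiable_bound[of "{0..t}" "\<lambda>s. heat (\<sigma> + s) a x" "\<lambda>s. heat_t (\<sigma> + s) a x"]) auto
      moreover have "X i \<noteq> s" using X(1) by auto
      ultimately show ?thesis unfolding norm_of_real by (simp add: abs_mult field_simps)
    qed
    have "((\<lambda>y. (heat (\<sigma> + y) a x - heat (\<sigma> + s) a x) / (y - s)) \<longlongrightarrow> heat_t (\<sigma> + s) a x) (at s within {0..t})"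
      using deriv[OF s] by (simp add: has_field_derivative_iff)
    then have "(\<lambda>i. ?f i x) \<longlonglongrightarrow> heat_t (\<sigma> + s) a x"
      using X unfolding tendsto_at_iff_sequentially by (auto simp: o_def divide_inverse mult.commute)
    then show "(\<lambda>i. of_real (?f i x) :: 'k) \<longlonglongrightarrow> of_real (heat_t (\<sigma> + s) a x)"
      by (rule tendsto_of_real)
  qed
  ultimately show "((\<lambda>y. (emb (heat (\<sigma> + y) a) - emb (heat (\<sigma> + s) a)) /\<^sub>R (y - s)) \<circ> X)
      \<longlonglongrightarrow> (emb (heat_t (\<sigma> + s) a) :: 'k l2)"
    by (simp add: o_def)
qed

section \<open>Positivity of the Dirichlet heat semigroup\<close>

lemma sigma_finite_halfline: "sigma_finite_measure halfline"
proof (rule sigma_finite_measure_restrict_space)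
  show "sigma_finite_measure (lebesgue :: real measure)"
  proof
    let ?A = "range (\<lambda>n::nat. cbox (- real n) (real n))"
    have "\<exists>n::nat. x \<in> cbox (- real n) (real n)" for x :: real
      using real_arch_simple[of "\<bar>x\<bar>"] by (auto simp: abs_le_iff) (metis minus_le_iff)
    then have "\<Union>?A = space lebesgue" by auto
    moreover have "\<forall>a\<in>?A. emeasure lebesgue a \<noteq> \<infinity>"
      using fmeasurableD2[OF lmeasurable_cbox] by auto
    moreover have "countable ?A" "?A \<subseteq> sets lebesgue" by auto
    ultimately show "\<exists>A::real set set. countable A \<and> A \<subseteq> sets lebesgue \<and> \<Union>A = space lebesgue \<and>
        (\<forall>a\<in>A. emeasure lebesgue a \<noteq> \<infinity>)"
      by blast
  qed
qed auto

interpretation halfline: sigma_finite_measure halfline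
  by (rule sigma_finite_halfline)

interpretation lborel_halfline: pair_sigma_finite lborel halfline ..

lemma borel_measurable_ident_halfline: "(\<lambda>x. x) \<in> borel_measurable halfline"
  by (rule borel_measurable_halfline) simp

lemma borel_measurable_fst_halfline [measurable]: "fst \<in> borel_measurable (lborel \<Otimes>\<^sub>M halfline)"
  by (rule measurable_compose[OF measurable_fst]) simp

lemma borel_measurable_snd_halfline [measurable]: "snd \<in> borel_measurable (lborel \<Otimes>\<^sub>M halfline)"
  by (rule measurable_compose[OF measurable_snd borel_measurable_ident_halfline])

lemma gauss_commute: "gauss s a x = gauss s x a"
  by (simp add: gauss_def power2_commute)

lemma gauss_integral:
  assumes "0 < s"
  shows "integrable lborel (gauss s a)" "(\<integral>x. gauss s a x \<partial>lborel) = 1"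
    "integrable lborel (\<lambda>x. (x - a)\<^sup>2 * gauss s a x)" "(\<integral>x. (x - a)\<^sup>2 * gauss s a x \<partial>lborel) = 2 * s"
proof -
  have eq: "gauss s a = normal_density a (sqrt (2 * s))"
    using assms by (simp add: fun_eq_iff gauss_eq_normal_density)
  have \<sigma>: "0 < sqrt (2 * s)" using assms by simp
  show "integrable lborel (gauss s a)" "(\<integral>x. gauss s a x \<partial>lborel) = 1"
    unfolding eq by (rule integrable_normal_density[OF \<sigma>], rule integral_normal_density[OF \<sigma>])
  show "integrable lborel (\<lambda>x. (x - a)\<^sup>2 * gauss s a x)" "(\<integral>x. (x - a)\<^sup>2 * gauss s a x \<partial>lborel) = 2 * s"
    using integrable_normal_moment[OF \<sigma>, of a 2] integral_normal_moment_even[OF \<sigma>, of a 1] assms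
    by (simp_all add: eq mult.commute)
qed

abbreviation gauss_mass :: "real set \<Rightarrow> real \<Rightarrow> real \<Rightarrow> real" where
  "gauss_mass A s y \<equiv> (\<integral>a. indicator A a * gauss s y a \<partial>lborel)"

lemma gauss_tail:
  assumes s: "0 < s" and S: "S \<in> sets borel" and \<delta>: "0 < \<delta>" "\<And>a. a \<in> S \<Longrightarrow> \<delta> \<le> \<bar>a - y\<bar>"
  shows "gauss_mass S s y \<le> 2 * s / \<delta>\<^sup>2"
proof -
  have "gauss_mass S s y \<le> (\<integral>a. (a - y)\<^sup>2 * gauss s y a / \<delta>\<^sup>2 \<partial>lborel)"
  proof (rule integral_mono)
    show "integrable lborel (\<lambda>a. indicator S a * gauss s y a)"
      using integrable_mult_indicator[OF _ gauss_integral(1)[OF s], of S y] S by simp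
    show "indicator S a * gauss s y a \<le> (a - y)\<^sup>2 * gauss s y a / \<delta>\<^sup>2" for a
    proof (cases "a \<in> S")
      case True
      have "\<delta>\<^sup>2 \<le> (a - y)\<^sup>2" using power_mono[OF \<delta>(2)[OF True], of 2] \<delta>(1) by simp
      then have "\<delta>\<^sup>2 * gauss s y a \<le> (a - y)\<^sup>2 * gauss s y a"
        using gauss_pos[OF s] by (intro mult_right_mono) (auto intro: less_imp_le)
      then show ?thesis using True \<delta>(1) by (simp add: field_simps)
    next
      case False
      have "0 \<le> (a - y)\<^sup>2 * gauss s y a / \<delta>\<^sup>2"
        by (intro divide_nonneg_nonneg mult_nonneg_nonneg less_imp_le[OF gauss_pos] s) auto
      then show ?thesis using False by simp
    qed
  qed (use gauss_integral[OF s] in auto)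
  also have "\<dots> = 2 * s / \<delta>\<^sup>2" using gauss_integral[OF s] by simp
  finally show ?thesis .
qed

lemma gauss_decay:
  assumes "0 < s" "s \<le> 1" "\<bar>a\<bar> \<le> c"
  shows "gauss s a x \<le> sqrt 2 * exp (c\<^sup>2 / 8) * exp (- (x\<^sup>2 / 16)) * gauss (2 * s) x a"
proof -
  let ?y = "(x - a)\<^sup>2"
  let ?A = "exp (c\<^sup>2 / 8) * exp (- (x\<^sup>2 / 16)) * exp (- (?y / (4 * (2 * s))))"
  have "x\<^sup>2 \<le> 2 * ?y + 2 * a\<^sup>2"
    using zero_le_power2[of "x - 2 * a"] by (simp add: power2_eq_square algebra_simps)
  moreover have "a\<^sup>2 \<le> c\<^sup>2" using power_mono[OF assms(3), of 2] by simp
  ultimately have "- (?y / 8) \<le> c\<^sup>2 / 8 - x\<^sup>2 / 16" by simp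
  moreover have "?y / 8 \<le> ?y / (8 * s)" using assms by (intro divide_left_mono) auto
  moreover have "?y / (4 * s) = ?y / (8 * s) + ?y / (4 * (2 * s))" by simp
  ultimately have "- (?y / (4 * s)) \<le> c\<^sup>2 / 8 + - (x\<^sup>2 / 16) + - (?y / (4 * (2 * s)))" by linarith
  then have "exp (- (?y / (4 * s))) \<le> ?A"
    by (simp flip: exp_add)
  then have "gauss s a x \<le> ?A / sqrt (4 * pi * s)"
    unfolding gauss_def using assms by (intro divide_right_mono) auto
  also have "\<dots> = ?A * (1 / sqrt (4 * pi * s))"
    by simp
  also have "1 / sqrt (4 * pi * s) = sqrt 2 / sqrt (4 * pi * (2 * s))"
  proof -
    have "sqrt (4 * pi * (2 * s)) = sqrt 2 * sqrt (4 * pi * s)" by (simp flip: real_sqrt_mult)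
    then show ?thesis by simp
  qed
  also have "?A * (sqrt 2 / sqrt (4 * pi * (2 * s)))
      = sqrt 2 * exp (c\<^sup>2 / 8) * exp (- (x\<^sup>2 / 16)) * gauss (2 * s) x a"
    unfolding gauss_def power2_commute[of a x] by simp
  finally show ?thesis .
qed

definition heat_mass :: "real \<Rightarrow> real \<Rightarrow> real \<Rightarrow> real \<Rightarrow> real" where
  "heat_mass b c s x = (\<integral>a. indicator {b..c} a * heat s a x \<partial>lborel)"

lemma heat_mass_split:
  assumes "0 < s"
  shows "integrable lborel (\<lambda>a. indicator {b..c} a * gauss s x a)"
    and "heat_mass b c s x = gauss_mass {b..c} s x - gauss_mass {b..c} s (- x)"
proof -
  have i: "integrable lborel (\<lambda>a. indicator {b..c} a * gauss s x a)" for x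
    using integrable_mult_indicator[OF _ gauss_integral(1)[OF assms], of "{b..c}" x] by simp
  show "integrable lborel (\<lambda>a. indicator {b..c} a * gauss s x a)" by (rule i)
  have "heat s a x = gauss s x a - gauss s (- x) a" for a
    by (simp add: heat_def gauss_def power2_commute[of a] ) (metis minus_diff_eq minus_add_distrib power2_minus add.commute diff_minus_eq_add)
  then show "heat_mass b c s x = gauss_mass {b..c} s x - gauss_mass {b..c} s (- x)"
    unfolding heat_mass_def using i[of x] i[of "- x"] by (simp add: right_diff_distrib)
qed

lemma heat_mass_bound:
  assumes "0 < s" "s \<le> 1" "0 < b"
  shows "\<bar>heat_mass b c s x\<bar> \<le> sqrt 2 * exp (c\<^sup>2 / 8) * exp (- (x\<^sup>2 / 16))"
proof -
  let ?D = "sqrt 2 * exp (c\<^sup>2 / 8) * exp (- (x\<^sup>2 / 16))"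
  have *: "0 \<le> gauss_mass {b..c} s y"
    "gauss_mass {b..c} s y \<le> ?D" if y: "y\<^sup>2 = x\<^sup>2" for y
  proof -
    show "0 \<le> gauss_mass {b..c} s y"
      by (intro integral_nonneg_AE AE_I2 mult_nonneg_nonneg less_imp_le[OF gauss_pos] assms) auto
    have "gauss_mass {b..c} s y \<le> (\<integral>a. ?D * gauss (2 * s) y a \<partial>lborel)"
    proof (rule integral_mono)
      show "indicator {b..c} a * gauss s y a \<le> ?D * gauss (2 * s) y a" for a
      proof (cases "a \<in> {b..c}")
        case True
        then show ?thesis
          using gauss_decay[of s a c y] assms by (simp add: gauss_commute[of s y a] y)
      qed (use gauss_pos[of "2 * s"] assms in \<open>auto intro: less_imp_le\<close>)
    qed (use heat_mass_split(1) gauss_integral(1) assms in auto)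
    also have "\<dots> = ?D" using gauss_integral(2)[of "2 * s"] assms by simp
    finally show "gauss_mass {b..c} s y \<le> ?D" .
  qed
  from *[of x] *[of "- x"] show ?thesis
    unfolding heat_mass_split(2)[OF assms(1)] by (simp add: abs_le_iff)
qed

lemma heat_mass_limit:
  assumes "0 < b" "0 < x" "x \<noteq> b" "x \<noteq> c"
  shows "((\<lambda>s. heat_mass b c s x) \<longlongrightarrow> indicator {b..c} x) (at_right 0)"
proof -
  have lim0: "((\<lambda>s. \<integral>a. indicator S a * gauss s y a \<partial>lborel) \<longlongrightarrow> 0) (at_right 0)"
    if "S \<in> sets borel" "0 < \<delta>" "\<And>a. a \<in> S \<Longrightarrow> \<delta> \<le> \<bar>a - y\<bar>" for S y \<delta>
  proof (rule tendsto_sandwich[OF _ _ tendsto_const])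
    show "((\<lambda>s. 2 * s / \<delta>\<^sup>2) \<longlongrightarrow> 0) (at_right 0)" using that(2) by (auto intro!: tendsto_eq_intros)
    show "\<forall>\<^sub>F s in at_right 0. 0 \<le> gauss_mass S s y"
      unfolding eventually_at_filter
      by (intro always_eventually allI impI integral_nonneg_AE AE_I2 mult_nonneg_nonneg less_imp_le[OF gauss_pos]) auto
    show "\<forall>\<^sub>F s in at_right 0. gauss_mass S s y \<le> 2 * s / \<delta>\<^sup>2"
      using gauss_tail[OF _ that] by (auto simp: eventually_at_filter)
  qed
  have 1: "((\<lambda>s. \<integral>a. indicator {b..c} a * gauss s x a \<partial>lborel) \<longlongrightarrow> indicator {b..c} x) (at_right 0)"
  proof (cases "x \<in> {b..c}")
    case True
    have "((\<lambda>s. 1 - gauss_mass (- {b..c}) s x) \<longlongrightarrow> 1 - 0) (at_right 0)"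
      using True assms by (intro tendsto_intros lim0[of _ "min (x - b) (c - x)"]) auto
    then have "((\<lambda>s. \<integral>a. indicator {b..c} a * gauss s x a \<partial>lborel) \<longlongrightarrow> 1 - 0) (at_right 0)"
    proof (rule Lim_transform_eventually)
      have "1 - gauss_mass (- {b..c}) s x = gauss_mass {b..c} s x"
        if s: "0 < s" for s
      proof -
        have i: "integrable lborel (\<lambda>a. indicator (- {b..c}) a * gauss s x a)"
          using integrable_mult_indicator[OF _ gauss_integral(1)[OF s], of "- {b..c}" x] by simp
        have "gauss_mass (- {b..c}) s x + gauss_mass {b..c} s x
            = (\<integral>a. indicator (- {b..c}) a * gauss s x a + indicator {b..c} a * gauss s x a \<partial>lborel)"
          using i heat_mass_split(1)[OF s] by (intro Bochner_Integration.integral_add[symmetric])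
        also have "\<dots> = (\<integral>a. gauss s x a \<partial>lborel)"
          by (intro Bochner_Integration.integral_cong) (auto simp: indicator_def)
        also have "\<dots> = 1" by (rule gauss_integral(2)[OF s])
        finally show ?thesis by simp
      qed
      then show "\<forall>\<^sub>F s in at_right 0. 1 - gauss_mass (- {b..c}) s x
          = gauss_mass {b..c} s x"
        by (auto simp: eventually_at_filter)
    qed
    then show ?thesis using True by simp
  next
    case False
    define \<delta> where "\<delta> = (if x < b then b - x else x - c)"
    have "((\<lambda>s. \<integral>a. indicator {b..c} a * gauss s x a \<partial>lborel) \<longlongrightarrow> 0) (at_right 0)"
      using False assms by (intro lim0[of _ \<delta>]) (auto simp: \<delta>_def)
    then show ?thesis using False by simp
  qed
  have 2: "((\<lambda>s. \<integral>a. indicator {b..c} a * gauss s (- x) a \<partial>lborel) \<longlongrightarrow> 0) (at_right 0)"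
    using assms by (intro lim0[of _ b]) auto
  have "((\<lambda>s. gauss_mass {b..c} s x - gauss_mass {b..c} s (- x))
      \<longlongrightarrow> indicator {b..c} x) (at_right 0)"
    using tendsto_diff[OF 1 2] by simp
  then show ?thesis
    by (rule Lim_transform_eventually) (auto simp: eventually_at_filter heat_mass_split(2))
qed

lemma heat_mass_fubini:
  assumes g: "sq_integrable (g :: real \<Rightarrow> real)" and s: "0 < s" "s \<le> 1" and b: "0 < b"
  shows "(\<integral>x. g x * heat_mass b c s x \<partial>halfline) = (\<integral>a. indicator {b..c} a * (\<integral>x. g x * heat s a x \<partial>halfline) \<partial>lborel)"
    and "integrable halfline (\<lambda>x. g x * heat_mass b c s x)"
proof -
  let ?f = "\<lambda>(a, x). indicator {b..c} a * (g x * heat s a x)"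
  let ?D = "2 * (sqrt 2 * exp (c\<^sup>2 / 8)) / sqrt (4 * pi * (2 * s))"
  let ?w = "\<lambda>x. ?D * (\<bar>g x\<bar> * exp (- (1 / 16 * (x - 0)\<^sup>2)))"
  have gm [measurable]: "g \<in> borel_measurable halfline" using g by (simp add: sq_integrable_def)
  have gsnd [measurable]: "(\<lambda>p. g (snd p)) \<in> borel_measurable (lborel \<Otimes>\<^sub>M halfline)"
    by (rule measurable_compose[OF measurable_snd gm])
  have fm: "?f \<in> borel_measurable (lborel \<Otimes>\<^sub>M halfline)"
    unfolding split_beta heat_def gauss_def by measurable
  have w: "integrable halfline ?w"
    using sq_integrable_mult_norm[OF g sq_integrable_exp_square[of "1 / 16" 0]] by (intro integrable_mult_right) simp
  have prod: "integrable (lborel \<Otimes>\<^sub>M halfline) (\<lambda>(a, x). indicator {b..c} a * ?w x)"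
  proof (rule lborel_halfline.Fubini_integrable)
    show "(\<lambda>(a, x). indicator {b..c} a * ?w x) \<in> borel_measurable (lborel \<Otimes>\<^sub>M halfline)"
      unfolding split_beta by measurable
    have "integrable lborel (\<lambda>a. indicator {b..c} a * (\<integral>x. ?w x \<partial>halfline))"
      using emeasure_lborel_cbox_finite[of b c]
      by (intro integrable_mult_left integrable_real_indicator) (auto simp: less_top)
    then show "integrable lborel (\<lambda>a. \<integral>x. norm (case (a, x) of (a, x) \<Rightarrow> indicator {b..c} a * ?w x) \<partial>halfline)"
      using s by (simp add: abs_mult)
    show "AE a in lborel. integrable halfline (\<lambda>x. case (a, x) of (a, x) \<Rightarrow> indicator {b..c} a * ?w x)"
      unfolding prod.case by (intro AE_I2 integrable_mult_right w)
  qed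
  have "integrable (lborel \<Otimes>\<^sub>M halfline) ?f"
  proof (rule Bochner_Integration.integrable_bound[OF prod fm], intro AE_I2, clarify)
    fix a x
    show "norm (indicator {b..c} a * (g x * heat s a x)) \<le> norm (indicator {b..c} a * ?w x)"
    proof (cases "a \<in> {b..c}")
      case True
      have gb: "\<bar>gauss s a' x\<bar> \<le> (sqrt 2 * exp (c\<^sup>2 / 8)) / sqrt (4 * pi * (2 * s)) * exp (- (1 / 16 * (x - 0)\<^sup>2))" if "\<bar>a'\<bar> \<le> c" for a'
      proof -
        have "gauss (2 * s) x a' \<le> 1 / sqrt (4 * pi * (2 * s))"
          unfolding gauss_def using s by (intro divide_right_mono) auto
        then have "sqrt 2 * exp (c\<^sup>2 / 8) * exp (- (x\<^sup>2 / 16)) * gauss (2 * s) x a' \<le>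
            sqrt 2 * exp (c\<^sup>2 / 8) * exp (- (x\<^sup>2 / 16)) * (1 / sqrt (4 * pi * (2 * s)))"
          by (intro mult_left_mono) auto
        then show ?thesis using gauss_decay[OF s that, of x] gauss_pos[OF s(1), of a' x] by simp
      qed
      have "\<bar>heat s a x\<bar> \<le> \<bar>gauss s a x\<bar> + \<bar>gauss s (- a) x\<bar>" by (simp add: heat_def)
      also have "\<dots> \<le> ?D * exp (- (1 / 16 * (x - 0)\<^sup>2))"
        using gb[of a] gb[of "- a"] True b by simp
      finally have "\<bar>g x\<bar> * \<bar>heat s a x\<bar> \<le> \<bar>g x\<bar> * (?D * exp (- (1 / 16 * (x - 0)\<^sup>2)))"
        by (intro mult_left_mono) auto
      then have "\<bar>g x * heat s a x\<bar> \<le> ?w x" by (simp add: abs_mult mult_ac)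
      then have "\<bar>g x * heat s a x\<bar> \<le> \<bar>?w x\<bar>" by (rule order_trans[OF _ abs_ge_self])
      then show ?thesis using True by simp
    qed simp
  qed
  then have int: "integrable (lborel \<Otimes>\<^sub>M halfline) (case_prod (\<lambda>a x. indicator {b..c} a * (g x * heat s a x)))"
    by (simp add: case_prod_unfold)
  have eq: "(\<integral>a. indicator {b..c} a * (g x * heat s a x) \<partial>lborel) = g x * heat_mass b c s x" for x
    unfolding heat_mass_def by (simp add: mult.left_commute flip: Bochner_Integration.integral_mult_right_zero)
  from lborel_halfline.Fubini_integral[OF int]
  show "(\<integral>x. g x * heat_mass b c s x \<partial>halfline) = (\<integral>a. indicator {b..c} a * (\<integral>x. g x * heat s a x \<partial>halfline) \<partial>lborel)"
    by (simp add: eq)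
  from lborel_halfline.integrable_snd[OF int] show "integrable halfline (\<lambda>x. g x * heat_mass b c s x)"
    by (simp add: eq)
qed

lemma AE_nonneg_of_intervals:
  fixes g :: "real \<Rightarrow> real"
  assumes g: "sq_integrable g"
    and int: "\<And>b c. 0 < b \<Longrightarrow> b < c \<Longrightarrow> 0 \<le> (\<integral>x. indicator {b..c} x * g x \<partial>halfline)"
  shows "AE x in halfline. 0 \<le> g x"
proof -
  let ?g = "\<lambda>a b x. indicator (cbox a b) x * g x"
  define f where "f x = indicator {0<..} x * g x" for x
  have gm: "g \<in> borel_measurable halfline" and g2: "integrable halfline (\<lambda>x. (g x)\<^sup>2)"
    using g by (auto simp: sq_integrable_def)
  have i: "integrable halfline (\<lambda>x. ?g a b x)" for a b
  proof (rule Bochner_Integration.integrable_bound)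
    have "integrable lborel (indicator (cbox a b) :: real \<Rightarrow> real)"
      by (intro integrable_real_indicator) (auto simp: emeasure_lborel_Icc_eq)
    then show "integrable halfline (\<lambda>x. indicator (cbox a b) x + (g x)\<^sup>2)"
      using g2 integrable_halfline by (intro Bochner_Integration.integrable_add)
    show "(\<lambda>x. ?g a b x) \<in> borel_measurable halfline"
      by (intro borel_measurable_times[OF borel_measurable_halfline gm]) simp
    have "\<bar>y\<bar> \<le> 1 + y\<^sup>2" for y :: real
      using zero_le_power2[of "\<bar>y\<bar> - 1 / 2"] by (simp add: power2_diff power_divide)
    then show "AE x in halfline. norm (?g a b x) \<le> norm (indicator (cbox a b) x + (g x)\<^sup>2)"
      by (intro AE_I2) (auto simp: indicator_def)
  qed
  have leb: "integrable lebesgue (\<lambda>x. indicator (cbox a b) x *\<^sub>R f x)"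
    "(\<integral>x. indicator (cbox a b) x *\<^sub>R f x \<partial>lebesgue) = (\<integral>x. ?g a b x \<partial>halfline)" for a b
  proof -
    have eq: "indicator (cbox a b) x *\<^sub>R f x = indicator {0<..} x *\<^sub>R (?g a b x)" for x
      by (simp add: f_def)
    show "integrable lebesgue (\<lambda>x. indicator (cbox a b) x *\<^sub>R f x)"
      unfolding eq using i[of a b] by (subst (asm) integrable_restrict_space) auto
    show "(\<integral>x. indicator (cbox a b) x *\<^sub>R f x \<partial>lebesgue) = (\<integral>x. ?g a b x \<partial>halfline)"
      unfolding eq by (subst integral_restrict_space) auto
  qed
  have hk: "f integrable_on cbox a b" "integral (cbox a b) f = (\<integral>x. ?g a b x \<partial>halfline)" for a b
  proof -
    have si: "set_integrable lebesgue (cbox a b) f" using leb(1) by (simp add: set_integrable_def)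
    then show "f integrable_on cbox a b" by (rule set_lebesgue_integral_eq_integral(1))
    show "integral (cbox a b) f = (\<integral>x. ?g a b x \<partial>halfline)"
      using set_lebesgue_integral_eq_integral(2)[OF si] leb(2) by (simp add: set_lebesgue_integral_def)
  qed
  obtain N where N: "negligible N"
    "\<And>x e. x \<notin> N \<Longrightarrow> 0 < e \<Longrightarrow> \<exists>d>0. \<forall>h. 0 < h \<and> h < d \<longrightarrow>
        norm (integral (cbox x (x + h *\<^sub>R One)) f /\<^sub>R h ^ DIM(real) - f x) < e"
    using integrable_ccontinuous_explicit[OF hk(1)] by blast
  have pos: "0 \<le> g x" if xN: "x \<notin> N" and x: "0 < x" for x
  proof (rule ccontr)
    assume "\<not> 0 \<le> g x"
    then have fx: "f x < 0" using x by (simp add: f_def)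
    then obtain d where d: "d > 0" "\<And>h. 0 < h \<Longrightarrow> h < d \<Longrightarrow> norm (integral (cbox x (x + h *\<^sub>R One)) f /\<^sub>R h ^ DIM(real) - f x) < - f x"
      using N(2)[OF xN, of "- f x"] by auto
    define h where "h = d / 2"
    have h: "0 < h" "h < d" using d by (auto simp: h_def)
    have "0 \<le> integral (cbox x (x + h *\<^sub>R One)) f"
      unfolding hk using int[of x "x + h"] x h by simp
    then have "0 \<le> integral (cbox x (x + h *\<^sub>R One)) f /\<^sub>R h ^ DIM(real)"
      using h by simp
    with d(2)[OF h] fx show False by (simp add: abs_if split: if_splits)
  qed
  have "AE x in lebesgue. x \<notin> N"
    using N(1) by (simp add: AE_not_in negligible_iff_null_sets)
  then have "AE x in lebesgue. x \<in> {0<..} \<longrightarrow> 0 \<le> g x"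
    by eventually_elim (use pos in auto)
  then show ?thesis by (subst AE_restrict_space_iff) auto
qed

lemma AE_nonneg_of_heat:
  fixes g :: "real \<Rightarrow> real"
  assumes g: "sq_integrable g"
    and heat: "\<And>s a. 0 < s \<Longrightarrow> 0 < a \<Longrightarrow> 0 \<le> (\<integral>x. g x * heat s a x \<partial>halfline)"
  shows "AE x in halfline. 0 \<le> g x"
proof (rule AE_nonneg_of_intervals[OF g])
  fix b c :: real assume b: "0 < b" "b < c"
  define s where "s n = inverse (real (Suc n))" for n
  have s: "0 < s n" "s n \<le> 1" for n by (auto simp: s_def inverse_le_1_iff)
  have s0: "filterlim s (at_right 0) sequentially"
    unfolding filterlim_at s_def using LIMSEQ_inverse_real_of_nat by auto
  have gm: "g \<in> borel_measurable halfline" using g by (simp add: sq_integrable_def)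
  have "(\<lambda>n. \<integral>x. g x * heat_mass b c (s n) x \<partial>halfline) \<longlonglongrightarrow> (\<integral>x. indicator {b..c} x * g x \<partial>halfline)"
  proof (rule integral_dominated_convergence)
    let ?w = "\<lambda>x. (sqrt 2 * exp (c\<^sup>2 / 8)) * (\<bar>g x\<bar> * exp (- (1 / 16 * (x - 0)\<^sup>2)))"
    show "integrable halfline ?w"
      using sq_integrable_mult_norm[OF g sq_integrable_exp_square[of "1 / 16" 0]] by (intro integrable_mult_right) simp
    show "(\<lambda>x. g x * heat_mass b c (s n) x) \<in> borel_measurable halfline" for n
      using heat_mass_fubini(2)[OF g s b(1)] by (rule borel_measurable_integrable)
    show "(\<lambda>x. indicator {b..c} x * g x) \<in> borel_measurable halfline"
      by (intro borel_measurable_times[OF borel_measurable_halfline gm]) simp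
    have "AE x in lborel. x \<noteq> b \<and> x \<noteq> c"
      using AE_lborel_singleton[of b] AE_lborel_singleton[of c] by eventually_elim auto
    then have "AE x in lebesgue. x \<noteq> b \<and> x \<noteq> c" by (rule AE_completion)
    then have "AE x in lebesgue. x \<in> {0<..} \<longrightarrow> x \<noteq> b \<and> x \<noteq> c" by eventually_elim auto
    then have ne: "AE x in halfline. 0 < x \<and> x \<noteq> b \<and> x \<noteq> c"
      by (subst AE_restrict_space_iff) auto
    then show "AE x in halfline. (\<lambda>n. g x * heat_mass b c (s n) x) \<longlonglongrightarrow> indicator {b..c} x * g x"
    proof eventually_elim
      case (elim x)
      then have "((\<lambda>s. heat_mass b c s x) \<longlongrightarrow> indicator {b..c} x) (at_right 0)"
        using b by (intro heat_mass_limit) auto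
      from tendsto_mult[OF tendsto_const[of "g x"] filterlim_compose[OF this s0]] show ?case
        by (simp add: mult.commute)
    qed
    have "\<bar>g x\<bar> * \<bar>heat_mass b c (s n) x\<bar> \<le> \<bar>g x\<bar> * (sqrt 2 * exp (c\<^sup>2 / 8) * exp (- (x\<^sup>2 / 16)))" for n x
      using heat_mass_bound[OF s b(1)] by (intro mult_left_mono) auto
    then show "AE x in halfline. norm (g x * heat_mass b c (s n) x) \<le> ?w x" for n
      by (intro AE_I2) (simp add: abs_mult mult_ac)
  qed
  moreover have "0 \<le> (\<integral>x. g x * heat_mass b c (s n) x \<partial>halfline)" for n
    unfolding heat_mass_fubini(1)[OF g s b(1)]
    using heat[OF s(1)] b by (intro integral_nonneg_AE AE_I2) (auto simp: indicator_def)
  ultimately show "0 \<le> (\<integral>x. indicator {b..c} x * g x \<partial>halfline)"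
    by (intro LIMSEQ_le_const) auto
qed

lemma C0_semigroup_imp_strongly_continuous:
  "C0_semigroup T \<Longrightarrow> strongly_continuous_semigroup T"
  unfolding C0_semigroup_def strongly_continuous_semigroup_def bounded_operator_def by blast

lemma gen_iff_generator: "gen T u v \<longleftrightarrow> (u, v) \<in> generator T"
  by (simp add: gen_def generator_def)

lemma semigroup_emb_heat:
  fixes T :: "real \<Rightarrow> 'k::{real_normed_field, euclidean_space} l2 \<Rightarrow> 'k l2"
  assumes T: "C0_semigroup T" "generator T = dirichlet_laplacian" and "0 < \<sigma>" "0 \<le> t"
  shows "T t (emb (heat \<sigma> a)) = emb (heat (\<sigma> + t) a)"
proof -
  interpret strongly_continuous_semigroup T
    using T(1) by (rule C0_semigroup_imp_strongly_continuous)
  have "T t (emb (heat (\<sigma> + 0) a)) = emb (heat (\<sigma> + t) a)"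
    using assms
    by (intro orbit_eqI[where v = "\<lambda>s. emb (heat (\<sigma> + s) a)" and w = "\<lambda>s. emb (heat_t (\<sigma> + s) a)"]
        emb_heat_deriv) (auto simp: gen_iff_generator intro!: emb_heat_in_dirichlet_laplacian)
  then show ?thesis by simp
qed

lemma dirichlet_semigroup_symmetric:
  fixes T :: "real \<Rightarrow> 'k::{real_normed_field, euclidean_space} l2 \<Rightarrow> 'k l2"
  assumes T: "C0_semigroup T" "generator T = dirichlet_laplacian" and "0 \<le> t"
  shows "T t f \<bullet> g = f \<bullet> T t g"
  using C0_semigroup_imp_strongly_continuous[OF T(1)] assms(3)
  by (rule semigroup_symmetric) (simp add: gen_iff_generator T(2) dirichlet_laplacian_symmetric)

definition nonneg_l2 :: "'k::{real_normed_field, euclidean_space} l2 \<Rightarrow> bool" where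
  "nonneg_l2 u \<longleftrightarrow> (AE x in halfline. fn_of u x = of_real (norm (fn_of u x)))"

lemma of_real_inner: "(of_real r :: 'k::{real_normed_field, euclidean_space}) \<bullet> z = r * (1 \<bullet> z)"
  by (simp add: of_real_def)

lemma one_inner_one: "(1 :: 'k::{real_normed_field, euclidean_space}) \<bullet> 1 = 1"
  using dot_square_norm[of "1 :: 'k"] by simp

lemma inner_nonneg_l2:
  assumes "nonneg_l2 u" "nonneg_l2 v"
  shows "0 \<le> u \<bullet> v"
  unfolding inner_l2_def
proof (rule integral_nonneg_AE)
  show "AE x in halfline. 0 \<le> fn_of u x \<bullet> fn_of v x"
    using assms unfolding nonneg_l2_def
  proof eventually_elim
    case (elim x)
    show ?case
      by (subst elim(1), subst elim(2)) (simp add: of_real_def one_inner_one)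
  qed
qed

lemma nonneg_l2_emb:
  assumes "sq_integrable f" "\<And>x. 0 < x \<Longrightarrow> 0 \<le> f x"
  shows "nonneg_l2 (emb f :: 'k::{real_normed_field, euclidean_space} l2)"
  unfolding nonneg_l2_def
  using fn_of_emb[OF assms(1), where 'k = 'k] AE_space[of halfline]
  by eventually_elim (simp add: assms(2))

lemma heat_nonneg:
  assumes "0 < s" "0 \<le> a" "0 \<le> x"
  shows "0 \<le> heat s a x"
proof -
  have "(x - a)\<^sup>2 \<le> (x - - a)\<^sup>2"
    using mult_nonneg_nonneg[OF assms(2,3)] by (simp add: power2_eq_square algebra_simps)
  then have "(x - a)\<^sup>2 / (4 * s) \<le> (x - - a)\<^sup>2 / (4 * s)"
    using assms by (intro divide_right_mono) auto
  then show ?thesis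
    unfolding heat_def gauss_def using assms by (simp add: divide_right_mono)
qed

lemma inner_scale_emb:
  fixes u :: "'k::{real_normed_field, euclidean_space} l2"
  assumes "sq_integrable f"
  shows "u \<bullet> scale_l2 \<kappa> (emb f) = (\<integral>x. (fn_of u x \<bullet> \<kappa>) * f x \<partial>halfline)"
  unfolding inner_l2_def
proof (rule integral_cong_AE)
  show "AE x in halfline. fn_of u x \<bullet> fn_of (scale_l2 \<kappa> (emb f)) x = (fn_of u x \<bullet> \<kappa>) * f x"
    using fn_of_scale_l2[of \<kappa> "emb f"] fn_of_emb[OF assms, where 'k='k]
    by eventually_elim (simp add: of_real_def mult.commute)
  show "(\<lambda>x. (fn_of u x \<bullet> \<kappa>) * f x) \<in> borel_measurable halfline"
    using assms by (auto simp: sq_integrable_def)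
qed (rule borel_measurable_integrable, simp)

lemma nonneg_l2I_heat:
  fixes u :: "'k::{real_normed_field, euclidean_space} l2"
  assumes heat: "\<And>\<kappa> s a. 0 \<le> 1 \<bullet> \<kappa> \<Longrightarrow> 0 < s \<Longrightarrow> 0 < a \<Longrightarrow> 0 \<le> u \<bullet> scale_l2 \<kappa> (emb (heat s a))"
  shows "nonneg_l2 u"
proof -
  have *: "AE x in halfline. 0 \<le> fn_of u x \<bullet> \<kappa>" if "0 \<le> 1 \<bullet> \<kappa>" for \<kappa>
  proof (rule AE_nonneg_of_heat)
    have sq: "sq_integrable (\<lambda>x. norm \<kappa> * norm (fn_of u x))"
      by (intro sq_integrable_mult) (simp add: sq_integrable_def)
    have "\<bar>fn_of u x \<bullet> \<kappa>\<bar> \<le> norm \<kappa> * norm (fn_of u x)" for x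
      using Cauchy_Schwarz_ineq2[of "fn_of u x" \<kappa>] by (simp add: mult.commute)
    then show "sq_integrable (\<lambda>x. fn_of u x \<bullet> \<kappa>)"
      by (intro sq_integrable_bound[OF sq]) (auto intro!: AE_I2)
    show "0 \<le> (\<integral>x. (fn_of u x \<bullet> \<kappa>) * heat s a x \<partial>halfline)" if "0 < s" "0 < a" for s a
      using heat[OF \<open>0 \<le> 1 \<bullet> \<kappa>\<close> that] that by (simp add: inner_scale_emb sq_integrable_heat)
  qed
  let ?p = "\<lambda>b. b - (b \<bullet> 1) *\<^sub>R (1 :: 'k)"
  have p: "1 \<bullet> ?p b = 0" for b
    by (simp add: inner_diff_right one_inner_one inner_commute)
  have "AE x in halfline. \<forall>b\<in>Basis. 0 \<le> fn_of u x \<bullet> ?p b"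
    using p by (intro AE_finite_allI *) auto
  moreover have "AE x in halfline. \<forall>b\<in>Basis. 0 \<le> fn_of u x \<bullet> (- ?p b)"
    using p by (intro AE_finite_allI *) (auto simp only: inner_minus_right, auto)
  moreover have "AE x in halfline. 0 \<le> fn_of u x \<bullet> 1"
    by (rule *) (simp add: one_inner_one)
  ultimately show ?thesis
    unfolding nonneg_l2_def
  proof eventually_elim
    case (elim x)
    have "fn_of u x = of_real (fn_of u x \<bullet> 1)"
    proof (rule euclidean_eqI)
      fix b :: 'k assume b: "b \<in> Basis"
      have "fn_of u x \<bullet> ?p b = 0" using bspec[OF elim(1) b] bspec[OF elim(2) b]
        unfolding inner_minus_right by linarith
      then show "fn_of u x \<bullet> b = of_real (fn_of u x \<bullet> 1) \<bullet> b"
        unfolding of_real_inner by (simp add: inner_diff_right inner_commute mult.commute)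
    qed
    then show ?case using elim(3) by (metis abs_of_nonneg norm_of_real)
  qed
qed

lemma dirichlet_semigroup_nonneg:
  fixes T :: "real \<Rightarrow> 'k::{real_normed_field, euclidean_space} l2 \<Rightarrow> 'k l2"
  assumes T: "C0_semigroup T" "generator T = dirichlet_laplacian" and t: "0 \<le> t" and f: "nonneg_l2 f"
  shows "nonneg_l2 (T t f)"
proof (rule nonneg_l2I_heat)
  fix \<kappa> :: 'k and s a :: real assume \<kappa>: "0 \<le> 1 \<bullet> \<kappa>" and s: "0 < s" "0 < a"
  have "T t (scale_l2 \<kappa> (emb (heat s a))) = scale_l2 \<kappa> (emb (heat (s + t) a))"
    using T t s semigroup_emb_heat[OF T s(1) t] unfolding C0_semigroup_def bounded_operator_def by simp
  then have "T t f \<bullet> scale_l2 \<kappa> (emb (heat s a)) = (\<integral>x. (fn_of f x \<bullet> \<kappa>) * heat (s + t) a x \<partial>halfline)"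
    using dirichlet_semigroup_symmetric[OF T t] s t by (simp add: inner_scale_emb sq_integrable_heat)
  also have "\<dots> \<ge> 0"
  proof (rule integral_nonneg_AE)
    show "AE x in halfline. 0 \<le> (fn_of f x \<bullet> \<kappa>) * heat (s + t) a x"
      using f[unfolded nonneg_l2_def] AE_space
    proof eventually_elim
      case (elim x)
      then have "0 \<le> fn_of f x \<bullet> \<kappa>" using \<kappa> by (metis mult_nonneg_nonneg norm_ge_zero of_real_inner)
      moreover have "0 \<le> heat (s + t) a x" using elim s t by (intro heat_nonneg) auto
      ultimately show ?case by simp
    qed
  qed
  finally show "0 \<le> T t f \<bullet> scale_l2 \<kappa> (emb (heat s a))" .
qed

section \<open>Perturbation by a bounded potential\<close>

definition mult_l2 :: "(real \<Rightarrow> real) \<Rightarrow> 'k::{real_normed_field, euclidean_space} l2 \<Rightarrow> 'k l2" where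
  "mult_l2 W u = abs_l2 (\<lambda>x. W x *\<^sub>R fn_of u x)"

locale bounded_potential =
  fixes W :: "real \<Rightarrow> real" and N :: real
  assumes measurable [measurable]: "W \<in> borel_measurable halfline"
    and nonneg: "\<And>x. 0 < x \<Longrightarrow> 0 \<le> W x" and bounded: "\<And>x. 0 < x \<Longrightarrow> W x \<le> N"
begin

lemma sq_integrable_mult_l2:
  fixes u :: "'k::{real_normed_field, euclidean_space} l2"
  shows "sq_integrable (\<lambda>x. W x *\<^sub>R fn_of u x)"
proof (rule sq_integrable_bound)
  show "sq_integrable (\<lambda>x. N *\<^sub>R fn_of u x)" by (simp add: sq_integrable_scaleR)
  show "AE x in halfline. norm (W x *\<^sub>R fn_of u x) \<le> norm (N *\<^sub>R fn_of u x)"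
    using nonneg bounded by (intro AE_I2) (fastforce intro: mult_right_mono)
qed measurable

lemma fn_of_mult_l2: "AE x in halfline. fn_of (mult_l2 W u :: 'k::{real_normed_field, euclidean_space} l2) x = W x *\<^sub>R fn_of u x"
  unfolding mult_l2_def by (rule fn_of_abs_l2[OF sq_integrable_mult_l2])

lemma inner_mult_l2:
  fixes u v :: "'k::{real_normed_field, euclidean_space} l2"
  shows "mult_l2 W u \<bullet> v = (\<integral>x. W x * (fn_of u x \<bullet> fn_of v x) \<partial>halfline)"
  unfolding inner_l2_def
  using fn_of_mult_l2[of u] by (intro integral_cong_AE) (auto elim!: eventually_mono)

lemma mult_l2_symmetric:
  fixes u v :: "'k::{real_normed_field, euclidean_space} l2"
  shows "mult_l2 W u \<bullet> v = u \<bullet> mult_l2 W v"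
  unfolding inner_commute[of u "mult_l2 W v"] inner_mult_l2 by (simp add: inner_commute)

lemma bounded_linear_mult_l2: "bounded_linear (mult_l2 W :: 'k::{real_normed_field, euclidean_space} l2 \<Rightarrow> 'k l2)"
proof (rule bounded_linear_intro)
  fix u v :: "'k l2" and r :: real
  show "mult_l2 W (u + v) = mult_l2 W u + mult_l2 W v"
    unfolding l2_eq_iff
    using fn_of_mult_l2[of "u + v"] fn_of_mult_l2[of u] fn_of_mult_l2[of v] fn_of_add[of u v] fn_of_add[of "mult_l2 W u" "mult_l2 W v"]
    by eventually_elim (simp add: scaleR_add_right)
  show "mult_l2 W (r *\<^sub>R u) = r *\<^sub>R mult_l2 W u"
    unfolding l2_eq_iff
    using fn_of_mult_l2[of "r *\<^sub>R u"] fn_of_mult_l2[of u] fn_of_scaleR[of r u] fn_of_scaleR[of r "mult_l2 W u"]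
    by eventually_elim simp
  have N: "0 \<le> N" using nonneg[of 1] bounded[of 1] by simp
  have "(norm (mult_l2 W u))\<^sup>2 = (\<integral>x. (norm (fn_of (mult_l2 W u) x))\<^sup>2 \<partial>halfline)" by (rule norm_l2_sq)
  also have "\<dots> \<le> (\<integral>x. N\<^sup>2 * (norm (fn_of u x))\<^sup>2 \<partial>halfline)"
  proof (rule integral_mono_AE)
    show "AE x in halfline. (norm (fn_of (mult_l2 W u) x))\<^sup>2 \<le> N\<^sup>2 * (norm (fn_of u x))\<^sup>2"
      using fn_of_mult_l2[of u] AE_space
    proof eventually_elim
      case (elim x)
      then have "(W x)\<^sup>2 \<le> N\<^sup>2" using nonneg bounded by (intro power_mono) auto
      then show ?case using elim by (simp add: power_mult_distrib mult_right_mono)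
    qed
  qed auto
  also have "\<dots> = (norm u * N)\<^sup>2" by (simp add: norm_l2_sq power_mult_distrib mult.commute)
  finally show "norm (mult_l2 W u) \<le> norm u * N" by (rule power2_le_imp_le) (use N in simp)
qed

lemma nonneg_mult_l2:
  assumes "nonneg_l2 u"
  shows "nonneg_l2 (mult_l2 W u)"
  unfolding nonneg_l2_def
  using fn_of_mult_l2[of u] assms[unfolded nonneg_l2_def] AE_space
proof eventually_elim
  case (elim x)
  then have "0 \<le> W x" using nonneg by simp
  then show ?case
    unfolding elim(1) by (subst elim(2)) (simp add: scaleR_conv_of_real norm_mult)
qed

end

lemma bounded_potential_perturbation:
  fixes T R :: "real \<Rightarrow> 'k::{real_normed_field, euclidean_space} l2 \<Rightarrow> 'k l2"
  assumes W: "bounded_potential W N"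
    and T: "generator T = dirichlet_laplacian" and R: "bdd_perturbed_semigroup T (\<lambda>x. - W x) R"
    and u: "gen R u u'" and v: "gen T v v'"
  shows "u' \<bullet> v - u \<bullet> v' = mult_l2 W u \<bullet> v"
proof -
  interpret bounded_potential W N by fact
  from u R obtain w where w: "(u, w) \<in> dirichlet_laplacian"
    "AE x in halfline. fn_of u' x = fn_of w x - (- W x) *\<^sub>R fn_of u x"
    unfolding bdd_perturbed_semigroup_def minus_potential_def gen_iff_generator T by auto
  have "u' = w + mult_l2 W u"
    unfolding l2_eq_iff using w(2) fn_of_mult_l2[of u] fn_of_add[of w "mult_l2 W u"]
    by eventually_elim simp
  moreover have "w \<bullet> v = u \<bullet> v'"
    using w(1) v unfolding gen_iff_generator T by (rule dirichlet_laplacian_symmetric)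
  ultimately show ?thesis by (simp add: inner_add_left)
qed

lemma bounded_perturbation_lower_bound:
  fixes T R :: "real \<Rightarrow> 'k::{real_normed_field, euclidean_space} l2 \<Rightarrow> 'k l2"
  assumes T: "C0_semigroup T" "generator T = dirichlet_laplacian"
    and W: "bounded_potential W N" and W': "bounded_potential W' N'" and le: "\<And>x. 0 < x \<Longrightarrow> W' x \<le> W x"
    and R: "bdd_perturbed_semigroup T (\<lambda>x. - W x) R"
    and t: "0 \<le> t" and f: "nonneg_l2 f" and g: "nonneg_l2 g"
  shows "integral {0..t} (\<lambda>s. mult_l2 W' (T s f) \<bullet> T (t - s) g) \<le> R t f \<bullet> g"
    and "(\<lambda>s. mult_l2 W' (T s f) \<bullet> T (t - s) g) integrable_on {0..t}"
proof -
  interpret W: bounded_potential W N by fact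
  interpret W': bounded_potential W' N' by fact
  have sT: "strongly_continuous_semigroup T" and sR: "strongly_continuous_semigroup R"
    using T R by (auto simp: bdd_perturbed_semigroup_def intro: C0_semigroup_imp_strongly_continuous)
  interpret T: strongly_continuous_semigroup T by (rule sT)
  note P = inner_nonneg_l2 W.nonneg_mult_l2 dirichlet_semigroup_nonneg[OF T]
  note perturb = bounded_potential_perturbation[OF W T(2) R]
  have D: "((\<lambda>s. mult_l2 W (R s f) \<bullet> T (t - s) g) has_integral (R t f \<bullet> g - f \<bullet> T t g)) {0..t}"
    by (rule duhamel[OF sR sT W.bounded_linear_mult_l2 perturb t])
  show int: "(\<lambda>s. mult_l2 W' (T s f) \<bullet> T (t - s) g) integrable_on {0..t}"
    by (intro integrable_continuous_real continuous_on_inner T.continuous_on_apply continuous_intros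
        bounded_linear.continuous_on[OF W'.bounded_linear_mult_l2]) auto
  have le: "mult_l2 W' (T s f) \<bullet> T (t - s) g \<le> mult_l2 W (R s f) \<bullet> T (t - s) g" if s: "s \<in> {0..t}" for s
  proof -
    let ?p = "T (t - s) g"
    have p: "nonneg_l2 ?p" "nonneg_l2 (T s f)" using s f g by (auto intro!: P)
    have "mult_l2 W' (T s f) \<bullet> ?p \<le> mult_l2 W (T s f) \<bullet> ?p"
      unfolding W.inner_mult_l2 W'.inner_mult_l2
    proof (rule integral_mono_AE)
      have i: "integrable halfline (\<lambda>x. X x * (fn_of (T s f) x \<bullet> fn_of ?p x))" if "bounded_potential X M" for X M
      proof -
        interpret X: bounded_potential X M by fact
        have "integrable halfline (\<lambda>x. (X x *\<^sub>R fn_of (T s f) x) \<bullet> fn_of ?p x)"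
          by (intro sq_integrable_inner X.sq_integrable_mult_l2) simp
        then show ?thesis by simp
      qed
      show "integrable halfline (\<lambda>x. W' x * (fn_of (T s f) x \<bullet> fn_of ?p x))" by (rule i[OF W'])
      show "integrable halfline (\<lambda>x. W x * (fn_of (T s f) x \<bullet> fn_of ?p x))" by (rule i[OF W])
      show "AE x in halfline. W' x * (fn_of (T s f) x \<bullet> fn_of ?p x) \<le> W x * (fn_of (T s f) x \<bullet> fn_of ?p x)"
        using p(1)[unfolded nonneg_l2_def] p(2)[unfolded nonneg_l2_def] AE_space
      proof eventually_elim
        case (elim x)
        have "0 \<le> fn_of (T s f) x \<bullet> fn_of ?p x"
          by (subst elim(1), subst elim(2)) (simp add: of_real_def one_inner_one)
        then show ?case using le elim by (intro mult_right_mono) auto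
      qed
    qed
    also have "\<dots> = f \<bullet> T s (mult_l2 W ?p)"
      using s dirichlet_semigroup_symmetric[OF T, of s f] by (simp add: W.mult_l2_symmetric)
    also have "\<dots> \<le> R s f \<bullet> mult_l2 W ?p"
      using perturbed_ge[OF sR sT W.bounded_linear_mult_l2 W.mult_l2_symmetric perturb, of "Collect nonneg_l2" s f "mult_l2 W ?p"]
        s f p P by auto
    also have "\<dots> = mult_l2 W (R s f) \<bullet> ?p" by (simp add: W.mult_l2_symmetric)
    finally show ?thesis .
  qed
  have "integral {0..t} (\<lambda>s. mult_l2 W' (T s f) \<bullet> T (t - s) g) \<le> R t f \<bullet> g - f \<bullet> T t g"
    using integral_le[OF int _ le] D by (auto simp: has_integral_iff)
  moreover have "0 \<le> f \<bullet> T t g" using f g t by (intro P) auto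
  ultimately show "integral {0..t} (\<lambda>s. mult_l2 W' (T s f) \<bullet> T (t - s) g) \<le> R t f \<bullet> g" by simp
qed

lemma bounded_potential_truncation:
  assumes "V \<in> borel_measurable halfline" "\<forall>x>0. V x \<le> 0"
  shows "bounded_potential (\<lambda>x. - max (V x) (- real n)) (real n)"
  by unfold_locales (use assms in \<open>auto simp: max_def\<close>)

lemma perturbed_semigroup_lower_bound:
  fixes T S :: "real \<Rightarrow> 'k::{real_normed_field, euclidean_space} l2 \<Rightarrow> 'k l2" and n :: nat
  assumes T: "C0_semigroup T" "generator T = dirichlet_laplacian"
    and V: "V \<in> borel_measurable halfline" "\<forall>x>0. V x \<le> 0"
    and S: "perturbed_semigroup T V S"
    and t: "0 \<le> t" and f: "nonneg_l2 f" and g: "nonneg_l2 g"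
  defines "W \<equiv> \<lambda>x. - max (V x) (- real n)"
  shows "integral {0..t} (\<lambda>s. mult_l2 W (T s f) \<bullet> T (t - s) g) \<le> S t f \<bullet> g"
    and "(\<lambda>s. mult_l2 W (T s f) \<bullet> T (t - s) g) integrable_on {0..t}"
proof -
  note W = bounded_potential_truncation[OF V]
  obtain R where R: "\<And>n::nat. bdd_perturbed_semigroup T (\<lambda>x. max (V x) (- real n)) (R n)"
    "\<And>u. (\<lambda>n. R n t u) \<longlonglongrightarrow> S t u"
    using S t unfolding perturbed_semigroup_def by blast
  have *: "integral {0..t} (\<lambda>s. mult_l2 W (T s f) \<bullet> T (t - s) g) \<le> R m t f \<bullet> g"
    "(\<lambda>s. mult_l2 W (T s f) \<bullet> T (t - s) g) integrable_on {0..t}" if "n \<le> m" for m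
    using bounded_perturbation_lower_bound[OF T W[of m] W[of n] _ _ t f g, of "R m"] R(1)[of m] that
    by (auto simp: W_def)
  then show "(\<lambda>s. mult_l2 W (T s f) \<bullet> T (t - s) g) integrable_on {0..t}" by blast
  have "(\<lambda>m. R m t f \<bullet> g) \<longlonglongrightarrow> S t f \<bullet> g"
    by (intro tendsto_intros R)
  then show "integral {0..t} (\<lambda>s. mult_l2 W (T s f) \<bullet> T (t - s) g) \<le> S t f \<bullet> g"
    by (rule LIMSEQ_le_const) (use * in blast)
qed

section \<open>Estimates\<close>

lemma two_le_exp_diff: "0 \<le> u \<Longrightarrow> 2 * u \<le> exp u - exp (- u)" for u :: real
proof -
  assume u: "0 \<le> u"
  have 1: "1 + u + u\<^sup>2 / 2 \<le> exp u" using exp_lower_Taylor_quadratic[OF u] .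
  have pos: "0 < 1 + u + u\<^sup>2 / 2" using u by (simp add: add_pos_nonneg)
  have "(1 - u + u\<^sup>2 / 2) * (1 + u + u\<^sup>2 / 2) = 1 + (u\<^sup>2)\<^sup>2 / 4"
    by (simp add: power2_eq_square field_simps)
  then have "1 / (1 + u + u\<^sup>2 / 2) \<le> 1 - u + u\<^sup>2 / 2"
    using pos by (simp add: pos_divide_le_eq)
  moreover have "exp (- u) \<le> 1 / (1 + u + u\<^sup>2 / 2)"
  proof -
    have "1 / exp u \<le> 1 / (1 + u + u\<^sup>2 / 2)" using 1 pos by (intro frac_le) auto
    then show ?thesis by (simp add: exp_minus inverse_eq_divide)
  qed
  ultimately show ?thesis using 1 by linarith
qed

lemma heat_ge:
  assumes "0 < s" "0 \<le> a" "0 \<le> x"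
  shows "exp (- ((x\<^sup>2 + a\<^sup>2) / (4 * s))) * (a * x / s) / sqrt (4 * pi * s) \<le> heat s a x"
proof -
  let ?E = "exp (- ((x\<^sup>2 + a\<^sup>2) / (4 * s)))" and ?u = "a * x / (2 * s)"
  have 1: "exp (- ((x - a)\<^sup>2 / (4 * s))) = ?E * exp ?u"
    using assms(1) by (simp add: power2_diff field_simps flip: exp_add)
  have 2: "exp (- ((x - - a)\<^sup>2 / (4 * s))) = ?E * exp (- ?u)"
    using assms(1) by (simp add: power2_sum field_simps flip: exp_add)
  have "?E * (a * x / s) \<le> ?E * (exp ?u - exp (- ?u))"
    using two_le_exp_diff[of ?u] assms by (intro mult_left_mono) auto
  then have "?E * (a * x / s) / sqrt (4 * pi * s) \<le> ?E * (exp ?u - exp (- ?u)) / sqrt (4 * pi * s)"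
    using assms by (intro divide_right_mono) auto
  also have "\<dots> = heat s a x"
    unfolding heat_def gauss_def 1 2 by (simp add: right_diff_distrib diff_divide_distrib)
  finally show ?thesis .
qed

lemma heat_ge_of_bounds:
  assumes "0 < p" "p \<le> r" "r \<le> q" "0 \<le> a" "0 \<le> x" "x\<^sup>2 + a\<^sup>2 \<le> 2 * p"
  shows "exp (- (1 / 2)) / sqrt (4 * pi) * (a * x / (q * sqrt q)) \<le> heat r a x"
proof -
  have r: "0 < r" "0 < q" using assms(1-3) by auto
  have "(x\<^sup>2 + a\<^sup>2) / (4 * r) \<le> 1 / 2"
  proof -
    have "(x\<^sup>2 + a\<^sup>2) / (4 * r) \<le> (2 * p) / (4 * p)" using assms by (intro frac_le) auto
    then show ?thesis using assms(1) by simp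
  qed
  then have 1: "exp (- (1 / 2)) \<le> exp (- ((x\<^sup>2 + a\<^sup>2) / (4 * r)))" by simp
  have 2: "a * x / q \<le> a * x / r" using assms r by (intro divide_left_mono) auto
  have 3: "exp (- (1 / 2)) * (a * x / q) \<le> exp (- ((x\<^sup>2 + a\<^sup>2) / (4 * r))) * (a * x / r)"
    using 1 2 assms r by (intro mult_mono) auto
  have 4: "sqrt (4 * pi * r) \<le> sqrt (4 * pi) * sqrt q" "0 < sqrt (4 * pi * r)"
    using r mult_left_mono[OF real_sqrt_le_mono[OF assms(3)], of "sqrt (4 * pi)"] by (auto simp: real_sqrt_mult)
  have "exp (- (1 / 2)) * (a * x / q) / (sqrt (4 * pi) * sqrt q) \<le>
      exp (- ((x\<^sup>2 + a\<^sup>2) / (4 * r))) * (a * x / r) / sqrt (4 * pi * r)"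
    using 3 4 assms r by (intro frac_le) auto
  also have "\<dots> \<le> heat r a x" using assms r by (intro heat_ge) auto
  finally show ?thesis by (simp add: mult_ac)
qed

lemma heat_product_ge:
  obtains K where "0 < K" "\<And>a x s t. 0 < a \<Longrightarrow> a \<le> x \<Longrightarrow> 4 * x\<^sup>2 \<le> t \<Longrightarrow> x\<^sup>2 \<le> s \<Longrightarrow> s \<le> 2 * x\<^sup>2 \<Longrightarrow>
    K * a\<^sup>2 / (t * sqrt t) / x \<le> heat (a\<^sup>2 + s) a x * heat (a\<^sup>2 + (t - s)) a x"
proof -
  define e where "e = exp (- (1 / 2)) / sqrt (4 * pi)"
  define K where "K = e / (3 * sqrt 3) * (e / (2 * sqrt 2))"
  have e: "0 < e" by (simp add: e_def)
  show thesis
  proof (rule that)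
    show "0 < K" using e by (simp add: K_def)
    fix a x s t :: real
    assume h: "0 < a" "a \<le> x" "4 * x\<^sup>2 \<le> t" "x\<^sup>2 \<le> s" "s \<le> 2 * x\<^sup>2"
    have x: "0 < x" "0 < x\<^sup>2" "0 < t" using h by (auto intro: less_le_trans[of 0 "4 * x\<^sup>2"])
    have ax: "a\<^sup>2 \<le> x\<^sup>2" using h by (intro power_mono) auto
    have "e * (a * x / (3 * x\<^sup>2 * sqrt (3 * x\<^sup>2))) \<le> heat (a\<^sup>2 + s) a x"
      unfolding e_def
    proof (rule heat_ge_of_bounds[of "x\<^sup>2"])
      show "x\<^sup>2 \<le> a\<^sup>2 + s" "a\<^sup>2 + s \<le> 3 * x\<^sup>2" "x\<^sup>2 + a\<^sup>2 \<le> 2 * x\<^sup>2"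
        using ax h(4,5) zero_le_power2[of a] by linarith+
    qed (use x h in auto)
    moreover have "e * (a * x / (3 * x\<^sup>2 * sqrt (3 * x\<^sup>2))) = e / (3 * sqrt 3) * (a / x\<^sup>2)"
      using x by (simp add: real_sqrt_mult power2_eq_square)
    ultimately have 1: "e / (3 * sqrt 3) * (a / x\<^sup>2) \<le> heat (a\<^sup>2 + s) a x" by simp
    have "e * (a * x / (2 * t * sqrt (2 * t))) \<le> heat (a\<^sup>2 + (t - s)) a x"
      unfolding e_def
    proof (rule heat_ge_of_bounds[of "t / 2"])
      show "t / 2 \<le> a\<^sup>2 + (t - s)" "a\<^sup>2 + (t - s) \<le> 2 * t" "x\<^sup>2 + a\<^sup>2 \<le> 2 * (t / 2)"
        using ax h(3-5) zero_le_power2[of a] by linarith+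
    qed (use x h in auto)
    moreover have "e * (a * x / (2 * t * sqrt (2 * t))) = e / (2 * sqrt 2) * (a * x / (t * sqrt t))"
      by (simp add: real_sqrt_mult)
    ultimately have 2: "e / (2 * sqrt 2) * (a * x / (t * sqrt t)) \<le> heat (a\<^sup>2 + (t - s)) a x" by (simp only:)
    have "(e / (3 * sqrt 3) * (a / x\<^sup>2)) * (e / (2 * sqrt 2) * (a * x / (t * sqrt t))) \<le>
        heat (a\<^sup>2 + s) a x * heat (a\<^sup>2 + (t - s)) a x"
      using h x e by (intro mult_mono 1 2 order_trans[OF _ 1]) auto
    moreover have "(e / (3 * sqrt 3) * (a / x\<^sup>2)) * (e / (2 * sqrt 2) * (a * x / (t * sqrt t))) =
        K * a\<^sup>2 / (t * sqrt t) / x"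
      using x by (simp add: K_def power2_eq_square mult_ac)
    ultimately show "K * a\<^sup>2 / (t * sqrt t) / x \<le> heat (a\<^sup>2 + s) a x * heat (a\<^sup>2 + (t - s)) a x" by simp
  qed
qed

text \<open>The function \<open>x\<close> is harmonic and vanishes at 0, hence its integral against the kernel is
  constant in time.\<close>

lemma heat_first_moment:
  assumes s: "0 < s"
  shows "integrable halfline (\<lambda>x. x * heat s a x)" "(\<integral>x. x * heat s a x \<partial>halfline) = a"
proof -
  have eq: "gauss s a x = normal_density a (sqrt (2 * s)) x" for a x
    using s by (rule gauss_eq_normal_density)
  have \<sigma>: "0 < sqrt (2 * s)" using s by simp
  have i: "integrable lborel (\<lambda>x. x * gauss s a x)" for a
    using integrable_normal_moment_nz_1[OF \<sigma>, of a] by (simp add: eq mult.commute)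
  have iA: "integrable lborel (\<lambda>x. indicator A x * (x * gauss s a x))" if "A \<in> sets borel" for A a
    using integrable_mult_indicator[OF _ i, of A a] that by simp
  have ih: "integrable lborel (\<lambda>x. x * heat s a x)"
    unfolding heat_def right_diff_distrib by (intro Bochner_Integration.integrable_diff i)
  then show "integrable halfline (\<lambda>x. x * heat s a x)" by (rule integrable_halfline)
  have "(\<integral>x. x * heat s a x \<partial>halfline) = (\<integral>x. indicator {0<..} x *\<^sub>R (x * heat s a x) \<partial>lebesgue)"
    by (subst integral_restrict_space) auto
  also have "\<dots> = (\<integral>x. indicator {0<..} x *\<^sub>R (x * heat s a x) \<partial>lborel)"
    using ih by (intro integral_completion) auto
  also have "\<dots> = (\<integral>x. indicator {0<..} x * (x * gauss s a x) \<partial>lborel) - (\<integral>x. indicator {0<..} x * (x * gauss s (- a) x) \<partial>lborel)"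
    unfolding heat_def by (subst Bochner_Integration.integral_diff[symmetric, OF iA iA]) (auto simp: right_diff_distrib)
  also have "(\<integral>x. indicator {0<..} x * (x * gauss s (- a) x) \<partial>lborel) =
      (\<integral>x. indicator {0<..} (0 + (- 1) * x) * ((0 + (- 1) * x) * gauss s (- a) (0 + (- 1) * x)) \<partial>lborel)"
    by (subst lborel_integral_real_affine[of "- 1" _ 0]) simp_all
  also have "\<dots> = - (\<integral>x. indicator {..<0} x * (x * gauss s a x) \<partial>lborel)"
  proof -
    have "gauss s (- a) (- x) = gauss s a x" for x
      by (simp add: gauss_def power2_commute[of a x])
    then have "indicator {0<..} (0 + (- 1) * x) * ((0 + (- 1) * x) * gauss s (- a) (0 + (- 1) * x)) =
        - (indicator {..<0} x * (x * gauss s a x))" for x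
      by (auto simp: indicator_def)
    then show ?thesis by (simp only: Bochner_Integration.integral_minus)
  qed
  also have "(\<integral>x. indicator {0<..} x * (x * gauss s a x) \<partial>lborel) - - (\<integral>x. indicator {..<0} x * (x * gauss s a x) \<partial>lborel)
      = (\<integral>x. indicator {0<..} x * (x * gauss s a x) + indicator {..<0} x * (x * gauss s a x) \<partial>lborel)"
    by (subst Bochner_Integration.integral_add[OF iA iA]) auto
  also have "\<dots> = (\<integral>x. x * gauss s a x \<partial>lborel)"
    by (intro Bochner_Integration.integral_cong) (auto simp: indicator_def)
  also have "\<dots> = a"
    using integral_normal_moment_nz_1[OF \<sigma>, of a] by (simp add: eq mult.commute)
  finally show "(\<integral>x. x * heat s a x \<partial>halfline) = a" .
qed

lemma AE_quadrant_imp: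
  assumes "AE p in quadrant. P p"
  shows "AE x in halfline. AE y in halfline. P (x, y)"
proof -
  have "AE p in lebesgue. p \<in> {0<..} \<times> {0<..} \<longrightarrow> P p"
  proof -
    have "({0<..} \<times> {0<..} :: (real \<times> real) set) \<in> sets borel"
      by (intro borel_open open_Times) auto
    then show ?thesis using assms by (subst (asm) AE_restrict_space_iff) (auto intro: sets_completionI_sets)
  qed
  then have "AE p in lborel \<Otimes>\<^sub>M lborel. p \<in> {0<..} \<times> {0<..} \<longrightarrow> P p"
    unfolding AE_completion_iff lborel_prod .
  then have "AE x in lborel. AE y in lborel. (x, y) \<in> {0<..} \<times> {0<..} \<longrightarrow> P (x, y)"
    by (rule lborel_pair.AE_pair)
  then have "AE x in lebesgue. AE y in lebesgue. (x, y) \<in> {0<..} \<times> {0<..} \<longrightarrow> P (x, y)"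
    by (simp add: AE_completion_iff)
  then have "AE x in lebesgue. x \<in> {0<..} \<longrightarrow> (AE y in halfline. P (x, y))"
    by eventually_elim (subst AE_restrict_space_iff, auto elim: eventually_mono)
  then show ?thesis by (subst AE_restrict_space_iff) auto
qed

lemma kernel_bound_le:
  assumes "0 < t" "0 < x" "0 < y" "0 < c" "0 < \<alpha>" "\<alpha> < 1"
  shows "c * min 1 (x * y / t * (1 + (x - y)\<^sup>2 / (4 * t)) powr (3 * \<alpha> / 4)) * t powr (- 1 / 2) * exp (- ((x - y)\<^sup>2 / (4 * t)))
    \<le> c / (t * sqrt t) * (x * y)"
proof -
  define r where "r = (x - y)\<^sup>2 / (4 * t)"
  have r: "0 \<le> r" using assms by (simp add: r_def)
  have "(1 + r) powr (3 * \<alpha> / 4) \<le> (1 + r) powr 1" using r assms by (intro powr_mono) auto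
  also have "\<dots> \<le> exp r" using r exp_ge_add_one_self[of r] by simp
  finally have p: "(1 + r) powr (3 * \<alpha> / 4) * exp (- r) \<le> 1"
    by (simp add: exp_minus field_simps)
  have st: "t powr (- 1 / 2) = 1 / sqrt t"
    using assms by (simp add: powr_minus_divide powr_half_sqrt)
  have "c * min 1 (x * y / t * (1 + r) powr (3 * \<alpha> / 4)) * t powr (- 1 / 2) * exp (- r)
      \<le> c * (x * y / t * (1 + r) powr (3 * \<alpha> / 4)) * t powr (- 1 / 2) * exp (- r)"
    using assms by (intro mult_right_mono mult_left_mono) auto
  also have "\<dots> = c / (t * sqrt t) * (x * y) * ((1 + r) powr (3 * \<alpha> / 4) * exp (- r))"
    unfolding st by simp
  also have "\<dots> \<le> c / (t * sqrt t) * (x * y) * 1"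
    using assms p by (intro mult_left_mono) auto
  finally show ?thesis by (simp add: r_def)
qed

lemma kernel_inner_le:
  fixes U :: "'k::{real_normed_field, euclidean_space} l2 \<Rightarrow> 'k l2"
  assumes kernel: "integral_kernel k U"
    and bound: "AE (x, y) in quadrant. k x y \<le> C * (x * y)"
    and h: "sq_integrable h" "\<And>x. 0 < x \<Longrightarrow> 0 \<le> h x" "integrable halfline (\<lambda>x. x * h x)"
  shows "U (emb h) \<bullet> emb h \<le> C * (\<integral>x. x * h x \<partial>halfline)\<^sup>2"
proof -
  let ?u = "fn_of (emb h :: 'k l2)" and ?v = "fn_of (U (emb h))"
  let ?A = "\<integral>x. x * h x \<partial>halfline"
  have "U (emb h) \<bullet> emb h = (\<integral>x. (?v x \<bullet> 1) * h x \<partial>halfline)"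
  proof -
    have "scale_l2 1 (emb h :: 'k l2) = emb h"
      unfolding l2_eq_iff using fn_of_scale_l2[of 1 "emb h :: 'k l2"] by simp
    then show ?thesis using inner_scale_emb[OF h(1), of "U (emb h)" 1] by simp
  qed
  also have "\<dots> \<le> (\<integral>x. (C * ?A) * (x * h x) \<partial>halfline)"
  proof (rule integral_mono_AE)
    have "integrable halfline (\<lambda>x. ?v x \<bullet> ?u x)" by simp
    moreover have "AE x in halfline. ?v x \<bullet> ?u x = (?v x \<bullet> 1) * h x"
      using fn_of_emb[OF h(1), where 'k = 'k] by eventually_elim (simp add: of_real_def)
    ultimately show "integrable halfline (\<lambda>x. (?v x \<bullet> 1) * h x)"
      using h(1) by (subst (asm) integrable_cong_AE) (auto simp: sq_integrable_def)
    show "integrable halfline (\<lambda>x. (C * ?A) * (x * h x))" using h by simp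
    have "AE x in halfline. AE y in halfline. k x y \<le> C * (x * y)"
      using AE_quadrant_imp[OF bound] by simp
    moreover have "AE x in halfline. integrable halfline (\<lambda>y. k x y *\<^sub>R ?u y) \<and>
        ?v x = (\<integral>y. k x y *\<^sub>R ?u y \<partial>halfline)"
      using kernel by (simp add: integral_kernel_def)
    ultimately show "AE x in halfline. (?v x \<bullet> 1) * h x \<le> (C * ?A) * (x * h x)"
      using AE_space
    proof eventually_elim
      case (elim x)
      have int: "integrable halfline (\<lambda>y. k x y *\<^sub>R ?u y)" using elim by simp
      have "?v x \<bullet> 1 = (\<integral>y. k x y *\<^sub>R ?u y \<partial>halfline) \<bullet> 1"
        using elim by simp
      also have "\<dots> = (\<integral>y. (k x y *\<^sub>R ?u y) \<bullet> 1 \<partial>halfline)"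
        using int by (intro integral_inner_left[symmetric]) auto
      also have "\<dots> \<le> (\<integral>y. (C * x) * (y * h y) \<partial>halfline)"
      proof (rule integral_mono_AE)
        show "integrable halfline (\<lambda>y. (k x y *\<^sub>R ?u y) \<bullet> 1)"
          using int by (intro integrable_inner_left) auto
        show "integrable halfline (\<lambda>y. (C * x) * (y * h y))" using h by simp
        show "AE y in halfline. (k x y *\<^sub>R ?u y) \<bullet> 1 \<le> (C * x) * (y * h y)"
          using fn_of_emb[OF h(1), where 'k = 'k] elim(1) AE_space
        proof eventually_elim
          case (elim y)
          then have "k x y * h y \<le> C * (x * y) * h y" using h(2) by (intro mult_right_mono) auto
          then show ?case using elim(1) by (simp add: of_real_inner one_inner_one mult_ac)
        qed
      qed
      also have "\<dots> = C * x * ?A" by simp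
      finally have "(?v x \<bullet> 1) * h x \<le> (C * x * ?A) * h x"
        using elim h(2) by (intro mult_right_mono) auto
      then show ?case by (simp add: mult_ac)
    qed
  qed
  also have "\<dots> = C * ?A\<^sup>2" by (simp add: power2_eq_square)
  finally show ?thesis .
qed

lemma heat_duhamel_lower_bound:
  assumes W: "bounded_potential W N"
    and K: "0 < K" "\<And>x s. a \<le> x \<Longrightarrow> 4 * x\<^sup>2 \<le> t \<Longrightarrow> x\<^sup>2 \<le> s \<Longrightarrow> s \<le> 2 * x\<^sup>2 \<Longrightarrow>
        K / x \<le> heat (a\<^sup>2 + s) a x * heat (a\<^sup>2 + (t - s)) a x"
    and ab: "0 < a" "a \<le> b" "4 * b\<^sup>2 \<le> t"
    and I: "((\<lambda>s. mult_l2 W (emb (heat (a\<^sup>2 + s) a) :: 'k::{real_normed_field, euclidean_space} l2)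
        \<bullet> emb (heat (a\<^sup>2 + (t - s)) a)) has_integral I) {0..t}"
  shows "(\<integral>\<^sup>+ x. ennreal (K * (x * W x)) * indicator {a..b} x \<partial>halfline) \<le> ennreal I"
proof -
  interpret W: bounded_potential W N by fact
  let ?u = "\<lambda>s. emb (heat (a\<^sup>2 + s) a) :: 'k l2"
  let ?F = "\<lambda>s. mult_l2 W (?u s) \<bullet> ?u (t - s)"
  let ?p = "\<lambda>s x. W x * (heat (a\<^sup>2 + s) a x * heat (a\<^sup>2 + (t - s)) a x)"
  have F: "(\<integral>\<^sup>+ x. ennreal (?p s x) \<partial>halfline) = ennreal (?F s)" "0 \<le> ?F s" if s: "s \<in> {0..t}" for s
  proof -
    have pos: "0 < a\<^sup>2 + s" "0 < a\<^sup>2 + (t - s)" using ab(1) s by (auto intro: add_pos_nonneg)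
    note sq = sq_integrable_heat[OF pos(1), of a] sq_integrable_heat[OF pos(2), of a]
    have meas: "(\<lambda>x. ?p s x) \<in> borel_measurable halfline"
      using sq by (auto simp: sq_integrable_def)
    have AE: "AE x in halfline. W x * (fn_of (?u s) x \<bullet> fn_of (?u (t - s)) x) = ?p s x"
      using fn_of_emb[OF sq(1), where 'k = 'k] fn_of_emb[OF sq(2), where 'k = 'k]
      by eventually_elim (simp add: of_real_inner one_inner_one of_real_def)
    have eq: "?F s = (\<integral>x. ?p s x \<partial>halfline)"
      unfolding W.inner_mult_l2 by (intro integral_cong_AE AE meas) auto
    have "integrable halfline (\<lambda>x. (W x *\<^sub>R fn_of (?u s) x) \<bullet> fn_of (?u (t - s)) x)"
      by (intro sq_integrable_inner W.sq_integrable_mult_l2) simp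
    then have int: "integrable halfline (\<lambda>x. ?p s x)"
      using AE meas by (subst (asm) integrable_cong_AE) auto
    have nn: "AE x in halfline. 0 \<le> ?p s x"
      using W.nonneg heat_nonneg[OF pos(1)] heat_nonneg[OF pos(2)] ab(1) by (intro AE_I2) auto
    show "(\<integral>\<^sup>+ x. ennreal (?p s x) \<partial>halfline) = ennreal (?F s)"
      unfolding eq using int nn by (rule nn_integral_eq_integral)
    show "0 \<le> ?F s" unfolding eq using nn by (rule integral_nonneg_AE)
  qed
  let ?G = "\<lambda>s x. ennreal (W x * (K / x)) * indicator {a..b} x * indicator {p. (snd p)\<^sup>2 \<le> fst p \<and> fst p \<le> 2 * (snd p)\<^sup>2} (s, x)"
  have Wsnd [measurable]: "(\<lambda>p. W (snd p)) \<in> borel_measurable (lborel \<Otimes>\<^sub>M halfline)"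
    by (rule measurable_compose[OF measurable_snd W.measurable])
  have Gm: "case_prod ?G \<in> borel_measurable (lborel \<Otimes>\<^sub>M halfline)"
  proof -
    have "(\<lambda>p. if a \<le> snd p \<and> snd p \<le> b \<and> (snd p)\<^sup>2 \<le> fst p \<and> fst p \<le> 2 * (snd p)\<^sup>2
        then ennreal (W (snd p) * (K / snd p)) else 0) \<in> borel_measurable (lborel \<Otimes>\<^sub>M halfline)"
      by measurable
    also have "(\<lambda>p. if a \<le> snd p \<and> snd p \<le> b \<and> (snd p)\<^sup>2 \<le> fst p \<and> fst p \<le> 2 * (snd p)\<^sup>2
        then ennreal (W (snd p) * (K / snd p)) else 0) = case_prod ?G"
      by (auto simp: fun_eq_iff indicator_def)
    finally show ?thesis .
  qed
  have "(\<integral>\<^sup>+ x. ennreal (K * (x * W x)) * indicator {a..b} x \<partial>halfline) = (\<integral>\<^sup>+ x. (\<integral>\<^sup>+ s. ?G s x \<partial>lborel) \<partial>halfline)"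
  proof (intro nn_integral_cong)
    fix x assume "x \<in> space halfline"
    then have x: "0 < x" by simp
    have "(\<integral>\<^sup>+ s. ?G s x \<partial>lborel) = (\<integral>\<^sup>+ s. (ennreal (W x * (K / x)) * indicator {a..b} x) * indicator {x\<^sup>2..2 * x\<^sup>2} s \<partial>lborel)"
      by (intro nn_integral_cong) (auto simp: indicator_def)
    also have "\<dots> = (ennreal (W x * (K / x)) * indicator {a..b} x) * ennreal (x\<^sup>2)"
      by (subst nn_integral_cmult_indicator) auto
    also have "\<dots> = ennreal (W x * (K / x) * x\<^sup>2) * indicator {a..b} x"
      using W.nonneg[OF x] K(1) x by (subst ennreal_mult) (auto simp: mult_ac)
    also have "W x * (K / x) * x\<^sup>2 = K * (x * W x)" using x by (simp add: power2_eq_square)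
    finally show "ennreal (K * (x * W x)) * indicator {a..b} x = (\<integral>\<^sup>+ s. ?G s x \<partial>lborel)" by simp
  qed
  also have "\<dots> = (\<integral>\<^sup>+ s. (\<integral>\<^sup>+ x. ?G s x \<partial>halfline) \<partial>lborel)"
    by (rule lborel_halfline.Fubini'[OF Gm])
  also have "\<dots> \<le> (\<integral>\<^sup>+ s. ennreal (?F s) * indicator {0..t} s \<partial>lborel)"
  proof (intro nn_integral_mono)
    fix s :: real
    show "(\<integral>\<^sup>+ x. ?G s x \<partial>halfline) \<le> ennreal (?F s) * indicator {0..t} s"
    proof (cases "s \<in> {0..t}")
      case True
      have "(\<integral>\<^sup>+ x. ?G s x \<partial>halfline) \<le> (\<integral>\<^sup>+ x. ennreal (?p s x) \<partial>halfline)"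
      proof (intro nn_integral_mono)
        fix x assume "x \<in> space halfline"
        then have x: "0 < x" by simp
        show "?G s x \<le> ennreal (?p s x)"
        proof (cases "a \<le> x \<and> x \<le> b \<and> x\<^sup>2 \<le> s \<and> s \<le> 2 * x\<^sup>2")
          case h: True
          have "x\<^sup>2 \<le> b\<^sup>2" using h x by (intro power_mono) auto
          then have "4 * x\<^sup>2 \<le> t" using ab(3) by linarith
          then have "K / x \<le> heat (a\<^sup>2 + s) a x * heat (a\<^sup>2 + (t - s)) a x"
            using h ab by (intro K(2)) auto
          then have "W x * (K / x) \<le> ?p s x" using W.nonneg[OF x] by (rule mult_left_mono)
          then show ?thesis using h by (simp add: ennreal_leI)
        qed (auto simp: indicator_def)
      qed
      then show ?thesis using True by (simp add: F)
    next
      case False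
      have "?G s x = 0" if "0 < x" for x
      proof (cases "a \<le> x \<and> x \<le> b \<and> x\<^sup>2 \<le> s \<and> s \<le> 2 * x\<^sup>2")
        case h: True
        have "x\<^sup>2 \<le> b\<^sup>2" using h that by (intro power_mono) auto
        moreover have "0 \<le> x\<^sup>2" by simp
        ultimately have "0 \<le> s" "s \<le> t" using h ab(3) by linarith+
        then show ?thesis using False by simp
      qed (auto simp: indicator_def)
      then have "(\<integral>\<^sup>+ x. ?G s x \<partial>halfline) = (\<integral>\<^sup>+ x. 0 \<partial>halfline)"
        by (intro nn_integral_cong) simp
      then show ?thesis by simp
    qed
  qed
  also have "\<dots> = ennreal I"
    using F(2) I by (intro nn_integral_has_integral_lebesgue')
  finally show ?thesis .
qed

theorem theorem4p10:
  fixes T T\<^sub>V :: "real \<Rightarrow> 'k::{real_normed_field, euclidean_space} l2 \<Rightarrow> 'k l2"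
    and V :: "real \<Rightarrow> real"
    and k :: "real \<Rightarrow> real \<Rightarrow> real \<Rightarrow> real"
    and \<alpha> c :: real
  assumes T: "C0_semigroup T" "generator T = dirichlet_laplacian"
    and V: "V \<in> borel_measurable halfline" "\<forall>x>0. V x \<le> 0"
    and admissible: "admissible T V"
    and T\<^sub>V: "perturbed_semigroup T V T\<^sub>V"
    and \<alpha>: "0 < \<alpha>" "\<alpha> < 1"
    and kernel: "\<forall>t>0. L_infinity_quadrant (k t) \<and> integral_kernel (k t) (T\<^sub>V t)"
    and c: "c > 0"
    and bound: "\<forall>t>0. AE (x, y) in quadrant.
      0 \<le> k t x y \<and>
      k t x y \<le> c * min 1 (x * y / t * (1 + (x - y)\<^sup>2 / (4 * t)) powr (3 * \<alpha> / 4))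
        * t powr (- 1 / 2) * exp (- ((x - y)\<^sup>2 / (4 * t)))"
  shows "(\<integral>\<^sup>+ x. ennreal (x * \<bar>V x\<bar>) \<partial>halfline) < \<infinity>"
proof -
  obtain K where K: "0 < K" "\<And>a x s t. 0 < a \<Longrightarrow> a \<le> x \<Longrightarrow> 4 * x\<^sup>2 \<le> t \<Longrightarrow> x\<^sup>2 \<le> s \<Longrightarrow> s \<le> 2 * x\<^sup>2 \<Longrightarrow>
      K * a\<^sup>2 / (t * sqrt t) / x \<le> heat (a\<^sup>2 + s) a x * heat (a\<^sup>2 + (t - s)) a x"
    using heat_product_ge by blast
  define W where "W n x = - max (V x) (- real n)" for n x
  have W: "bounded_potential (W n) (real n)" for n
    unfolding W_def by (rule bounded_potential_truncation[OF V])
  have [measurable]: "W n \<in> borel_measurable halfline" for n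
    using W[of n] by (simp add: bounded_potential_def)
  note borel_measurable_ident_halfline [measurable]
  have [measurable]: "(\<lambda>x. indicator {a..b} x :: ennreal) \<in> borel_measurable halfline" for a b :: real
    by (rule borel_measurable_halfline) simp
  have main: "(\<integral>\<^sup>+ x. ennreal (x * W n x) * indicator {a..b} x \<partial>halfline) \<le> ennreal (c / K)"
    if ab: "0 < a" "a \<le> b" for a b n
  proof -
    define t where "t = 4 * b\<^sup>2"
    have t: "0 < t" using ab by (simp add: t_def)
    define q where "q = a\<^sup>2 / (t * sqrt t)"
    have q: "0 < q" using ab t by (simp add: q_def)
    let ?J = "\<integral>\<^sup>+ x. ennreal (K * q * (x * W n x)) * indicator {a..b} x \<partial>halfline"
    let ?h = "heat (a\<^sup>2) a"
    have a2: "0 < a\<^sup>2" using ab by simp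
    have h: "sq_integrable ?h" "\<And>x. 0 < x \<Longrightarrow> 0 \<le> ?h x"
      using sq_integrable_heat[OF a2] heat_nonneg[OF a2] ab by auto
    have f: "nonneg_l2 (emb ?h :: 'k l2)" using h by (rule nonneg_l2_emb)
    define I where "I = integral {0..t} (\<lambda>s. mult_l2 (W n) (T s (emb ?h)) \<bullet> T (t - s) (emb ?h))"
    have "((\<lambda>s. mult_l2 (W n) (T s (emb ?h)) \<bullet> T (t - s) (emb ?h)) has_integral I) {0..t}"
      using perturbed_semigroup_lower_bound(2)[OF T V T\<^sub>V _ f f, of t n] t
      unfolding I_def W_def by (intro integrable_integral) simp
    then have I: "((\<lambda>s. mult_l2 (W n) (emb (heat (a\<^sup>2 + s) a) :: 'k l2) \<bullet> emb (heat (a\<^sup>2 + (t - s)) a)) has_integral I) {0..t}"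
      by (rule has_integral_eq[rotated]) (simp add: semigroup_emb_heat[OF T a2])
    have "?J \<le> ennreal I"
    proof (rule heat_duhamel_lower_bound[OF W _ _ ab(1,2) _ I])
      show "K * q / x \<le> heat (a\<^sup>2 + s) a x * heat (a\<^sup>2 + (t - s)) a x"
        if "a \<le> x" "4 * x\<^sup>2 \<le> t" "x\<^sup>2 \<le> s" "s \<le> 2 * x\<^sup>2" for x s
        using K(2)[OF ab(1) that] by (simp add: q_def)
    qed (use K(1) q in \<open>auto simp: t_def\<close>)
    also have "I \<le> T\<^sub>V t (emb ?h) \<bullet> emb ?h"
      using perturbed_semigroup_lower_bound(1)[OF T V T\<^sub>V _ f f, of t n] t unfolding I_def W_def by simp
    also have "\<dots> \<le> c / (t * sqrt t) * (\<integral>x. x * ?h x \<partial>halfline)\<^sup>2"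
    proof (rule kernel_inner_le[OF _ _ h heat_first_moment(1)[OF a2]])
      show "integral_kernel (k t) (T\<^sub>V t)" using kernel t by blast
      have "AE p in quadrant. p \<in> {0<..} \<times> {0<..}"
        by (rule AE_I2) (simp add: space_restrict_space)
      then show "AE (x, y) in quadrant. k t x y \<le> c / (t * sqrt t) * (x * y)"
        using bound[rule_format, OF t]
      proof eventually_elim
        case (elim p)
        then show ?case
          using kernel_bound_le[OF t _ _ c \<alpha>, of "fst p" "snd p"] by (auto simp: case_prod_beta)
      qed
    qed
    also have "\<dots> = c * q"
      by (simp add: heat_first_moment(2)[OF a2] q_def)
    finally have le: "?J \<le> ennreal (c * q)"
      by (simp add: ennreal_leI)
    have "(\<integral>\<^sup>+ x. ennreal (x * W n x) * indicator {a..b} x \<partial>halfline)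
        = (\<integral>\<^sup>+ x. ennreal (1 / (K * q)) * (ennreal (K * q * (x * W n x)) * indicator {a..b} x) \<partial>halfline)"
    proof (intro nn_integral_cong)
      fix x assume "x \<in> space halfline"
      then have "0 \<le> x * W n x" using bounded_potential.nonneg[OF W[of n], of x] by simp
      then have "ennreal (1 / (K * q)) * ennreal (K * q * (x * W n x)) = ennreal (x * W n x)"
        using K(1) q by (simp flip: ennreal_mult)
      then show "ennreal (x * W n x) * indicator {a..b} x
          = ennreal (1 / (K * q)) * (ennreal (K * q * (x * W n x)) * indicator {a..b} x)"
        by (simp flip: mult.assoc)
    qed
    also have "\<dots> = ennreal (1 / (K * q)) * ?J"
      by (rule nn_integral_cmult) measurable
    also have "\<dots> \<le> ennreal (1 / (K * q)) * ennreal (c * q)"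
      by (rule mult_left_mono[OF le]) simp
    also have "\<dots> = ennreal (c / K)"
      using K(1) q c by (simp flip: ennreal_mult)
    finally show ?thesis .
  qed
  let ?\<phi> = "\<lambda>n x. ennreal (x * W n x) * indicator {inverse (real (Suc n))..real (Suc n)} x"
  have "(\<integral>\<^sup>+ x. ennreal (x * \<bar>V x\<bar>) \<partial>halfline) = (\<integral>\<^sup>+ x. liminf (\<lambda>n. ?\<phi> n x) \<partial>halfline)"
  proof (intro nn_integral_cong)
    fix x assume "x \<in> space halfline"
    then have x: "0 < x" by simp
    have "eventually (\<lambda>n. inverse (real (Suc n)) < x) sequentially"
      using LIMSEQ_inverse_real_of_nat x by (rule order_tendstoD)
    moreover have "eventually (\<lambda>n. max x (- V x) \<le> real n) sequentially"
      using filterlim_real_sequentially unfolding filterlim_at_top by blast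
    ultimately have "eventually (\<lambda>n. ennreal (x * \<bar>V x\<bar>) = ?\<phi> n x) sequentially"
    proof eventually_elim
      case (elim n)
      have "max (V x) (- real n) = V x" using elim(2) by (intro max_absorb1) simp
      then have "W n x = \<bar>V x\<bar>" using V(2) x by (simp add: W_def)
      moreover have "indicator {inverse (real (Suc n))..real (Suc n)} x = (1 :: ennreal)"
        using elim by (simp add: indicator_def)
      ultimately show ?case by simp
    qed
    then have "(\<lambda>n. ?\<phi> n x) \<longlonglongrightarrow> ennreal (x * \<bar>V x\<bar>)"
      by (rule Lim_transform_eventually[OF tendsto_const])
    then show "ennreal (x * \<bar>V x\<bar>) = liminf (\<lambda>n. ?\<phi> n x)"
      by (simp add: lim_imp_Liminf)
  qed
  also have "\<dots> \<le> liminf (\<lambda>n. \<integral>\<^sup>+ x. ?\<phi> n x \<partial>halfline)"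
    by (rule nn_integral_liminf) measurable
  also have "\<dots> \<le> limsup (\<lambda>n. \<integral>\<^sup>+ x. ?\<phi> n x \<partial>halfline)"
    by (rule Liminf_le_Limsup) simp
  also have "\<dots> \<le> ennreal (c / K)"
  proof (rule Limsup_bounded, intro always_eventually allI)
    fix n
    have "inverse (real (Suc n)) \<le> 1" by (simp add: inverse_le_1_iff)
    also have "1 \<le> real (Suc n)" by simp
    finally show "(\<integral>\<^sup>+ x. ?\<phi> n x \<partial>halfline) \<le> ennreal (c / K)"
      by (rule main[rotated]) (simp only: inverse_positive_iff_positive of_nat_0_less_iff zero_less_Suc)
  qed
  finally show ?thesis by (rule order_le_less_trans) simp
qed

end
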